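(* Let $\rho_0\in\mathbb{C}^{m\times m}$ be Hermitian and positive semidefinite with $\mathrm{Tr}(\rho_0)=1$, and let $\rho:[0,T]\to\mathbb{C}^{m\times m}$ be the solution of the Lindblad equation $$\dot\rho(t)=-i[H,\rho(t)]+\sum_{k=1}^K\gamma_k\left(L_k\rho(t)L_k^{\dagger}-\frac12\left\{L_k^{\dagger}L_k,\rho(t)\right\}\right),\qquad \rho(0)=\rho_0.$$ Let $\varrho_0=Z_0Z_0^{\dagger}$ with $Z_0\in\mathbb{C}^{m\times r_0}$, $\mathrm{Tr}(\varrho_0)=1$ and $\|\rho_0-\varrho_0\|_1\le\delta$ for some $\delta>0$, and let $\{\varrho_n\}_{n=0}^N$, $\varrho_n=Z_nZ_n^{\dagger}$, be the numerical solution generated by the LREE scheme described in the context. Assume that the matrix exponential approximation $\mathfrak{e}^{\tau A}$ used in the scheme satisfies $$\|e^{\tau A}\sigma e^{\tau A^{\dagger}}-\mathfrak{e}^{\tau A}\sigma(\mathfrak{e}^{\tau A})^{\dagger}\|_1\le C_3\,tol_1\,\|\sigma\|_1\qquad\text{for any }\sigma\in\mathbb{C}^{m\times m},$$ and that the error tolerances of the matrix exponential algorithm and of the column compression satisfy $tol_1=\tau\epsilon_1$ and $tol_2=\tau\epsilon_2$ for some $\epsilon_1,\epsilon_2>0$, respectively. Then $$\|\rho(t_n)-\varrho_n\|_1\le\tilde c_1\,t_n\,\tau+\delta+2c_2\,t_n\epsilon_1+2\,t_n\epsilon_2,\qquad 0\le n\le N,$$ where $\tilde c_1=c_1+2C_1C_2$,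 $c_1=\frac12C_1^2+C_1C_2+\frac13C_1C_2^2T$ and $c_2=(1+TC_1)C_3$.
   Context: $m,K,N,r_0$ are positive integers, $T>0$, $\tau=T/N$, $t_n=n\tau$. $H\in\mathbb{C}^{m\times m}$ is Hermitian; $L_1,\dots,L_K\in\mathbb{C}^{m\times m}$ are arbitrary; $\gamma_1,\dots,\gamma_K\ge0$ are real; $\dagger$ is the conjugate transpose; $[X,Y]=XY-YX$, $\{X,Y\}=XY+YX$; $$A=-iH-\frac12\sum_{k=1}^K\gamma_kL_k^{\dagger}L_k .$$ $\|\cdot\|_1$ is the trace (Schatten-1) norm (sum of the singular values), $\|\cdot\|_F$ the Frobenius norm. $C_1=\sum_{k=1}^K\gamma_k\|L_k\|_1^2$, $C_2=\|A\|_1$, and $C_3>0$ is a constant. $\mathfrak{e}^{\tau A}\in\mathbb{C}^{m\times m}$ denotes an approximation of the matrix exponential $e^{\tau A}$ computed with error tolerance $tol_1>0$ (in the paper's notation $\mathfrak{e}^{\tau A^{\dagger}}$ stands for $(\mathfrak{e}^{\tau A})^{\dagger}$). Column compression: for $tol_2>0$ and $Z\in\mathbb{C}^{m\times q}$ with singular values $\sigma_1(Z)\ge\sigma_2(Z)\ge\cdots$ (set to $0$ beyond index $\min(m,q)$), let $r$ be the minimal integer with $\sum_{j=r+1}^q\sigma_j^2(Z)\le tol_2$. Then $\mathcal{T}_{tol_2}(Z)$ is the best rank-$r$ approximation of $Z$ in Frobenius norm obtained by truncating a singular value decomposition $Z=\sum_j\sigma_ju_jv_j^{\dagger}$ to its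 first $r$ terms; it may be stored equivalently by the columns $\sigma_ju_j$, $j\le r$, since only $\mathcal{T}_{tol_2}(Z)\mathcal{T}_{tol_2}(Z)^{\dagger}=\sum_{j\le r}\sigma_j^2u_ju_j^{\dagger}$ matters. LREE (low-rank exponential Euler) scheme: starting from $Z_0$, for $n=0,\dots,N-1$, $$V_n=\mathfrak{e}^{\tau A}Z_n,\quad \tilde Z_{n+1}=\left[V_n,\sqrt{\gamma_1\tau}L_1V_n,\ldots,\sqrt{\gamma_K\tau}L_KV_n\right],\quad \hat Z_{n+1}=\mathcal{T}_{tol_2}(\tilde Z_{n+1}),\quad Z_{n+1}=\frac{\hat Z_{n+1}}{\|\hat Z_{n+1}\|_F},$$ where $[\cdot,\ldots,\cdot]$ places blocks side by side, and $\varrho_n=Z_nZ_n^{\dagger}$. The scheme is assumed well defined, i.e. $\hat Z_{n+1}\ne0$ for all $0\le n\le N-1$. *)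

theory Defs
  imports
    "Jordan_Normal_Form.Char_Poly"
    "Jordan_Normal_Form.Schur_Decomposition"
    "HOL-Computational_Algebra.Fundamental_Theorem_Algebra"
begin

section \<open>Matrices\<close>

definition mat_trace :: "complex mat \<Rightarrow> complex" where
  "mat_trace A = (\<Sum>i<dim_row A. A $$ (i, i))"

definition hermitian_mat :: "complex mat \<Rightarrow> bool" where
  "hermitian_mat A \<longleftrightarrow> square_mat A \<and> mat_adjoint A = A"

definition psd_mat :: "complex mat \<Rightarrow> bool" where
  "psd_mat A \<longleftrightarrow> hermitian_mat A \<and>
     (\<forall>v \<in> carrier_vec (dim_row A). 0 \<le> Re ((A *\<^sub>v v) \<bullet>c v))"

text \<open>The type of matrices of all sizes has no additive unit, hence an explicit size for sums.\<close>

definition mat_sum :: "nat \<Rightarrow> nat \<Rightarrow> nat set \<Rightarrow> (nat \<Rightarrow> complex mat) \<Rightarrow> complex mat" where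
  "mat_sum nr nc I F = mat nr nc (\<lambda>(i, j). \<Sum>k\<in>I. F k $$ (i, j))"

definition mat_exp :: "complex mat \<Rightarrow> complex mat" where
  "mat_exp A = mat (dim_row A) (dim_row A)
     (\<lambda>(i, j). \<Sum>k. (A ^\<^sub>m k) $$ (i, j) / fact k)"

definition frob_norm :: "complex mat \<Rightarrow> real" where
  "frob_norm A = sqrt (\<Sum>i<dim_row A. \<Sum>j<dim_col A. (cmod (A $$ (i, j)))\<^sup>2)"

text \<open>\<open>[B\<^sub>1, \<dots>, B\<^sub>s]\<close>: blocks with \<open>nr\<close> rows placed side by side.\<close>

definition hcat :: "nat \<Rightarrow> complex mat list \<Rightarrow> complex mat" where
  "hcat nr Bs = mat_of_cols nr (concat (map cols Bs))"


section \<open>Singular values and column compression\<close>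

text \<open>
  For a matrix \<open>Z\<close> with \<open>q\<close> columns this is the list, in decreasing order, of the square roots of
  the \<open>q\<close> eigenvalues (with algebraic multiplicity) of the Gram matrix of \<open>Z\<close>. These eigenvalues
  are real and nonnegative, so \<^const>\<open>Re\<close> only changes the type.
\<close>

definition gram_roots :: "complex mat \<Rightarrow> real list" where
  "gram_roots Z = rev (sorted_list_of_multiset
     (image_mset (\<lambda>x. sqrt (Re x)) (proots (char_poly (mat_adjoint Z * Z)))))"

text \<open>Indices start at 0: \<open>sing_val Z j\<close> is the \<open>(j+1)\<close>-st largest singular value.\<close>

definition sing_val :: "complex mat \<Rightarrow> nat \<Rightarrow> real" where
  "sing_val Z j = (if j < min (dim_row Z) (dim_col Z) then gram_roots Z ! j else 0)"

definition trace_norm :: "complex mat \<Rightarrow> real" where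
  "trace_norm Z = (\<Sum>j<min (dim_row Z) (dim_col Z). sing_val Z j)"

text \<open>\<open>Z = \<Sum>\<^sub>j \<sigma>\<^sub>j u\<^sub>j v\<^sub>j\<^sup>\<dagger>\<close>, where \<open>u\<^sub>j\<close> and \<open>v\<^sub>j\<close> are the (orthonormal) columns of \<open>U\<close> and \<open>V\<close>.\<close>

definition is_svd :: "complex mat \<Rightarrow> complex mat \<Rightarrow> complex mat \<Rightarrow> bool" where
  "is_svd Z U V \<longleftrightarrow>
     (let p = min (dim_row Z) (dim_col Z) in
        U \<in> carrier_mat (dim_row Z) p \<and> V \<in> carrier_mat (dim_col Z) p \<and>
        mat_adjoint U * U = 1\<^sub>m p \<and> mat_adjoint V * V = 1\<^sub>m p \<and>
        Z = U * mat_diag p (\<lambda>j. complex_of_real (sing_val Z j)) * mat_adjoint V)"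

definition trunc_rank :: "real \<Rightarrow> complex mat \<Rightarrow> nat" where
  "trunc_rank tol Z = (LEAST r. (\<Sum>j\<in>{r..<dim_col Z}. (sing_val Z j)\<^sup>2) \<le> tol)"

definition first_cols :: "nat \<Rightarrow> complex mat \<Rightarrow> complex mat" where
  "first_cols r M = mat (dim_row M) r (\<lambda>(i, j). M $$ (i, j))"

text \<open>
  A singular value decomposition is not unique, so compression is a relation between \<open>Z\<close> and its
  possible compressions \<open>Zc\<close>. The result may be stored either as the columns \<open>\<sigma>\<^sub>j u\<^sub>j\<close>, \<open>j \<le> r\<close>
  (the matrix \<open>W\<close>), or as the full rank-\<open>r\<close> matrix \<open>\<Sum>\<^sub>j\<^sub>\<le>\<^sub>r \<sigma>\<^sub>j u\<^sub>j v\<^sub>j\<^sup>\<dagger>\<close>.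
\<close>

definition column_compression :: "real \<Rightarrow> complex mat \<Rightarrow> complex mat \<Rightarrow> bool" where
  "column_compression tol Z Zc \<longleftrightarrow>
     (\<exists>U V. is_svd Z U V \<and>
        (let r = trunc_rank tol Z;
             W = first_cols r U * mat_diag r (\<lambda>j. complex_of_real (sing_val Z j))
         in Zc = W \<or> Zc = W * mat_adjoint (first_cols r V)))"


section \<open>The Lindblad equation\<close>

definition lindblad_rhs ::
  "nat \<Rightarrow> nat \<Rightarrow> complex mat \<Rightarrow> (nat \<Rightarrow> real) \<Rightarrow> (nat \<Rightarrow> complex mat) \<Rightarrow> complex mat \<Rightarrow> complex mat"
  where
  "lindblad_rhs m K H \<gamma> L X =
     (- \<i>) \<cdot>\<^sub>m (H * X - X * H) +
     mat_sum m m {1..K} (\<lambda>k. complex_of_real (\<gamma> k) \<cdot>\<^sub>m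
       (L k * X * mat_adjoint (L k) -
        (1/2) \<cdot>\<^sub>m (mat_adjoint (L k) * L k * X + X * (mat_adjoint (L k) * L k))))"

text \<open>The type of matrices carries no topology; the derivative is taken entrywise (and is
  one-sided at the end points of the interval).\<close>

definition lindblad_solution ::
  "nat \<Rightarrow> nat \<Rightarrow> complex mat \<Rightarrow> (nat \<Rightarrow> real) \<Rightarrow> (nat \<Rightarrow> complex mat) \<Rightarrow> real \<Rightarrow>
   complex mat \<Rightarrow> (real \<Rightarrow> complex mat) \<Rightarrow> bool"
  where
  "lindblad_solution m K H \<gamma> L T \<rho>0 \<rho> \<longleftrightarrow>
     \<rho> 0 = \<rho>0 \<and>
     (\<forall>t\<in>{0..T}. \<rho> t \<in> carrier_mat m m \<and>
        (\<forall>i<m. \<forall>j<m. ((\<lambda>s. \<rho> s $$ (i, j)) has_vector_derivative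
           lindblad_rhs m K H \<gamma> L (\<rho> t) $$ (i, j)) (at t within {0..T})))"

definition drift_mat ::
  "nat \<Rightarrow> nat \<Rightarrow> complex mat \<Rightarrow> (nat \<Rightarrow> real) \<Rightarrow> (nat \<Rightarrow> complex mat) \<Rightarrow> complex mat" where
  "drift_mat m K H \<gamma> L =
     (- \<i>) \<cdot>\<^sub>m H -
     (1/2) \<cdot>\<^sub>m mat_sum m m {1..K} (\<lambda>k. complex_of_real (\<gamma> k) \<cdot>\<^sub>m (mat_adjoint (L k) * L k))"


section \<open>The low-rank exponential Euler scheme\<close>

text \<open>\<open>E\<close> is the approximation of the exponential of \<open>\<tau> A\<close>.\<close>

definition lree_expand ::
  "nat \<Rightarrow> nat \<Rightarrow> (nat \<Rightarrow> real) \<Rightarrow> (nat \<Rightarrow> complex mat) \<Rightarrow> real \<Rightarrow> complex mat \<Rightarrow>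
   complex mat \<Rightarrow> complex mat" where
  "lree_expand m K \<gamma> L \<tau> E Z =
     (let V = E * Z in
      hcat m (V # map (\<lambda>k. complex_of_real (sqrt (\<gamma> k * \<tau>)) \<cdot>\<^sub>m (L k * V)) [1..<Suc K]))"

text \<open>\<open>Zh\<close> is the sequence of compressed, not yet normalized factors; \<open>Zh 0\<close> is irrelevant. A
  factor without columns counts as the zero matrix and is excluded as well.\<close>

definition lree_scheme ::
  "nat \<Rightarrow> nat \<Rightarrow> nat \<Rightarrow> (nat \<Rightarrow> real) \<Rightarrow> (nat \<Rightarrow> complex mat) \<Rightarrow> real \<Rightarrow> complex mat \<Rightarrow> real \<Rightarrow>
   complex mat \<Rightarrow> (nat \<Rightarrow> complex mat) \<Rightarrow> (nat \<Rightarrow> complex mat) \<Rightarrow> bool"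
  where
  "lree_scheme m K N \<gamma> L \<tau> E tol2 Z0 Z Zh \<longleftrightarrow>
     Z 0 = Z0 \<and>
     (\<forall>n<N.
        column_compression tol2 (lree_expand m K \<gamma> L \<tau> E (Z n)) (Zh (Suc n)) \<and>
        Zh (Suc n) \<noteq> 0\<^sub>m (dim_row (Zh (Suc n))) (dim_col (Zh (Suc n))) \<and>
        Z (Suc n) = complex_of_real (1 / frob_norm (Zh (Suc n))) \<cdot>\<^sub>m Zh (Suc n))"

end

theory Submission
  imports Defs "HOL-Analysis.L2_Norm"
begin

text \<open>
  Write \<open>G X = A X + X A\<^sup>\<dagger> + J X\<close> with \<open>J X = \<Sum>\<^sub>k \<gamma>\<^sub>k L\<^sub>k X L\<^sub>k\<^sup>\<dagger>\<close> for the right-hand side of the Lindblad equation. The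
  bound grows only linearly in time because the exact flow does not expand the trace norm: errors
  of earlier steps are propagated with constant one, and it remains to add up local errors.

  Non-expansiveness is used in infinitesimal form. The identity \<open>A + A\<^sup>\<dagger> + \<Sum>\<^sub>k \<gamma>\<^sub>k L\<^sub>k\<^sup>\<dagger> L\<^sub>k = 0\<close> makes
  \<open>X + h G X\<close>, up to \<open>O(h\<^sup>2)\<close>, a trace-preserving Kraus map applied to \<open>X\<close>. The trace norm is the
  maximum of \<open>|tr (C X)|\<close> over all contractions \<open>C\<close> (\<open>norm_trace_mult_le\<close>, \<open>trace_norm_attained\<close>), and the
  adjoint of such a Kraus map takes contractions to matrices of norm \<open>1 + O(h\<^sup>2)\<close>. So
  \<open>\<parallel>X + h G X\<parallel>\<^sub>1 \<le> (1 + O(h\<^sup>2)) \<parallel>X\<parallel>\<^sub>1\<close> (\<open>trace_norm_euler_step_le\<close>), and a curve that satisfies \<open>F' = G F + R\<close> has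
  \<open>\<parallel>F \<tau>\<parallel>\<^sub>1 \<le> \<parallel>F 0\<parallel>\<^sub>1 + \<integral> \<parallel>R\<parallel>\<^sub>1\<close> (\<open>trace_norm_comparison\<close>).

  For a single step from \<open>\<sigma> = Z\<^sub>n Z\<^sub>n\<^sup>\<dagger>\<close>, let \<open>X s = e\<^sup>s\<^sup>A \<sigma> e\<^sup>s\<^sup>A\<^sup>\<dagger>\<close> and \<open>Y s = X s + s J (X s)\<close>. The curve \<open>Y\<close> interpolates
  the scheme without compression and solves the Lindblad equation up to the residual
  \<open>s (J (A X + X A\<^sup>\<dagger>) - G (J X))\<close>, which is at most \<open>s (4 C\<^sub>1 C\<^sub>2 + C\<^sub>1\<^sup>2)\<close> because \<open>\<parallel>X s\<parallel>\<^sub>1 \<le> \<parallel>\<sigma>\<parallel>\<^sub>1 = 1\<close>.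
  Comparison with the exact solution gives a local error of \<open>(C\<^sub>1\<^sup>2/2 + 2 C\<^sub>1 C\<^sub>2) \<tau>\<^sup>2\<close>
  (\<open>exact_minus_euler_step_le\<close>). The approximate exponential adds \<open>(1 + \<tau> C\<^sub>1) C\<^sub>3 tol\<^sub>1\<close>, and compression adds
  \<open>tol\<^sub>2\<close>, the trace of the discarded positive part (\<open>column_compression_error\<close>).

  Normalization costs the deviation of the trace from one. The generator preserves the trace, so
  \<open>tr (Y \<tau>)\<close> differs from one by \<open>C\<^sub>1 C\<^sub>2 \<tau>\<^sup>2\<close> at most (\<open>trace_euler_step_defect\<close>), and the two perturbations enter
  the trace a second time. Per step this amounts to
  \<open>(C\<^sub>1\<^sup>2/2 + 3 C\<^sub>1 C\<^sub>2) \<tau>\<^sup>2 + 2 (1 + \<tau> C\<^sub>1) C\<^sub>3 tol\<^sub>1 + 2 tol\<^sub>2\<close> (\<open>scheme_step_error\<close>), and the first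
  coefficient is at most the constant \<open>c\<^sub>1 + 2 C\<^sub>1 C\<^sub>2\<close> of the theorem.
\<close>

section \<open>Adjoint, inner product and trace\<close>

lemma dim_mat_adjoint [simp]:
  "dim_row (mat_adjoint A) = dim_col A" "dim_col (mat_adjoint A) = dim_row A"
  by (simp_all add: mat_adjoint_def)

lemma mat_adjoint_carrier [simp]: "A \<in> carrier_mat n k \<Longrightarrow> mat_adjoint A \<in> carrier_mat k n"
  by (auto intro!: carrier_matI)

lemma index_mat_adjoint [simp]:
  fixes A :: "complex mat"
  shows "i < dim_col A \<Longrightarrow> j < dim_row A \<Longrightarrow> mat_adjoint A $$ (i, j) = cnj (A $$ (j, i))"
  by (simp add: mat_adjoint_def mat_of_rows_index)

lemma index_mult_mat_sum:
  "i < dim_row A \<Longrightarrow> j < dim_col B \<Longrightarrow> dim_col A = dim_row B \<Longrightarrow>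
   (A * B) $$ (i, j) = (\<Sum>k<dim_row B. A $$ (i, k) * B $$ (k, j))"
  by (simp add: scalar_prod_def lessThan_atLeast0)

lemma mat_adjoint_mat_adjoint [simp]: "mat_adjoint (mat_adjoint A) = (A :: complex mat)"
  by (rule eq_matI) auto

lemma mat_adjoint_mult:
  fixes A B :: "complex mat"
  assumes "dim_col A = dim_row B"
  shows "mat_adjoint (A * B) = mat_adjoint B * mat_adjoint A"
  by (rule eq_matI) (use assms in \<open>auto simp: index_mult_mat_sum mult.commute simp del: index_mult_mat(1)\<close>)

lemma mat_adjoint_smult: "mat_adjoint (c \<cdot>\<^sub>m A) = cnj c \<cdot>\<^sub>m mat_adjoint (A :: complex mat)"
  by (rule eq_matI) auto

lemma cscalar_prod_sum:
  fixes v w :: "complex vec"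
  shows "v \<bullet>c w = (\<Sum>i<dim_vec w. v $ i * cnj (w $ i))"
  by (simp add: scalar_prod_def lessThan_atLeast0)

lemma cscalar_prod_mat_adjoint:
  fixes A :: "complex mat"
  assumes "v \<in> carrier_vec (dim_col A)" "w \<in> carrier_vec (dim_row A)"
  shows "(A *\<^sub>v v) \<bullet>c w = v \<bullet>c (mat_adjoint A *\<^sub>v w)"
proof -
  have "(A *\<^sub>v v) \<bullet>c w = (\<Sum>i<dim_row A. \<Sum>j<dim_col A. A $$ (i,j) * v $ j * cnj (w $ i))"
    using assms by (simp add: cscalar_prod_sum scalar_prod_def lessThan_atLeast0 sum_distrib_right)
  also have "\<dots> = (\<Sum>j<dim_col A. \<Sum>i<dim_row A. A $$ (i,j) * v $ j * cnj (w $ i))"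
    by (rule sum.swap)
  also have "\<dots> = v \<bullet>c (mat_adjoint A *\<^sub>v w)"
    using assms by (simp add: cscalar_prod_sum scalar_prod_def lessThan_atLeast0 sum_distrib_left mult_ac)
  finally show ?thesis .
qed

lemma index_mat_adjoint_mult:
  fixes W M :: "complex mat"
  assumes "i < dim_col W" "j < dim_col M" "dim_row W = dim_row M"
  shows "(mat_adjoint W * M) $$ (i, j) = col M j \<bullet>c col W i"
  using assms by (simp add: index_mult_mat_sum cscalar_prod_sum mult.commute del: index_mult_mat(1))

definition vnorm :: "complex vec \<Rightarrow> real" where
  "vnorm v = L2_set (\<lambda>i. cmod (v $ i)) {..<dim_vec v}"

lemma vnorm_nonneg [simp]: "0 \<le> vnorm v"
  by (simp add: vnorm_def)

lemma cscalar_prod_self: "v \<bullet>c v = complex_of_real ((vnorm v)\<^sup>2)"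
  by (simp add: cscalar_prod_sum vnorm_def L2_set_def sum_nonneg complex_norm_square del: of_real_power)

lemma cmod_cscalar_prod_le:
  assumes "dim_vec v = dim_vec w"
  shows "cmod (v \<bullet>c w) \<le> vnorm v * vnorm w"
proof -
  have "cmod (v \<bullet>c w) \<le> (\<Sum>i<dim_vec w. \<bar>cmod (v $ i)\<bar> * \<bar>cmod (w $ i)\<bar>)"
    unfolding cscalar_prod_sum by (rule order.trans[OF norm_sum]) (simp add: norm_mult)
  also have "\<dots> \<le> vnorm v * vnorm w"
    unfolding vnorm_def assms by (rule L2_set_mult_ineq)
  finally show ?thesis .
qed

lemma vnorm_eq_0_iff: "v \<in> carrier_vec n \<Longrightarrow> vnorm v = 0 \<longleftrightarrow> v = 0\<^sub>v n"
  by (auto simp: vnorm_def L2_set_eq_0_iff)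

lemma vnorm_smult: "vnorm (c \<cdot>\<^sub>v v) = cmod c * vnorm v"
  unfolding vnorm_def L2_set_right_distrib[OF norm_ge_zero] by (rule L2_set_cong) (simp_all add: norm_mult)

lemma cmod_index_le_vnorm: "i < dim_vec v \<Longrightarrow> cmod (v $ i) \<le> vnorm v"
  unfolding vnorm_def by (rule member_le_L2_set) auto

lemma vnorm_unit_vec: "i < n \<Longrightarrow> vnorm (unit_vec n i) = 1"
  by (simp add: vnorm_def L2_set_def if_distrib[of cmod] if_distrib[of "\<lambda>x. x\<^sup>2"] cong: if_cong)

lemma mat_trace_commute:
  assumes "A \<in> carrier_mat n k" "B \<in> carrier_mat k n"
  shows "mat_trace (A * B) = mat_trace (B * A)"
proof -
  have "mat_trace (A * B) = (\<Sum>i<n. \<Sum>j<k. A $$ (i, j) * B $$ (j, i))"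
    unfolding mat_trace_def using assms by (auto simp: index_mult_mat_sum simp del: index_mult_mat(1) intro!: sum.cong)
  also have "\<dots> = (\<Sum>j<k. \<Sum>i<n. A $$ (i, j) * B $$ (j, i))"
    by (rule sum.swap)
  also have "\<dots> = mat_trace (B * A)"
    unfolding mat_trace_def using assms by (auto simp: index_mult_mat_sum mult.commute simp del: index_mult_mat(1) intro!: sum.cong)
  finally show ?thesis .
qed

lemma mat_trace_add:
  "A \<in> carrier_mat n n \<Longrightarrow> B \<in> carrier_mat n n \<Longrightarrow> mat_trace (A + B) = mat_trace A + mat_trace B"
  by (auto simp: mat_trace_def sum.distrib)

lemma mat_trace_minus:
  "A \<in> carrier_mat n n \<Longrightarrow> B \<in> carrier_mat n n \<Longrightarrow> mat_trace (A - B) = mat_trace A - mat_trace B"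
  by (auto simp: mat_trace_def sum_subtractf)

lemma mat_trace_smult: "A \<in> carrier_mat n n \<Longrightarrow> mat_trace (c \<cdot>\<^sub>m A) = c * mat_trace A"
  by (auto simp: mat_trace_def sum_distrib_left)

lemma mat_sum_carrier [simp]: "mat_sum n k I F \<in> carrier_mat n k"
  by (simp add: mat_sum_def)

lemma dim_mat_sum [simp]: "dim_row (mat_sum n k I F) = n" "dim_col (mat_sum n k I F) = k"
  by (simp_all add: mat_sum_def)

lemma index_mat_sum [simp]:
  "i < n \<Longrightarrow> j < k \<Longrightarrow> mat_sum n k I F $$ (i, j) = (\<Sum>l\<in>I. F l $$ (i, j))"
  by (simp add: mat_sum_def)

lemma mat_trace_mat_sum:
  assumes "\<And>k. k \<in> I \<Longrightarrow> F k \<in> carrier_mat n n"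
  shows "mat_trace (mat_sum n n I F) = (\<Sum>k\<in>I. mat_trace (F k))"
proof -
  have "(\<Sum>k\<in>I. mat_trace (F k)) = (\<Sum>k\<in>I. \<Sum>i<n. F k $$ (i, i))"
    using assms by (intro sum.cong) (auto simp: mat_trace_def)
  also have "\<dots> = mat_trace (mat_sum n n I F)"
    by (subst sum.swap) (simp add: mat_trace_def)
  finally show ?thesis ..
qed

lemma mult_mat_sum_right:
  fixes C :: "complex mat"
  assumes "C \<in> carrier_mat p n" "\<And>l. l \<in> I \<Longrightarrow> F l \<in> carrier_mat n k"
  shows "C * mat_sum n k I F = mat_sum p k I (\<lambda>l. C * F l)"
proof (rule eq_matI)
  fix i j assume ij: "i < dim_row (mat_sum p k I (\<lambda>l. C * F l))" "j < dim_col (mat_sum p k I (\<lambda>l. C * F l))"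
  have F: "dim_row (F l) = n" "dim_col (F l) = k" if "l \<in> I" for l
    using assms(2)[OF that] by auto
  have "(C * mat_sum n k I F) $$ (i, j) = (\<Sum>a<n. \<Sum>l\<in>I. C $$ (i, a) * F l $$ (a, j))"
    using assms(1) ij by (simp add: index_mult_mat_sum sum_distrib_left del: index_mult_mat(1))
  also have "\<dots> = (\<Sum>l\<in>I. \<Sum>a<n. C $$ (i, a) * F l $$ (a, j))"
    by (rule sum.swap)
  also have "\<dots> = mat_sum p k I (\<lambda>l. C * F l) $$ (i, j)"
    using assms(1) ij F by (simp add: index_mult_mat_sum del: index_mult_mat(1))
  finally show "(C * mat_sum n k I F) $$ (i, j) = mat_sum p k I (\<lambda>l. C * F l) $$ (i, j)" .
qed (use assms in auto)

lemma mult_mat_sum_left: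
  fixes C :: "complex mat"
  assumes "C \<in> carrier_mat k p" "\<And>l. l \<in> I \<Longrightarrow> F l \<in> carrier_mat n k"
  shows "mat_sum n k I F * C = mat_sum n p I (\<lambda>l. F l * C)"
proof (rule eq_matI)
  fix i j assume ij: "i < dim_row (mat_sum n p I (\<lambda>l. F l * C))" "j < dim_col (mat_sum n p I (\<lambda>l. F l * C))"
  have F: "dim_row (F l) = n" "dim_col (F l) = k" if "l \<in> I" for l
    using assms(2)[OF that] by auto
  have "(mat_sum n k I F * C) $$ (i, j) = (\<Sum>a<k. \<Sum>l\<in>I. F l $$ (i, a) * C $$ (a, j))"
    using assms(1) ij by (simp add: index_mult_mat_sum sum_distrib_right del: index_mult_mat(1))
  also have "\<dots> = (\<Sum>l\<in>I. \<Sum>a<k. F l $$ (i, a) * C $$ (a, j))"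
    by (rule sum.swap)
  also have "\<dots> = mat_sum n p I (\<lambda>l. F l * C) $$ (i, j)"
    using assms(1) ij F by (simp add: index_mult_mat_sum del: index_mult_mat(1))
  finally show "(mat_sum n k I F * C) $$ (i, j) = mat_sum n p I (\<lambda>l. F l * C) $$ (i, j)" .
qed (use assms in auto)

section \<open>Unitary diagonalization of Hermitian matrices\<close>

lemma four_block_adjoint:
  fixes W :: "complex mat"
  assumes "W \<in> carrier_mat n n"
  shows "mat_adjoint (four_block_mat (1\<^sub>m 1) (0\<^sub>m 1 n) (0\<^sub>m n 1) W) =
    four_block_mat (1\<^sub>m 1) (0\<^sub>m 1 n) (0\<^sub>m n 1) (mat_adjoint W)"
  by (rule eq_matI) (use assms in auto)

lemma four_block_diag_mult:
  fixes A A' B B' :: "complex mat"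
  assumes "A \<in> carrier_mat k k" "A' \<in> carrier_mat k k" "B \<in> carrier_mat n n" "B' \<in> carrier_mat n n"
  shows "four_block_mat A (0\<^sub>m k n) (0\<^sub>m n k) B * four_block_mat A' (0\<^sub>m k n) (0\<^sub>m n k) B' =
    four_block_mat (A * A') (0\<^sub>m k n) (0\<^sub>m n k) (B * B')"
  using assms by (subst mult_four_block_mat[of _ k k _ n _ n _ _ k _ n]) auto

text \<open>
  The characteristic polynomial has a complex root. A corresponding eigenvector is completed to a
  basis, and Gram--Schmidt orthogonalization followed by normalization changes this first vector
  only by a scalar.
\<close>

lemma unitary_with_first_col_eigenvector:
  fixes G :: "complex mat"
  assumes G: "G \<in> carrier_mat (Suc n) (Suc n)"
  shows "\<exists>W e. W \<in> carrier_mat (Suc n) (Suc n) \<and> mat_adjoint W * W = 1\<^sub>m (Suc n) \<and>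
    G *\<^sub>v col W 0 = e \<cdot>\<^sub>v col W 0"
proof -
  let ?n = "Suc n"
  have "degree (char_poly G) = ?n"
    using degree_monic_char_poly[OF G] by simp
  hence "\<not> constant (poly (char_poly G))"
    by (simp add: constant_degree)
  then obtain e where "poly (char_poly G) e = 0"
    using fundamental_theorem_of_algebra by blast
  hence "eigenvalue G e"
    using eigenvalue_root_char_poly[OF G] by simp
  then obtain v where "eigenvector G v e"
    unfolding eigenvalue_def by blast
  hence v: "v \<in> carrier_vec ?n" "v \<noteq> 0\<^sub>v ?n" and ev: "G *\<^sub>v v = e \<cdot>\<^sub>v v"
    using G by (auto simp: eigenvector_def)
  interpret cof_vec_space ?n "TYPE(complex)" .
  define b where "b = basis_completion v"
  define ws where "ws = gram_schmidt ?n b"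
  note bc = basis_completion[OF v, folded b_def]
  have ws: "set ws \<subseteq> carrier_vec ?n" "corthogonal ws" "length ws = ?n"
    using gram_schmidt_result[OF bc(2) bc(4) bc(5) ws_def] bc(6) by auto
  obtain vs where "b = v # vs"
    using bc(6,7) by (cases b) auto
  hence ws0: "ws ! 0 = v"
    using gram_schmidt_hd[OF v(1), of vs] ws(3) unfolding ws_def by (metis hd_conv_nth length_0_conv nat.distinct(1))
  have wsc: "ws ! i \<in> carrier_vec ?n" if "i < ?n" for i
    using ws that by auto
  have ortho: "ws ! i \<bullet>c ws ! j = 0 \<longleftrightarrow> i \<noteq> j" if "i < ?n" "j < ?n" for i j
    using corthogonalD[OF ws(2)] that ws(3) by auto
  define a where "a i = complex_of_real (1 / vnorm (ws ! i))" for i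
  have nz: "vnorm (ws ! i) \<noteq> 0" if "i < ?n" for i
    using ortho[OF that that] by (auto simp: cscalar_prod_self)
  define W where "W = mat_of_cols ?n (map (\<lambda>i. a i \<cdot>\<^sub>v ws ! i) [0..<?n])"
  have W: "W \<in> carrier_mat ?n ?n"
    unfolding W_def by (rule carrier_matI) auto
  have colW: "col W i = a i \<cdot>\<^sub>v ws ! i" if "i < ?n" for i
    unfolding W_def by (subst col_mat_of_cols) (use that wsc[OF that] in \<open>auto simp del: upt_Suc\<close>)
  have "(mat_adjoint W * W) $$ (i, j) = 1\<^sub>m ?n $$ (i, j)" if ij: "i < ?n" "j < ?n" for i j
  proof -
    have "(mat_adjoint W * W) $$ (i, j) = col W j \<bullet>c col W i"
      using ij W by (subst index_mat_adjoint_mult) auto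
    also have "\<dots> = a j * cnj (a i) * (ws ! j \<bullet>c ws ! i)"
      using ij wsc[OF ij(1)] wsc[OF ij(2)] by (simp add: colW cscalar_prod_sum sum_distrib_left mult_ac del: sum.lessThan_Suc)
    also have "\<dots> = 1\<^sub>m ?n $$ (i, j)"
    proof (cases "i = j")
      case True
      have "a j * cnj (a j) * (ws ! j \<bullet>c ws ! j) = complex_of_real (1 / vnorm (ws!j) * (1 / vnorm (ws!j)) * (vnorm (ws!j))\<^sup>2)"
        by (simp add: a_def cscalar_prod_self)
      also have "\<dots> = 1" using nz[OF ij(2)] by (simp add: power2_eq_square)
      finally show ?thesis using True ij by simp
    next
      case False
      then show ?thesis using ortho[OF ij(2,1)] ij by simp
    qed
    finally show ?thesis .
  qed
  hence "mat_adjoint W * W = 1\<^sub>m ?n"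
    by (intro eq_matI) (use W in auto)
  moreover have "G *\<^sub>v col W 0 = e \<cdot>\<^sub>v col W 0"
    using G v ev by (simp add: colW ws0 mult_mat_vec smult_smult_assoc mult.commute)
  ultimately show ?thesis
    using W by blast
qed

text \<open>
  Deflation. In an orthonormal basis that starts with an eigenvector, the first column of the matrix
  is a multiple of the first unit vector; by symmetry so is the first row, and the induction
  hypothesis applies to the remaining block.
\<close>

lemma hermitian_unitary_diagonalization:
  fixes G :: "complex mat"
  assumes "G \<in> carrier_mat n n" "mat_adjoint G = G"
  shows "\<exists>W d. W \<in> carrier_mat n n \<and> mat_adjoint W * W = 1\<^sub>m n \<and>
    mat_adjoint W * G * W = mat_diag n d"
  using assms
proof (induction n arbitrary: G)
  case 0
  then show ?case
    by (intro exI[of _ "1\<^sub>m 0"]) (auto intro!: eq_matI simp: mat_diag_def)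
next
  case (Suc n)
  let ?n = "Suc n"
  obtain W e where W: "W \<in> carrier_mat ?n ?n" and uW: "mat_adjoint W * W = 1\<^sub>m ?n"
    and ev: "G *\<^sub>v col W 0 = e \<cdot>\<^sub>v col W 0"
    using unitary_with_first_col_eigenvector[OF Suc.prems(1)] by blast
  note G = Suc.prems(1)
  have W': "mat_adjoint W \<in> carrier_mat ?n ?n" using W by simp
  define M where "M = mat_adjoint W * G * W"
  have M: "M \<in> carrier_mat ?n ?n" unfolding M_def using W G by auto
  have hM: "mat_adjoint M = M"
    unfolding M_def using W W' G Suc.prems(2)
    by (simp add: mat_adjoint_mult assoc_mult_mat[of _ ?n ?n _ ?n _ ?n] mult_carrier_mat[of _ ?n ?n _ ?n])
  have M0: "M $$ (i, 0) = (if i = 0 then e else 0)" if "i < ?n" for i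
  proof -
    have "M $$ (i, 0) = (mat_adjoint W * (G * W)) $$ (i, 0)"
      unfolding M_def using W W' G by (simp add: assoc_mult_mat[of _ ?n ?n _ ?n _ ?n] mult_carrier_mat[of _ ?n ?n _ ?n])
    also have "\<dots> = col (G * W) 0 \<bullet>c col W i"
      using that W G by (subst index_mat_adjoint_mult) auto
    also have "col (G * W) 0 = e \<cdot>\<^sub>v col W 0"
      by (rule trans[OF col_mult2[OF G W zero_less_Suc] ev])
    also have "(e \<cdot>\<^sub>v col W 0) \<bullet>c col W i = e * (col W 0 \<bullet>c col W i)"
      using W that by (simp add: cscalar_prod_sum sum_distrib_left mult_ac del: sum.lessThan_Suc)
    also have "col W 0 \<bullet>c col W i = (mat_adjoint W * W) $$ (i, 0)"
      using W that by (subst index_mat_adjoint_mult) auto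
    finally show ?thesis using that by (simp add: uW)
  qed
  have M0': "M $$ (0, i) = (if i = 0 then e else 0)" if "i < ?n" for i
  proof (cases "i = 0")
    case True then show ?thesis using M0[of 0] by simp
  next
    case False
    have "M $$ (0, i) = cnj (M $$ (i, 0))"
      using M that by (subst hM[symmetric], subst index_mat_adjoint) auto
    then show ?thesis using M0[OF that] False by simp
  qed
  define M3 where "M3 = mat n n (\<lambda>(i, j). M $$ (Suc i, Suc j))"
  have M3: "M3 \<in> carrier_mat n n" by (simp add: M3_def)
  have "mat_adjoint M3 = M3"
  proof (rule eq_matI)
    fix i j assume "i < dim_row M3" "j < dim_col M3"
    hence ij: "i < n" "j < n" by (auto simp: M3_def)
    have "M $$ (Suc i, Suc j) = cnj (M $$ (Suc j, Suc i))"
      using M ij by (subst hM[symmetric], subst index_mat_adjoint) auto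
    then show "mat_adjoint M3 $$ (i, j) = M3 $$ (i, j)"
      using ij M3 by (simp add: M3_def)
  qed (use M3 in auto)
  from Suc.IH[OF M3 this] obtain V d where V: "V \<in> carrier_mat n n"
    and uV: "mat_adjoint V * V = 1\<^sub>m n" and dV: "mat_adjoint V * M3 * V = mat_diag n d"
    by blast
  have V': "mat_adjoint V \<in> carrier_mat n n" using V by simp
  have Mblock: "M = four_block_mat (mat 1 1 (\<lambda>_. e)) (0\<^sub>m 1 n) (0\<^sub>m n 1) M3"
    by (rule eq_matI) (use M M0 M0' in \<open>auto simp: M3_def\<close>)
  define U where "U = four_block_mat (1\<^sub>m 1) (0\<^sub>m 1 n) (0\<^sub>m n 1) V"
  have U: "U \<in> carrier_mat ?n ?n" unfolding U_def using V by auto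
  have U': "mat_adjoint U \<in> carrier_mat ?n ?n" using U by simp
  have aU: "mat_adjoint U = four_block_mat (1\<^sub>m 1) (0\<^sub>m 1 n) (0\<^sub>m n 1) (mat_adjoint V)"
    unfolding U_def by (rule four_block_adjoint[OF V])
  have uU: "mat_adjoint U * U = 1\<^sub>m ?n"
  proof -
    have "mat_adjoint U * U = four_block_mat (1\<^sub>m 1) (0\<^sub>m 1 n) (0\<^sub>m n 1) (1\<^sub>m n)"
      unfolding aU unfolding U_def
      using V V' uV by (simp add: four_block_diag_mult)
    also have "\<dots> = 1\<^sub>m ?n" by (rule eq_matI) auto
    finally show ?thesis .
  qed
  have "mat_adjoint U * M * U =
      four_block_mat (mat 1 1 (\<lambda>_. e)) (0\<^sub>m 1 n) (0\<^sub>m n 1) (mat_adjoint V * M3 * V)"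
    unfolding aU Mblock unfolding U_def
    using V V' M3 mult_carrier_mat[OF V' M3] by (simp add: four_block_diag_mult del: One_nat_def)
  also have "\<dots> = mat_diag ?n (\<lambda>i. if i = 0 then e else d (i - 1))"
    unfolding dV by (rule eq_matI) (auto simp: mat_diag_def)
  finally have dU: "mat_adjoint U * M * U = mat_diag ?n (\<lambda>i. if i = 0 then e else d (i - 1))" .
  have "mat_adjoint (W * U) * (W * U) = mat_adjoint U * (mat_adjoint W * W) * U"
    using W W' U U' by (simp add: mat_adjoint_mult assoc_mult_mat[of _ ?n ?n _ ?n _ ?n] mult_carrier_mat[of _ ?n ?n _ ?n])
  hence "mat_adjoint (W * U) * (W * U) = 1\<^sub>m ?n"
    using U U' by (simp add: uW uU)
  moreover have "mat_adjoint (W * U) * G * (W * U) = mat_adjoint U * M * U"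
    unfolding M_def using W W' U U' G
    by (simp add: mat_adjoint_mult assoc_mult_mat[of _ ?n ?n _ ?n _ ?n] mult_carrier_mat[of _ ?n ?n _ ?n])
  ultimately show ?case
    using dU W U by (intro exI[of _ "W * U"]) auto
qed

section \<open>Duality of trace norm and operator norm\<close>

lemma vnorm_power2_eq_Re: "(vnorm v)\<^sup>2 = Re (v \<bullet>c v)"
  by (simp add: cscalar_prod_self del: of_real_power)

lemma unitary_right_inverse:
  fixes W :: "complex mat"
  assumes "W \<in> carrier_mat n n" "mat_adjoint W * W = 1\<^sub>m n"
  shows "W * mat_adjoint W = 1\<^sub>m n"
  using mat_mult_left_right_inverse[of "mat_adjoint W" n W] assms by simp

lemma vnorm_col_unitary:
  fixes W :: "complex mat"
  assumes "W \<in> carrier_mat n n" "mat_adjoint W * W = 1\<^sub>m n" "i < n"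
  shows "vnorm (col W i) = 1"
proof -
  have "col W i \<bullet>c col W i = (mat_adjoint W * W) $$ (i, i)"
    using assms(1,3) by (subst index_mat_adjoint_mult) auto
  hence "(vnorm (col W i))\<^sup>2 = 1"
    using assms(2,3) by (simp add: vnorm_power2_eq_Re)
  thus ?thesis
    using vnorm_nonneg[of "col W i"] by (simp add: power2_eq_1_iff)
qed

lemma mat_trace_unitary_basis:
  fixes W :: "complex mat"
  assumes W: "W \<in> carrier_mat n n" "mat_adjoint W * W = 1\<^sub>m n" and M: "M \<in> carrier_mat n n"
  shows "mat_trace M = (\<Sum>i<n. (M *\<^sub>v col W i) \<bullet>c col W i)"
proof -
  have W': "mat_adjoint W \<in> carrier_mat n n" using W by simp
  have "mat_trace M = mat_trace ((M * W) * mat_adjoint W)"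
    using M W W' unitary_right_inverse[OF W] by (simp add: assoc_mult_mat[of _ n n _ n _ n] mult_carrier_mat[of _ n n _ n])
  also have "\<dots> = mat_trace (mat_adjoint W * (M * W))"
    using M W W' by (intro mat_trace_commute[of _ n n]) auto
  also have "\<dots> = (\<Sum>i<n. col (M * W) i \<bullet>c col W i)"
    unfolding mat_trace_def using M W
    by (intro sum.cong) (auto simp: index_mat_adjoint_mult simp del: index_mult_mat(1))
  also have "\<dots> = (\<Sum>i<n. (M *\<^sub>v col W i) \<bullet>c col W i)"
    by (intro sum.cong refl) (simp only: lessThan_iff col_mult2[OF M W(1)])
  finally show ?thesis .
qed

lemma proots_linear_factors: "proots (\<Prod>a\<leftarrow>xs. [:- a, 1:]) = mset (xs :: complex list)"
proof (induction xs)
  case (Cons a xs)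
  have "(\<Prod>a\<leftarrow>xs. [:- a, 1:]) \<noteq> (0 :: complex poly)"
    by (auto simp: prod_list_zero_iff)
  then show ?case
    using Cons.IH by (simp add: proots_mult del: mult_pCons_left)
qed simp

text \<open>
  The diagonal entries of a unitary diagonalization are the roots of the characteristic polynomial
  with their multiplicities, and the list of singular values is a rearrangement of their square
  roots.
\<close>

lemma trace_norm_eq_sum_sqrt:
  assumes X: "X \<in> carrier_mat n n" and W: "W \<in> carrier_mat n n" "mat_adjoint W * W = 1\<^sub>m n"
    and diag: "mat_adjoint W * (mat_adjoint X * X) * W = mat_diag n d"
  shows "trace_norm X = (\<Sum>i<n. sqrt (Re (d i)))"
proof -
  let ?G = "mat_adjoint X * X"
  have W': "mat_adjoint W \<in> carrier_mat n n" using W by simp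
  have G: "?G \<in> carrier_mat n n" using X by (intro mult_carrier_mat[of _ n n]) auto
  have "similar_mat (mat_diag n d) ?G"
    unfolding similar_mat_def
    by (intro exI[of _ "mat_adjoint W"] exI[of _ W] similar_mat_witI[of _ _ n])
       (use W W' G diag unitary_right_inverse[OF W] in \<open>auto simp: mat_diag_def\<close>)
  hence "char_poly ?G = char_poly (mat_diag n d)"
    using char_poly_similar by metis
  also have "\<dots> = (\<Prod>a\<leftarrow>diag_mat (mat_diag n d). [:- a, 1:])"
    by (intro char_poly_upper_triangular[of _ n]) (auto simp: mat_diag_def upper_triangular_def)
  also have "diag_mat (mat_diag n d) = map d [0..<n]"
    by (simp add: diag_mat_def mat_diag_def)
  finally have "proots (char_poly ?G) = mset (map d [0..<n])"
    by (simp only: proots_linear_factors)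
  hence m: "mset (gram_roots X) = mset (map (\<lambda>i. sqrt (Re (d i))) [0..<n])"
    by (simp add: gram_roots_def image_mset.compositionality o_def)
  hence len: "length (gram_roots X) = n"
    by (metis length_map length_upt size_mset diff_zero)
  have "trace_norm X = (\<Sum>j<n. gram_roots X ! j)"
    using X by (auto simp: trace_norm_def sing_val_def)
  also have "\<dots> = sum_list (gram_roots X)"
    by (simp add: sum_list_sum_nth len lessThan_atLeast0)
  also have "\<dots> = sum_list (map (\<lambda>i. sqrt (Re (d i))) [0..<n])"
    using m by (metis sum_mset_sum_list)
  also have "\<dots> = (\<Sum>i<n. sqrt (Re (d i)))"
    by (simp add: interv_sum_list_conv_sum_set_nat lessThan_atLeast0)
  finally show ?thesis .
qed

text \<open>
  In an orthonormal eigenbasis \<open>w\<^sub>i\<close> of the Gram matrix of \<open>X\<close>, the \<open>i\<close>-th eigenvalue is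
  \<open>\<parallel>X w\<^sub>i\<parallel>\<^sup>2\<close>, so that the singular values are the norms \<open>\<parallel>X w\<^sub>i\<parallel>\<close>.
\<close>

lemma trace_norm_basis:
  assumes X: "X \<in> carrier_mat n n"
  shows "\<exists>W. W \<in> carrier_mat n n \<and> mat_adjoint W * W = 1\<^sub>m n \<and>
    mat_adjoint W * (mat_adjoint X * X) * W =
      mat_diag n (\<lambda>i. complex_of_real ((vnorm (X *\<^sub>v col W i))\<^sup>2)) \<and>
    trace_norm X = (\<Sum>i<n. vnorm (X *\<^sub>v col W i))"
proof -
  let ?G = "mat_adjoint X * X"
  have X': "mat_adjoint X \<in> carrier_mat n n" using X by simp
  have G: "?G \<in> carrier_mat n n" by (rule mult_carrier_mat[OF X' X])
  have "mat_adjoint ?G = ?G" using X by (simp add: mat_adjoint_mult)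
  from hermitian_unitary_diagonalization[OF G this] obtain W d
    where W: "W \<in> carrier_mat n n" "mat_adjoint W * W = 1\<^sub>m n"
      and d: "mat_adjoint W * ?G * W = mat_diag n d" by blast
  have W': "mat_adjoint W \<in> carrier_mat n n" using W by simp
  have di: "d i = complex_of_real ((vnorm (X *\<^sub>v col W i))\<^sup>2)" if i: "i < n" for i
  proof -
    have "d i = (mat_adjoint W * (?G * W)) $$ (i, i)"
      using d i unfolding assoc_mult_mat[OF W' G W(1)] by (simp add: mat_diag_def)
    also have "\<dots> = col (?G * W) i \<bullet>c col W i"
      using i W G X by (subst index_mat_adjoint_mult) auto
    also have "col (?G * W) i = mat_adjoint X *\<^sub>v (X *\<^sub>v col W i)"
      unfolding col_mult2[OF G W(1) i] using W i by (intro assoc_mult_mat_vec[OF X' X]) auto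
    also have "\<dots> \<bullet>c col W i = (X *\<^sub>v col W i) \<bullet>c (X *\<^sub>v col W i)"
      using X W i by (subst cscalar_prod_mat_adjoint) auto
    finally show ?thesis by (simp add: cscalar_prod_self)
  qed
  have "mat_diag n d = mat_diag n (\<lambda>i. complex_of_real ((vnorm (X *\<^sub>v col W i))\<^sup>2))"
    by (rule eq_matI) (auto simp: mat_diag_def di)
  moreover have "trace_norm X = (\<Sum>i<n. vnorm (X *\<^sub>v col W i))"
    unfolding trace_norm_eq_sum_sqrt[OF X W d] by (intro sum.cong) (simp_all add: di del: of_real_power)
  ultimately show ?thesis
    using W d by auto
qed

definition op_bounded :: "real \<Rightarrow> complex mat \<Rightarrow> bool" where
  "op_bounded c D \<longleftrightarrow> (\<forall>v \<in> carrier_vec (dim_col D). vnorm (D *\<^sub>v v) \<le> c * vnorm v)"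

lemma op_boundedD:
  "op_bounded c D \<Longrightarrow> D \<in> carrier_mat n k \<Longrightarrow> v \<in> carrier_vec k \<Longrightarrow> vnorm (D *\<^sub>v v) \<le> c * vnorm v"
  by (auto simp: op_bounded_def)

lemma op_boundedI:
  "D \<in> carrier_mat n k \<Longrightarrow> (\<And>v. v \<in> carrier_vec k \<Longrightarrow> vnorm (D *\<^sub>v v) \<le> c * vnorm v) \<Longrightarrow> op_bounded c D"
  by (auto simp: op_bounded_def)

lemma op_bounded_adjoint:
  assumes D: "D \<in> carrier_mat n k" and c: "op_bounded c D" and c0: "0 \<le> c"
  shows "op_bounded c (mat_adjoint D)"
proof (rule op_boundedI)
  show "mat_adjoint D \<in> carrier_mat k n" using D by simp
  fix v :: "complex vec" assume v: "v \<in> carrier_vec n"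
  define w where "w = mat_adjoint D *\<^sub>v v"
  have w: "w \<in> carrier_vec k" unfolding w_def using D by (intro carrier_vecI) simp
  have "(vnorm w)\<^sup>2 = Re (w \<bullet>c w)" by (rule vnorm_power2_eq_Re)
  also have "w \<bullet>c w = (D *\<^sub>v w) \<bullet>c v"
    using D v w by (subst cscalar_prod_mat_adjoint) (auto simp: w_def)
  also have "Re \<dots> \<le> vnorm (D *\<^sub>v w) * vnorm v"
    by (rule order.trans[OF complex_Re_le_cmod cmod_cscalar_prod_le]) (use D v in auto)
  also have "\<dots> \<le> c * vnorm w * vnorm v"
    using op_boundedD[OF c D w] by (intro mult_right_mono) auto
  finally have *: "vnorm w * vnorm w \<le> vnorm w * (c * vnorm v)"
    by (simp add: power2_eq_square mult_ac)
  show "vnorm (mat_adjoint D *\<^sub>v v) \<le> c * vnorm v"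
  proof (cases "vnorm w = 0")
    case True
    thus ?thesis using c0 by (simp add: w_def)
  next
    case False
    hence "0 < vnorm w" using vnorm_nonneg[of w] by linarith
    thus ?thesis using * by (simp add: w_def)
  qed
qed

text \<open>
  One half of the duality between trace norm and operator norm: the trace is expanded in an
  eigenbasis of the Gram matrix of \<open>X\<close>, and Cauchy--Schwarz is applied to each term.
\<close>

lemma norm_trace_mult_le:
  assumes D: "D \<in> carrier_mat n n" "op_bounded c D" and X: "X \<in> carrier_mat n n"
  shows "cmod (mat_trace (D * X)) \<le> c * trace_norm X"
proof -
  obtain W where W: "W \<in> carrier_mat n n" "mat_adjoint W * W = 1\<^sub>m n"
    and tn: "trace_norm X = (\<Sum>i<n. vnorm (X *\<^sub>v col W i))"
    using trace_norm_basis[OF X] by blast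
  have "cmod (mat_trace (D * X)) = cmod (\<Sum>i<n. ((D * X) *\<^sub>v col W i) \<bullet>c col W i)"
    using mat_trace_unitary_basis[OF W] D X by simp
  also have "\<dots> \<le> (\<Sum>i<n. c * vnorm (X *\<^sub>v col W i))"
  proof (rule sum_norm_le)
    fix i assume "i \<in> {..<n}"
    hence i: "i < n" by simp
    have w: "col W i \<in> carrier_vec n" using W i by auto
    have "(D * X) *\<^sub>v col W i = D *\<^sub>v (X *\<^sub>v col W i)"
      using D X w by (simp add: assoc_mult_mat_vec[of _ n n _ n])
    hence "cmod (((D * X) *\<^sub>v col W i) \<bullet>c col W i) \<le> vnorm (D *\<^sub>v (X *\<^sub>v col W i)) * vnorm (col W i)"
      using D W by (auto intro!: cmod_cscalar_prod_le)
    also have "\<dots> \<le> c * vnorm (X *\<^sub>v col W i)"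
      using op_boundedD[OF D(2) D(1), of "X *\<^sub>v col W i"] X w
      by (simp add: vnorm_col_unitary[OF W i] mult_mat_vec_carrier)
    finally show "cmod (((D * X) *\<^sub>v col W i) \<bullet>c col W i) \<le> c * vnorm (X *\<^sub>v col W i)" .
  qed
  also have "\<dots> = c * trace_norm X" by (simp add: tn sum_distrib_left)
  finally show ?thesis .
qed

text \<open>
  The other half of the duality. The contraction is the adjoint of the partial isometry in the polar
  decomposition of \<open>X\<close>; multiplied with \<open>X\<close> it gives the positive square root of the Gram matrix.
\<close>

lemma trace_norm_attained:
  assumes X: "X \<in> carrier_mat n n"
  shows "\<exists>C. C \<in> carrier_mat n n \<and> op_bounded 1 C \<and> mat_trace (C * X) = complex_of_real (trace_norm X)"
proof -
  have X': "mat_adjoint X \<in> carrier_mat n n" using X by simp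
  obtain W where W: "W \<in> carrier_mat n n" and uW: "mat_adjoint W * W = 1\<^sub>m n"
    and diag: "mat_adjoint W * (mat_adjoint X * X) * W =
      mat_diag n (\<lambda>i. complex_of_real ((vnorm (X *\<^sub>v col W i))\<^sup>2))"
    and tn: "trace_norm X = (\<Sum>i<n. vnorm (X *\<^sub>v col W i))"
    using trace_norm_basis[OF X] by blast
  have W': "mat_adjoint W \<in> carrier_mat n n" using W by simp
  note WW' = unitary_right_inverse[OF W uW]
  define s where "s i = vnorm (X *\<^sub>v col W i)" for i
  \<comment> \<open>The pseudo-inverse of the singular values: vanishing ones stay zero because \<open>inverse 0 = 0\<close>.\<close>
  define P where "P = mat_diag n (\<lambda>i. complex_of_real (inverse (s i)))"
  have P: "P \<in> carrier_mat n n" by (simp add: P_def mat_diag_def)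
  have P': "mat_adjoint P = P" by (rule eq_matI) (auto simp: P_def mat_diag_def)
  note assoc = assoc_mult_mat[of _ n n _ n _ n] mult_carrier_mat[of _ n n _ n]
  have diag': "mat_adjoint W * (mat_adjoint X * (X * W)) = mat_diag n (\<lambda>i. complex_of_real ((s i)\<^sup>2))"
    using diag W W' X X' by (simp add: assoc s_def)
  define C where "C = W * P * mat_adjoint W * mat_adjoint X"
  have C: "C \<in> carrier_mat n n" using W W' P X' by (simp add: C_def assoc)
  have C': "mat_adjoint C = X * W * P * mat_adjoint W"
    unfolding C_def using W W' P X X' by (simp add: mat_adjoint_mult P' assoc)
  have Cc: "mat_adjoint C \<in> carrier_mat n n" using C by simp
  have bounded': "op_bounded 1 (mat_adjoint C)"
  proof (rule op_boundedI[OF Cc])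
    fix v :: "complex vec" assume v: "v \<in> carrier_vec n"
    define y where "y = mat_adjoint W *\<^sub>v v"
    have y: "y \<in> carrier_vec n" unfolding y_def using W' v by (rule mult_mat_vec_carrier)
    define Q where "Q = P * mat_diag n (\<lambda>i. complex_of_real ((s i)\<^sup>2)) * P"
    have Q: "Q = mat_diag n (\<lambda>i. if s i = 0 then 0 else 1)"
      unfolding Q_def P_def mat_diag_diag
      by (rule eq_matI) (auto simp: mat_diag_def power2_eq_square field_simps)
    have Qc: "Q \<in> carrier_mat n n" by (simp add: Q mat_diag_def)
    have CC: "C * mat_adjoint C = W * Q * mat_adjoint W"
      unfolding C' unfolding C_def Q_def diag'[symmetric]
      using W W' P X X' by (simp add: assoc)
    have "(vnorm (mat_adjoint C *\<^sub>v v))\<^sup>2 = Re ((C *\<^sub>v (mat_adjoint C *\<^sub>v v)) \<bullet>c v)"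
      unfolding vnorm_power2_eq_Re using C Cc v
      by (subst (2) cscalar_prod_mat_adjoint) (auto intro: mult_mat_vec_carrier[OF Cc])
    also have "C *\<^sub>v (mat_adjoint C *\<^sub>v v) = W *\<^sub>v (Q *\<^sub>v y)"
    proof -
      have "C *\<^sub>v (mat_adjoint C *\<^sub>v v) = (C * mat_adjoint C) *\<^sub>v v"
        using assoc_mult_mat_vec[OF C Cc v] by simp
      also have "\<dots> = (W * Q) *\<^sub>v y"
        unfolding CC y_def using W Qc by (intro assoc_mult_mat_vec[OF _ W' v]) auto
      also have "\<dots> = W *\<^sub>v (Q *\<^sub>v y)"
        by (rule assoc_mult_mat_vec[OF W Qc y])
      finally show ?thesis .
    qed
    also have "(W *\<^sub>v (Q *\<^sub>v y)) \<bullet>c v = (Q *\<^sub>v y) \<bullet>c y"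
      using W Qc y v by (subst cscalar_prod_mat_adjoint) (auto simp: y_def mult_mat_vec_carrier)
    also have "Re ((Q *\<^sub>v y) \<bullet>c y) = (\<Sum>i<n. if s i = 0 then 0 else (cmod (y $ i))\<^sup>2)"
    proof -
      have "(Q *\<^sub>v y) $ i = (if s i = 0 then 0 else y $ i)" if "i < n" for i
      proof -
        have "(Q *\<^sub>v y) $ i = (\<Sum>j<n. Q $$ (i, j) * y $ j)"
          using that y Qc by (simp add: scalar_prod_def lessThan_atLeast0)
        also have "\<dots> = (\<Sum>j<n. if j = i then (if s i = 0 then 0 else y $ i) else 0)"
          using that by (intro sum.cong) (auto simp: Q mat_diag_def)
        finally have "(Q *\<^sub>v y) $ i = (\<Sum>j<n. if j = i then (if s i = 0 then 0 else y $ i) else 0)" .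
        thus ?thesis using that by (simp add: sum.delta)
      qed
      hence "(Q *\<^sub>v y) \<bullet>c y = complex_of_real (\<Sum>i<n. if s i = 0 then 0 else (cmod (y $ i))\<^sup>2)"
        using y by (auto simp: cscalar_prod_sum complex_norm_square simp del: of_real_power intro!: sum.cong)
      thus ?thesis by (simp del: of_real_sum)
    qed
    also have "\<dots> \<le> (\<Sum>i<n. (cmod (y $ i))\<^sup>2)"
      by (intro sum_mono) auto
    also have "\<dots> = Re (y \<bullet>c y)"
      using y by (simp add: cscalar_prod_sum complex_norm_square[symmetric] flip: of_real_power)
    also have "y \<bullet>c y = v \<bullet>c v"
    proof -
      have "y \<bullet>c y = v \<bullet>c (W *\<^sub>v y)"
        using W v y unfolding y_def by (subst cscalar_prod_mat_adjoint) auto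
      also have "W *\<^sub>v y = v"
        using assoc_mult_mat_vec[OF W W' v] v by (simp add: y_def WW')
      finally show ?thesis .
    qed
    finally have "(vnorm (mat_adjoint C *\<^sub>v v))\<^sup>2 \<le> (vnorm v)\<^sup>2"
      by (simp add: vnorm_power2_eq_Re)
    thus "vnorm (mat_adjoint C *\<^sub>v v) \<le> 1 * vnorm v"
      using power2_le_imp_le[OF _ vnorm_nonneg] by simp
  qed
  hence "op_bounded 1 C"
    using op_bounded_adjoint[OF Cc] by simp
  moreover have "mat_trace (C * X) = complex_of_real (trace_norm X)"
  proof -
    have "mat_trace (C * X) = mat_trace (W * (P * mat_adjoint W * mat_adjoint X * X))"
      unfolding C_def using W W' P X X' by (simp add: assoc)
    also have "\<dots> = mat_trace ((P * mat_adjoint W * mat_adjoint X * X) * W)"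
      using W W' P X X' by (intro mat_trace_commute[of _ n n]) (simp_all add: assoc)
    also have "(P * mat_adjoint W * mat_adjoint X * X) * W = P * mat_diag n (\<lambda>i. complex_of_real ((s i)\<^sup>2))"
      unfolding diag'[symmetric] using W W' P X X' by (simp add: assoc)
    also have "\<dots> = mat_diag n (\<lambda>i. complex_of_real (s i))"
      unfolding P_def mat_diag_diag by (rule eq_matI) (auto simp: mat_diag_def power2_eq_square field_simps)
    also have "mat_trace \<dots> = complex_of_real (trace_norm X)"
      by (simp add: mat_trace_def mat_diag_def tn s_def)
    finally show ?thesis .
  qed
  ultimately show ?thesis using C by blast
qed

text \<open>
  Through this rule every bound of a trace norm below becomes a bound of the number \<open>tr (C X)\<close> for
  a fixed contraction \<open>C\<close>, where factors of \<open>X\<close> can be moved cyclically onto \<open>C\<close>.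
\<close>

lemma trace_norm_leI:
  assumes X: "X \<in> carrier_mat n n"
    and "\<And>C. C \<in> carrier_mat n n \<Longrightarrow> op_bounded 1 C \<Longrightarrow> cmod (mat_trace (C * X)) \<le> b"
  shows "trace_norm X \<le> b"
proof -
  obtain C where "C \<in> carrier_mat n n" "op_bounded 1 C" "mat_trace (C * X) = complex_of_real (trace_norm X)"
    using trace_norm_attained[OF X] by blast
  from assms(2)[OF this(1,2)] this(3) show ?thesis by simp
qed

lemma trace_norm_nonneg:
  assumes X: "X \<in> carrier_mat n n"
  shows "0 \<le> trace_norm X"
proof -
  obtain W where "trace_norm X = (\<Sum>i<n. vnorm (X *\<^sub>v col W i))"
    using trace_norm_basis[OF X] by blast
  thus ?thesis by (simp add: sum_nonneg)
qed

lemma trace_norm_add: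
  assumes "X \<in> carrier_mat n n" "Y \<in> carrier_mat n n"
  shows "trace_norm (X + Y) \<le> trace_norm X + trace_norm Y"
proof (rule trace_norm_leI)
  fix C :: "complex mat" assume C: "C \<in> carrier_mat n n" "op_bounded 1 C"
  have "mat_trace (C * (X + Y)) = mat_trace (C * X) + mat_trace (C * Y)"
    using C assms by (simp add: mult_add_distrib_mat[of _ n n] mat_trace_add[of _ n] mult_carrier_mat[of _ n n _ n])
  thus "cmod (mat_trace (C * (X + Y))) \<le> trace_norm X + trace_norm Y"
    using norm_trace_mult_le[OF C assms(1)] norm_trace_mult_le[OF C assms(2)]
      norm_triangle_ineq[of "mat_trace (C * X)" "mat_trace (C * Y)"] by simp
qed (use assms in auto)

lemma trace_norm_smult_le:
  assumes X: "X \<in> carrier_mat n n"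
  shows "trace_norm (c \<cdot>\<^sub>m X) \<le> cmod c * trace_norm X"
proof (rule trace_norm_leI)
  fix C :: "complex mat" assume C: "C \<in> carrier_mat n n" "op_bounded 1 C"
  have "mat_trace (C * (c \<cdot>\<^sub>m X)) = c * mat_trace (C * X)"
    using C X by (simp add: mult_smult_distrib[of _ n n _ n] mat_trace_smult[of _ n] mult_carrier_mat[of _ n n _ n])
  thus "cmod (mat_trace (C * (c \<cdot>\<^sub>m X))) \<le> cmod c * trace_norm X"
    using norm_trace_mult_le[OF C X] by (simp add: norm_mult mult_left_mono)
qed (use X in auto)

lemma trace_norm_minus:
  assumes "X \<in> carrier_mat n n" "Y \<in> carrier_mat n n"
  shows "trace_norm (X - Y) \<le> trace_norm X + trace_norm Y"
proof -
  have "X - Y = X + (-1) \<cdot>\<^sub>m Y"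
    by (rule eq_matI) (use assms in auto)
  thus ?thesis using trace_norm_add[of X n "(-1) \<cdot>\<^sub>m Y"] trace_norm_smult_le[of Y n "-1"] assms by simp
qed

lemma trace_norm_triangle:
  assumes "X \<in> carrier_mat n n" "Y \<in> carrier_mat n n" "Z \<in> carrier_mat n n"
  shows "trace_norm (X - Z) \<le> trace_norm (X - Y) + trace_norm (Y - Z)"
proof -
  have "X - Z = (X - Y) + (Y - Z)"
    by (rule eq_matI) (use assms in auto)
  thus ?thesis using trace_norm_add[OF minus_carrier_mat[OF assms(2), of X] minus_carrier_mat[OF assms(3), of Y]] by simp
qed

lemma trace_norm_mat_sum:
  assumes "\<And>k. k \<in> I \<Longrightarrow> F k \<in> carrier_mat n n"
  shows "trace_norm (mat_sum n n I F) \<le> (\<Sum>k\<in>I. trace_norm (F k))"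
proof (rule trace_norm_leI)
  fix C :: "complex mat" assume C: "C \<in> carrier_mat n n" "op_bounded 1 C"
  have "mat_trace (C * mat_sum n n I F) = (\<Sum>k\<in>I. mat_trace (C * F k))"
    using C assms by (simp add: mult_mat_sum_right[of _ n n _ _ n] mat_trace_mat_sum mult_carrier_mat[of _ n n _ n])
  thus "cmod (mat_trace (C * mat_sum n n I F)) \<le> (\<Sum>k\<in>I. trace_norm (F k))"
    using norm_trace_mult_le[OF C assms] by (auto intro!: sum_norm_le)
qed auto

lemma op_bounded_one: "op_bounded 1 (1\<^sub>m n)"
  by (rule op_boundedI[of _ n n]) auto

lemma norm_trace_le:
  assumes "X \<in> carrier_mat n n"
  shows "cmod (mat_trace X) \<le> trace_norm X"
  using norm_trace_mult_le[OF one_carrier_mat op_bounded_one assms] assms by simp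

lemma op_bounded_mult:
  assumes D: "D \<in> carrier_mat n k" "op_bounded a D" and B: "B \<in> carrier_mat k l" "op_bounded b B" and "0 \<le> a"
  shows "op_bounded (a * b) (D * B)"
proof (rule op_boundedI)
  show "D * B \<in> carrier_mat n l" using D B by simp
  fix v :: "complex vec" assume v: "v \<in> carrier_vec l"
  have "vnorm ((D * B) *\<^sub>v v) = vnorm (D *\<^sub>v (B *\<^sub>v v))"
    using assoc_mult_mat_vec[OF D(1) B(1) v] by simp
  also have "\<dots> \<le> a * vnorm (B *\<^sub>v v)"
    using op_boundedD[OF D(2,1)] B v by (simp add: mult_mat_vec_carrier)
  also have "\<dots> \<le> a * (b * vnorm v)"
    using op_boundedD[OF B(2,1) v] \<open>0 \<le> a\<close> by (rule mult_left_mono)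
  finally show "vnorm ((D * B) *\<^sub>v v) \<le> a * b * vnorm v" by simp
qed

lemma trace_norm_mult_left:
  assumes D: "D \<in> carrier_mat n n" "op_bounded c D" and X: "X \<in> carrier_mat n n"
  shows "trace_norm (D * X) \<le> c * trace_norm X"
proof (rule trace_norm_leI)
  fix C :: "complex mat" assume C: "C \<in> carrier_mat n n" "op_bounded 1 C"
  have "op_bounded (1 * c) (C * D)" by (rule op_bounded_mult[OF C D]) simp
  thus "cmod (mat_trace (C * (D * X))) \<le> c * trace_norm X"
    using norm_trace_mult_le[of "C * D" n c X] C D X by (simp add: assoc_mult_mat[of _ n n _ n _ n])
qed (use D X in auto)

lemma trace_norm_mult_right:
  assumes D: "D \<in> carrier_mat n n" "op_bounded c D" "0 \<le> c" and X: "X \<in> carrier_mat n n"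
  shows "trace_norm (X * D) \<le> c * trace_norm X"
proof (rule trace_norm_leI)
  fix C :: "complex mat" assume C: "C \<in> carrier_mat n n" "op_bounded 1 C"
  have "op_bounded (c * 1) (D * C)" by (rule op_bounded_mult[OF D(1,2) C D(3)])
  moreover have "mat_trace (C * (X * D)) = mat_trace ((D * C) * X)"
    using mat_trace_commute[of "C * X" n n D] C D X
    by (simp add: assoc_mult_mat[of _ n n _ n _ n] mult_carrier_mat[of _ n n _ n])
  ultimately show "cmod (mat_trace (C * (X * D))) \<le> c * trace_norm X"
    using norm_trace_mult_le[of "D * C" n c X] C D X by simp
qed (use D X in auto)

text \<open>
  The vector \<open>u = X v\<close> satisfies \<open>\<parallel>u\<parallel>\<^sup>2 = tr (v u\<^sup>\<dagger> X)\<close>, and the rank-one matrix \<open>v u\<^sup>\<dagger>\<close> has operator norm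
  at most \<open>\<parallel>v\<parallel> \<parallel>u\<parallel>\<close>.
\<close>

lemma op_bounded_trace_norm:
  assumes X: "X \<in> carrier_mat n n"
  shows "op_bounded (trace_norm X) X"
proof (rule op_boundedI[OF X])
  fix v :: "complex vec" assume v: "v \<in> carrier_vec n"
  define u where "u = X *\<^sub>v v"
  have u: "u \<in> carrier_vec n" unfolding u_def using X v by simp
  define D where "D = mat n n (\<lambda>(i, j). v $ i * cnj (u $ j))"
  have D: "D \<in> carrier_mat n n" by (simp add: D_def)
  have "op_bounded (vnorm v * vnorm u) D"
  proof (rule op_boundedI[OF D])
    fix w :: "complex vec" assume w: "w \<in> carrier_vec n"
    have "D *\<^sub>v w = (w \<bullet>c u) \<cdot>\<^sub>v v"
      using u v w by (intro eq_vecI) (auto simp: D_def cscalar_prod_sum scalar_prod_def lessThan_atLeast0 sum_distrib_left mult_ac)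
    hence "vnorm (D *\<^sub>v w) = cmod (w \<bullet>c u) * vnorm v" by (simp add: vnorm_smult)
    also have "\<dots> \<le> (vnorm w * vnorm u) * vnorm v"
      using u w by (intro mult_right_mono cmod_cscalar_prod_le) auto
    finally show "vnorm (D *\<^sub>v w) \<le> vnorm v * vnorm u * vnorm w" by (simp add: mult_ac)
  qed
  from norm_trace_mult_le[OF D this X]
  have "cmod (mat_trace (D * X)) \<le> vnorm v * vnorm u * trace_norm X" .
  also have "mat_trace (D * X) = u \<bullet>c u"
  proof -
    have "mat_trace (D * X) = mat_trace (X * D)" by (rule mat_trace_commute[OF D X])
    also have "\<dots> = (\<Sum>i<n. u $ i * cnj (u $ i))"
      unfolding mat_trace_def
    proof (rule sum.cong)
      fix i assume "i \<in> {..<n}"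
      hence i: "i < n" by simp
      have "(X * D) $$ (i, i) = (\<Sum>j<n. X $$ (i, j) * v $ j) * cnj (u $ i)"
        using X D i by (simp add: index_mult_mat_sum D_def sum_distrib_left mult_ac del: index_mult_mat(1))
      also have "(\<Sum>j<n. X $$ (i, j) * v $ j) = u $ i"
        using X v i by (simp add: u_def scalar_prod_def lessThan_atLeast0)
      finally show "(X * D) $$ (i, i) = u $ i * cnj (u $ i)" .
    qed (use X in simp)
    also have "\<dots> = u \<bullet>c u" using u by (simp add: cscalar_prod_sum)
    finally show ?thesis .
  qed
  also have "cmod (u \<bullet>c u) = vnorm u * vnorm u"
    by (simp add: cscalar_prod_self norm_power power2_eq_square norm_mult)
  finally have "vnorm u * vnorm u \<le> vnorm u * (trace_norm X * vnorm v)" by (simp add: mult_ac)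
  thus "vnorm (X *\<^sub>v v) \<le> trace_norm X * vnorm v"
    using trace_norm_nonneg[OF X] vnorm_nonneg[of u] vnorm_nonneg[of v]
    unfolding u_def[symmetric] by (cases "vnorm u = 0") auto
qed

lemma op_bounded_index_le:
  assumes C: "C \<in> carrier_mat n k" "op_bounded c C" and ij: "i < n" "j < k"
  shows "cmod (C $$ (i, j)) \<le> c"
proof -
  have "C $$ (i, j) = (C *\<^sub>v unit_vec k j) $ i"
    using C ij by simp
  also have "cmod \<dots> \<le> vnorm (C *\<^sub>v unit_vec k j)"
    using C ij by (intro cmod_index_le_vnorm) auto
  also have "\<dots> \<le> c * vnorm (unit_vec k j)"
    by (rule op_boundedD[OF C(2,1)]) auto
  finally show ?thesis using ij by (simp add: vnorm_unit_vec)
qed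

text \<open>
  A contraction has entries of modulus at most one. The bound is crude, but it suffices to pass from
  entrywise differentiability to first-order expansions in trace norm.
\<close>

lemma trace_norm_le_sum_entries:
  assumes X: "X \<in> carrier_mat n n"
  shows "trace_norm X \<le> (\<Sum>i<n. \<Sum>j<n. cmod (X $$ (i, j)))"
proof (rule trace_norm_leI[OF X])
  fix C :: "complex mat" assume C: "C \<in> carrier_mat n n" "op_bounded 1 C"
  have "mat_trace (C * X) = (\<Sum>j<n. \<Sum>i<n. C $$ (j, i) * X $$ (i, j))"
    using C X by (auto simp: mat_trace_def index_mult_mat_sum simp del: index_mult_mat(1) intro!: sum.cong)
  also have "\<dots> = (\<Sum>i<n. \<Sum>j<n. C $$ (j, i) * X $$ (i, j))"
    by (rule sum.swap)
  also have "cmod \<dots> \<le> (\<Sum>i<n. \<Sum>j<n. cmod (X $$ (i, j)))"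
    by (intro sum_norm_le) (auto simp: norm_mult intro!: mult_left_le_one_le op_bounded_index_le[OF C])
  finally show "cmod (mat_trace (C * X)) \<le> (\<Sum>i<n. \<Sum>j<n. cmod (X $$ (i, j)))" .
qed

lemma mat_trace_self_adjoint_product:
  "mat_trace (B * mat_adjoint B) = complex_of_real ((frob_norm B)\<^sup>2)"
proof -
  have "mat_trace (B * mat_adjoint B) = (\<Sum>i<dim_row B. \<Sum>j<dim_col B. complex_of_real ((cmod (B $$ (i, j)))\<^sup>2))"
    unfolding mat_trace_def by (auto simp: index_mult_mat_sum complex_norm_square simp del: index_mult_mat(1) of_real_power intro!: sum.cong)
  thus ?thesis by (simp add: frob_norm_def sum_nonneg)
qed

lemma frob_norm_sum_vnorm_col: "(frob_norm B)\<^sup>2 = (\<Sum>j<dim_col B. (vnorm (col B j))\<^sup>2)"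
  unfolding frob_norm_def
  by (subst sum.swap) (simp add: vnorm_def L2_set_def sum_nonneg)

text \<open>
  For a contraction \<open>C\<close> the number \<open>tr (C B B\<^sup>\<dagger>)\<close> is the sum of \<open>\<langle>C b, b\<rangle>\<close> over the columns \<open>b\<close> of \<open>B\<close>.
\<close>

lemma trace_norm_gram_le:
  assumes B: "B \<in> carrier_mat n k"
  shows "trace_norm (B * mat_adjoint B) \<le> (frob_norm B)\<^sup>2"
proof (rule trace_norm_leI)
  show "B * mat_adjoint B \<in> carrier_mat n n" using B by auto
  fix C :: "complex mat" assume C: "C \<in> carrier_mat n n" "op_bounded 1 C"
  have B': "mat_adjoint B \<in> carrier_mat k n" using B by simp
  have CB: "C * B \<in> carrier_mat n k" using C B by simp
  have "mat_trace (C * (B * mat_adjoint B)) = mat_trace (mat_adjoint B * (C * B))"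
    using mat_trace_commute[OF CB B'] assoc_mult_mat[OF C(1) B B'] by simp
  also have "\<dots> = (\<Sum>j<k. col (C * B) j \<bullet>c col B j)"
    unfolding mat_trace_def using B C CB
    by (intro sum.cong) (auto simp: index_mat_adjoint_mult simp del: index_mult_mat(1))
  also have "\<dots> = (\<Sum>j<k. (C *\<^sub>v col B j) \<bullet>c col B j)"
    by (intro sum.cong refl) (simp only: lessThan_iff col_mult2[OF C(1) B])
  also have "cmod \<dots> \<le> (\<Sum>j<k. (vnorm (col B j))\<^sup>2)"
  proof (rule sum_norm_le)
    fix j assume "j \<in> {..<k}"
    hence b: "col B j \<in> carrier_vec n" using B by auto
    have "cmod ((C *\<^sub>v col B j) \<bullet>c col B j) \<le> vnorm (C *\<^sub>v col B j) * vnorm (col B j)"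
      using b C B by (intro cmod_cscalar_prod_le) auto
    also have "\<dots> \<le> 1 * vnorm (col B j) * vnorm (col B j)"
      by (intro mult_right_mono op_boundedD[OF C(2,1) b]) simp
    finally show "cmod ((C *\<^sub>v col B j) \<bullet>c col B j) \<le> (vnorm (col B j))\<^sup>2"
      by (simp add: power2_eq_square)
  qed
  also have "\<dots> = (frob_norm B)\<^sup>2" using B by (simp add: frob_norm_sum_vnorm_col)
  finally show "cmod (mat_trace (C * (B * mat_adjoint B))) \<le> (frob_norm B)\<^sup>2" .
qed

section \<open>The logarithmic norm of a dissipative generator\<close>

lemma cscalar_mult_mat_vec:
  fixes M :: "complex mat"
  assumes "M \<in> carrier_mat n k" "v \<in> carrier_vec k" "u \<in> carrier_vec n"
  shows "(M *\<^sub>v v) \<bullet>c u = (\<Sum>i<n. \<Sum>j<k. M $$ (i, j) * v $ j * cnj (u $ i))"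
  using assms by (auto simp: cscalar_prod_sum scalar_prod_def lessThan_atLeast0 sum_distrib_right intro!: sum.cong)

lemma cscalar_prod_add_left:
  fixes u v w :: "complex vec"
  shows "u \<in> carrier_vec n \<Longrightarrow> v \<in> carrier_vec n \<Longrightarrow> w \<in> carrier_vec n \<Longrightarrow>
    (u + v) \<bullet>c w = u \<bullet>c w + v \<bullet>c w"
  by (simp add: cscalar_prod_sum sum.distrib distrib_right)

lemma cscalar_prod_add_right:
  fixes u v w :: "complex vec"
  shows "u \<in> carrier_vec n \<Longrightarrow> v \<in> carrier_vec n \<Longrightarrow> w \<in> carrier_vec n \<Longrightarrow>
    u \<bullet>c (v + w) = u \<bullet>c v + u \<bullet>c w"
  by (simp add: cscalar_prod_sum sum.distrib distrib_left)

lemma cscalar_prod_smult_left: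
  fixes u w :: "complex vec"
  shows "u \<in> carrier_vec n \<Longrightarrow> w \<in> carrier_vec n \<Longrightarrow> (a \<cdot>\<^sub>v u) \<bullet>c w = a * (u \<bullet>c w)"
  by (simp add: cscalar_prod_sum sum_distrib_left mult.assoc)

lemma cscalar_prod_smult_right:
  fixes u w :: "complex vec"
  shows "u \<in> carrier_vec n \<Longrightarrow> w \<in> carrier_vec n \<Longrightarrow> u \<bullet>c (a \<cdot>\<^sub>v w) = cnj a * (u \<bullet>c w)"
  by (simp add: cscalar_prod_sum sum_distrib_left mult_ac)

lemma cscalar_prod_commute: 
  fixes u w :: "complex vec"
  shows "u \<in> carrier_vec n \<Longrightarrow> w \<in> carrier_vec n \<Longrightarrow> u \<bullet>c w = cnj (w \<bullet>c u)"
  by (simp add: cscalar_prod_sum mult.commute)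

lemma cscalar_add_mat:
  fixes M N :: "complex mat"
  assumes "M \<in> carrier_mat n k" "N \<in> carrier_mat n k" "v \<in> carrier_vec k" "u \<in> carrier_vec n"
  shows "((M + N) *\<^sub>v v) \<bullet>c u = (M *\<^sub>v v) \<bullet>c u + (N *\<^sub>v v) \<bullet>c u"
  using assms by (simp add: cscalar_mult_mat_vec[of _ n k] sum.distrib distrib_right)

lemma cscalar_smult_mat:
  fixes M :: "complex mat"
  assumes "M \<in> carrier_mat n k" "v \<in> carrier_vec k" "u \<in> carrier_vec n"
  shows "((a \<cdot>\<^sub>m M) *\<^sub>v v) \<bullet>c u = a * ((M *\<^sub>v v) \<bullet>c u)"
  using assms by (simp add: cscalar_mult_mat_vec[of _ n k] sum_distrib_left mult.assoc)

lemma cscalar_mat_sum: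
  assumes "\<And>l. l \<in> I \<Longrightarrow> F l \<in> carrier_mat n k" "v \<in> carrier_vec k" "u \<in> carrier_vec n"
  shows "(mat_sum n k I F *\<^sub>v v) \<bullet>c u = (\<Sum>l\<in>I. (F l *\<^sub>v v) \<bullet>c u)"
proof -
  have "(mat_sum n k I F *\<^sub>v v) \<bullet>c u = (\<Sum>i<n. \<Sum>j<k. \<Sum>l\<in>I. F l $$ (i, j) * v $ j * cnj (u $ i))"
    using assms(2,3) by (simp add: cscalar_mult_mat_vec[of _ n k] sum_distrib_right)
  also have "\<dots> = (\<Sum>l\<in>I. \<Sum>i<n. \<Sum>j<k. F l $$ (i, j) * v $ j * cnj (u $ i))"
    by (subst sum.swap[of _ _ I, symmetric]) (intro sum.cong refl sum.swap)
  also have "\<dots> = (\<Sum>l\<in>I. (F l *\<^sub>v v) \<bullet>c u)"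
    using assms by (intro sum.cong) (simp_all add: cscalar_mult_mat_vec[of _ n k])
  finally show ?thesis .
qed

text \<open>
  The arithmetic mean of \<open>\<parallel>v\<parallel>\<^sup>2\<close> and \<open>\<parallel>u\<parallel>\<^sup>2\<close> takes the place of the product \<open>\<parallel>v\<parallel> \<parallel>u\<parallel>\<close> in the hypothesis:
  unlike products, means of several form bounds simply add up.
\<close>

lemma op_bounded_if_form_bounded:
  assumes D: "D \<in> carrier_mat n n" and c: "0 \<le> c"
    and form: "\<And>v u. v \<in> carrier_vec n \<Longrightarrow> u \<in> carrier_vec n \<Longrightarrow>
      cmod ((D *\<^sub>v v) \<bullet>c u) \<le> c * ((vnorm v)\<^sup>2 + (vnorm u)\<^sup>2) / 2"
  shows "op_bounded c D"
proof (rule op_boundedI[OF D])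
  fix v :: "complex vec" assume v: "v \<in> carrier_vec n"
  define w where "w = D *\<^sub>v v"
  have w: "w \<in> carrier_vec n" unfolding w_def using D v by simp
  have form': "a * (vnorm w)\<^sup>2 \<le> c * ((vnorm v)\<^sup>2 + (a * vnorm w)\<^sup>2) / 2" if "0 \<le> a" for a
  proof -
    have "cmod (w \<bullet>c (complex_of_real a \<cdot>\<^sub>v w)) = a * (vnorm w)\<^sup>2"
      using w that by (simp add: cscalar_prod_smult_right[of _ n] cscalar_prod_self norm_mult norm_power)
    moreover have "vnorm (complex_of_real a \<cdot>\<^sub>v w) = a * vnorm w"
      using that by (simp add: vnorm_smult)
    ultimately show ?thesis
      using form[OF v, of "complex_of_real a \<cdot>\<^sub>v w"] w by (simp add: w_def)
  qed
  show "vnorm (D *\<^sub>v v) \<le> c * vnorm v"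
  proof (cases "vnorm v = 0 \<or> vnorm w = 0")
    case True
    have "vnorm w = 0" if "vnorm v = 0"
    proof -
      have "v = 0\<^sub>v n" using that v by (simp add: vnorm_eq_0_iff)
      hence "w = 0\<^sub>v n" unfolding w_def using D by (intro eq_vecI) (auto simp: scalar_prod_def)
      thus ?thesis by (simp add: vnorm_eq_0_iff[of _ n])
    qed
    thus ?thesis using True c unfolding w_def by auto
  next
    case False
    hence pos: "0 < vnorm v" "0 < vnorm w" using vnorm_nonneg[of v] vnorm_nonneg[of w] by linarith+
    \<comment> \<open>The factor rescales the test vector \<open>w\<close> to the norm of \<open>v\<close>, where the two means agree.\<close>
    have "vnorm v / vnorm w * (vnorm w)\<^sup>2 \<le> c * ((vnorm v)\<^sup>2 + (vnorm v / vnorm w * vnorm w)\<^sup>2) / 2"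
      using pos by (intro form') simp
    hence "vnorm v * vnorm w \<le> vnorm v * (c * vnorm v)"
      using pos by (simp add: power2_eq_square mult_ac)
    thus ?thesis using pos by (simp add: w_def)
  qed
qed

text \<open>
  The completely positive part of a Lindblad generator, and the generator itself. The set \<open>I\<close> of
  jump indices is a parameter: for the empty set \<open>gen\<close> is the drift \<open>X \<mapsto> A X + X A\<^sup>\<dagger>\<close> alone.
\<close>

definition jump :: "nat \<Rightarrow> nat set \<Rightarrow> (nat \<Rightarrow> real) \<Rightarrow> (nat \<Rightarrow> complex mat) \<Rightarrow> complex mat \<Rightarrow> complex mat" where
  "jump m I \<gamma> L X = mat_sum m m I (\<lambda>k. complex_of_real (\<gamma> k) \<cdot>\<^sub>m (L k * X * mat_adjoint (L k)))"

definition gen ::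
  "nat \<Rightarrow> nat set \<Rightarrow> (nat \<Rightarrow> real) \<Rightarrow> (nat \<Rightarrow> complex mat) \<Rightarrow> complex mat \<Rightarrow> complex mat \<Rightarrow> complex mat" where
  "gen m I \<gamma> L A X = A * X + X * mat_adjoint A + jump m I \<gamma> L X"

lemma jump_carrier [simp]: "jump m I \<gamma> L X \<in> carrier_mat m m"
  by (simp add: jump_def)

text \<open>
  The dissipativity condition says that \<open>A + A\<^sup>\<dagger> + \<Sum>\<^sub>k \<gamma>\<^sub>k L\<^sub>k\<^sup>\<dagger> L\<^sub>k\<close> is negative semidefinite. With an inequality
  instead of an equation the condition is inherited by every subset of the jumps, so that the full
  generator and the drift alone are both instances.
\<close>

locale dissipative_generator =
  fixes m :: nat and I :: "nat set" and \<gamma> :: "nat \<Rightarrow> real" and L :: "nat \<Rightarrow> complex mat" and A :: "complex mat"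
  assumes A: "A \<in> carrier_mat m m"
    and L: "\<And>k. k \<in> I \<Longrightarrow> L k \<in> carrier_mat m m"
    and \<gamma>: "\<And>k. k \<in> I \<Longrightarrow> 0 \<le> \<gamma> k"
    and dissipative: "\<And>v. v \<in> carrier_vec m \<Longrightarrow>
      2 * Re ((A *\<^sub>v v) \<bullet>c v) + (\<Sum>k\<in>I. \<gamma> k * (vnorm (L k *\<^sub>v v))\<^sup>2) \<le> 0"
begin

abbreviation J where "J \<equiv> jump m I \<gamma> L"
abbreviation G where "G \<equiv> gen m I \<gamma> L A"

lemma A': "mat_adjoint A \<in> carrier_mat m m"
  using A by simp

lemma gen_carrier [simp]: "X \<in> carrier_mat m m \<Longrightarrow> G X \<in> carrier_mat m m"
  unfolding gen_def using A by simp

lemmas assoc = assoc_mult_mat[of _ m m _ m _ m] mult_carrier_mat[of _ m m _ m]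

definition jump_bound where "jump_bound = (\<Sum>k\<in>I. \<gamma> k * (trace_norm (L k))\<^sup>2)"

lemma jump_bound_nonneg: "0 \<le> jump_bound"
  unfolding jump_bound_def using \<gamma> by (intro sum_nonneg mult_nonneg_nonneg) auto

lemma trace_norm_jump_le:
  assumes X: "X \<in> carrier_mat m m"
  shows "trace_norm (J X) \<le> jump_bound * trace_norm X"
proof -
  have "trace_norm (J X) \<le> (\<Sum>k\<in>I. trace_norm (complex_of_real (\<gamma> k) \<cdot>\<^sub>m (L k * X * mat_adjoint (L k))))"
    unfolding jump_def using L X by (intro trace_norm_mat_sum) (auto simp: assoc)
  also have "\<dots> \<le> (\<Sum>k\<in>I. \<gamma> k * (trace_norm (L k))\<^sup>2 * trace_norm X)"
  proof (rule sum_mono)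
    fix k assume k: "k \<in> I"
    have Lk: "L k \<in> carrier_mat m m" using L[OF k] .
    have LX: "L k * X \<in> carrier_mat m m" using Lk X by simp
    have L': "mat_adjoint (L k) \<in> carrier_mat m m" using Lk by simp
    note nn = trace_norm_nonneg[OF Lk]
    note bd = op_bounded_trace_norm[OF Lk]
    have "trace_norm (complex_of_real (\<gamma> k) \<cdot>\<^sub>m (L k * X * mat_adjoint (L k)))
        \<le> \<gamma> k * trace_norm (L k * X * mat_adjoint (L k))"
      using trace_norm_smult_le[of "L k * X * mat_adjoint (L k)" m "complex_of_real (\<gamma> k)"] LX L' \<gamma>[OF k] by simp
    also have "trace_norm (L k * X * mat_adjoint (L k)) \<le> trace_norm (L k) * trace_norm (L k * X)"
      by (rule trace_norm_mult_right[OF L' op_bounded_adjoint[OF Lk bd nn] nn LX])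
    also have "trace_norm (L k * X) \<le> trace_norm (L k) * trace_norm X"
      by (rule trace_norm_mult_left[OF Lk bd X])
    finally show "trace_norm (complex_of_real (\<gamma> k) \<cdot>\<^sub>m (L k * X * mat_adjoint (L k)))
        \<le> \<gamma> k * (trace_norm (L k))\<^sup>2 * trace_norm X"
      using nn \<gamma>[OF k] by (simp add: power2_eq_square mult_left_mono mult.assoc)
  qed
  finally show ?thesis by (simp add: jump_bound_def sum_distrib_right)
qed

lemma trace_norm_commutator_le:
  assumes X: "X \<in> carrier_mat m m"
  shows "trace_norm (A * X + X * mat_adjoint A) \<le> 2 * trace_norm A * trace_norm X"
proof -
  note nn = trace_norm_nonneg[OF A]
  note bd = op_bounded_trace_norm[OF A]
  have "trace_norm (A * X) \<le> trace_norm A * trace_norm X"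
    by (rule trace_norm_mult_left[OF A bd X])
  moreover have "trace_norm (X * mat_adjoint A) \<le> trace_norm A * trace_norm X"
    by (rule trace_norm_mult_right[OF A' op_bounded_adjoint[OF A bd nn] nn X])
  moreover have "trace_norm (A * X + X * mat_adjoint A) \<le> trace_norm (A * X) + trace_norm (X * mat_adjoint A)"
    using A A' X by (intro trace_norm_add[of _ m]) auto
  ultimately show ?thesis by simp
qed

lemma jump_linear:
  assumes X: "X \<in> carrier_mat m m" and Y: "Y \<in> carrier_mat m m"
  shows "J (X + a \<cdot>\<^sub>m Y) = J X + a \<cdot>\<^sub>m J Y"
proof (rule eq_matI)
  fix i j assume "i < dim_row (J X + a \<cdot>\<^sub>m J Y)" "j < dim_col (J X + a \<cdot>\<^sub>m J Y)"
  hence ij: "i < m" "j < m" by (auto simp: jump_def)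
  define F where "F Z k = complex_of_real (\<gamma> k) \<cdot>\<^sub>m (L k * Z * mat_adjoint (L k))" for Z k
  have F: "F (X + a \<cdot>\<^sub>m Y) k $$ (i, j) = F X k $$ (i, j) + a * F Y k $$ (i, j)" if k: "k \<in> I" for k
  proof -
    have Lk: "L k \<in> carrier_mat m m" "mat_adjoint (L k) \<in> carrier_mat m m" using L[OF k] by auto
    have "L k * (X + a \<cdot>\<^sub>m Y) * mat_adjoint (L k) = L k * X * mat_adjoint (L k) + a \<cdot>\<^sub>m (L k * Y * mat_adjoint (L k))"
      using X Y Lk by (simp add: mult_add_distrib_mat[of _ m m _ m] add_mult_distrib_mat[of _ m m _ _ m]
          mult_smult_distrib[of _ m m _ m] mult_smult_assoc_mat[of _ m m _ m])
    thus ?thesis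
      using ij Lk unfolding F_def by (simp add: distrib_left del: index_mult_mat(1))
  qed
  have "J (X + a \<cdot>\<^sub>m Y) $$ (i, j) = (\<Sum>k\<in>I. F (X + a \<cdot>\<^sub>m Y) k $$ (i, j))"
    using ij by (simp add: jump_def F_def)
  also have "\<dots> = (\<Sum>k\<in>I. F X k $$ (i, j) + a * F Y k $$ (i, j))"
    by (rule sum.cong) (simp_all add: F)
  also have "\<dots> = (J X + a \<cdot>\<^sub>m J Y) $$ (i, j)"
    using ij by (simp add: jump_def F_def sum.distrib sum_distrib_left)
  finally show "J (X + a \<cdot>\<^sub>m Y) $$ (i, j) = (J X + a \<cdot>\<^sub>m J Y) $$ (i, j)" .
qed (auto simp: jump_def)

lemma gen_linear:
  assumes X: "X \<in> carrier_mat m m" and Y: "Y \<in> carrier_mat m m"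
  shows "G (X + a \<cdot>\<^sub>m Y) = G X + a \<cdot>\<^sub>m G Y"
proof -
  have rearrange: "(P + a \<cdot>\<^sub>m P') + (Q + a \<cdot>\<^sub>m Q') + (R + a \<cdot>\<^sub>m R') = (P + Q + R) + a \<cdot>\<^sub>m (P' + Q' + R')"
    if "P \<in> carrier_mat m m" "Q \<in> carrier_mat m m" "R \<in> carrier_mat m m"
      "P' \<in> carrier_mat m m" "Q' \<in> carrier_mat m m" "R' \<in> carrier_mat m m" for P Q R P' Q' R' :: "complex mat"
    using that by (intro eq_matI) (auto simp: distrib_left)
  have "A * (X + a \<cdot>\<^sub>m Y) = A * X + a \<cdot>\<^sub>m (A * Y)"
    using A X Y by (simp add: mult_add_distrib_mat[of _ m m _ m] mult_smult_distrib[of _ m m _ m])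
  moreover have "(X + a \<cdot>\<^sub>m Y) * mat_adjoint A = X * mat_adjoint A + a \<cdot>\<^sub>m (Y * mat_adjoint A)"
    using X Y A' by (simp add: add_mult_distrib_mat[of _ m m _ _ m] mult_smult_assoc_mat[of _ m m _ m])
  ultimately show ?thesis
    unfolding gen_def jump_linear[OF X Y] using A A' X Y by (simp add: rearrange)
qed

lemma gen_minus:
  assumes X: "X \<in> carrier_mat m m" and Y: "Y \<in> carrier_mat m m"
  shows "G (X - Y) = G X - G Y"
proof -
  have minus: "P - Q = P + (- 1) \<cdot>\<^sub>m Q" if "P \<in> carrier_mat m m" "Q \<in> carrier_mat m m" for P Q :: "complex mat"
    using that by (intro eq_matI) auto
  show ?thesis
    unfolding minus[OF X Y] minus[OF gen_carrier[OF X] gen_carrier[OF Y]] by (rule gen_linear[OF X Y])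
qed

lemma trace_norm_gen_le:
  assumes X: "X \<in> carrier_mat m m"
  shows "trace_norm (G X) \<le> (2 * trace_norm A + jump_bound) * trace_norm X"
proof -
  have "trace_norm (G X) \<le> trace_norm (A * X + X * mat_adjoint A) + trace_norm (J X)"
    unfolding gen_def using A A' X by (intro trace_norm_add[of _ m]) auto
  thus ?thesis
    using trace_norm_commutator_le[OF X] trace_norm_jump_le[OF X] by (simp add: distrib_right)
qed

text \<open>
  The logarithmic norm of the generator with respect to the trace norm is at most zero. Up to the
  second-order term \<open>h\<^sup>2 A X A\<^sup>\<dagger>\<close>, the Euler step \<open>X + h G X\<close> has the Kraus form \<open>\<Sum>\<^sub>k B\<^sub>k X B\<^sub>k\<^sup>\<dagger>\<close> with
  \<open>B\<^sub>0 = 1 + h A\<close> and \<open>B\<^sub>k = \<surd>(h \<gamma>\<^sub>k) L\<^sub>k\<close>. By duality this map acts on the test contraction \<open>C\<close> as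
  \<open>\<Sum>\<^sub>k B\<^sub>k\<^sup>\<dagger> C B\<^sub>k\<close>, which is bounded by the form \<open>\<Sum>\<^sub>k \<parallel>B\<^sub>k v\<parallel>\<^sup>2\<close>, and by dissipativity the first-order
  terms of that form sum up to something nonpositive.
\<close>

lemma trace_norm_euler_step_le:
  assumes X: "X \<in> carrier_mat m m" and h: "0 \<le> h"
  shows "trace_norm (X + complex_of_real h \<cdot>\<^sub>m G X) \<le> (1 + 2 * (trace_norm A)\<^sup>2 * h\<^sup>2) * trace_norm X"
proof (rule trace_norm_leI)
  show "X + complex_of_real h \<cdot>\<^sub>m G X \<in> carrier_mat m m" using X by simp
  fix C :: "complex mat" assume C: "C \<in> carrier_mat m m" and contraction: "op_bounded 1 C"
  define c where "c = trace_norm A"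
  have c0: "0 \<le> c" unfolding c_def by (rule trace_norm_nonneg[OF A])
  have cA: "op_bounded c A" unfolding c_def by (rule op_bounded_trace_norm[OF A])
  have L': "mat_adjoint (L k) \<in> carrier_mat m m" if "k \<in> I" for k using L[OF that] by simp
  define S where "S = mat_sum m m I (\<lambda>k. complex_of_real (\<gamma> k) \<cdot>\<^sub>m (mat_adjoint (L k) * C * L k))"
  have S: "S \<in> carrier_mat m m" by (simp add: S_def)
  \<comment> \<open>\<open>D\<close> is the image of \<open>C\<close> under the adjoint of the Euler step.\<close>
  define D where "D = C + complex_of_real h \<cdot>\<^sub>m (C * A + mat_adjoint A * C + S)"
  have D: "D \<in> carrier_mat m m" unfolding D_def using A A' C S by auto
  have trS: "mat_trace (C * J X) = mat_trace (S * X)"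
  proof -
    have "mat_trace (C * J X) = (\<Sum>k\<in>I. mat_trace (C * (complex_of_real (\<gamma> k) \<cdot>\<^sub>m (L k * X * mat_adjoint (L k)))))"
      unfolding jump_def using C L L' X
      by (simp add: mult_mat_sum_right[of _ m m _ _ m] mat_trace_mat_sum assoc)
    also have "\<dots> = (\<Sum>k\<in>I. mat_trace ((complex_of_real (\<gamma> k) \<cdot>\<^sub>m (mat_adjoint (L k) * C * L k)) * X))"
    proof (rule sum.cong[OF refl])
      fix k assume k: "k \<in> I"
      have "mat_trace (C * (L k * X * mat_adjoint (L k))) = mat_trace ((C * (L k * X)) * mat_adjoint (L k))"
        using C L[OF k] L'[OF k] X by (simp add: assoc)
      also have "\<dots> = mat_trace (mat_adjoint (L k) * (C * (L k * X)))"
        using C L[OF k] L'[OF k] X by (intro mat_trace_commute[of _ m m]) (auto simp: assoc)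
      finally show "mat_trace (C * (complex_of_real (\<gamma> k) \<cdot>\<^sub>m (L k * X * mat_adjoint (L k)))) =
        mat_trace ((complex_of_real (\<gamma> k) \<cdot>\<^sub>m (mat_adjoint (L k) * C * L k)) * X)"
        using C L[OF k] L'[OF k] X
        by (simp add: assoc mult_smult_distrib[of _ m m _ m] mult_smult_assoc_mat[of _ m m _ m] mat_trace_smult[of _ m])
    qed
    also have "\<dots> = mat_trace (S * X)"
      unfolding S_def using C L L' X
      by (simp add: mult_mat_sum_left[of _ m m _ _ m] mat_trace_mat_sum assoc)
    finally show ?thesis .
  qed
  have trA: "mat_trace (C * (X * mat_adjoint A)) = mat_trace (mat_adjoint A * C * X)"
    using mat_trace_commute[of "C * X" m m "mat_adjoint A"] C X A A' by (simp add: assoc)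
  have "mat_trace (C * (X + complex_of_real h \<cdot>\<^sub>m G X)) = mat_trace (D * X)"
    unfolding gen_def D_def using C X A A' S trS trA
    by (simp add: assoc mult_smult_distrib[of _ m m _ m] mult_smult_assoc_mat[of _ m m _ m] mat_trace_smult[of _ m]
        mult_add_distrib_mat[of _ m m _ m] add_mult_distrib_mat[of _ m m _ _ m] mat_trace_add[of _ m])
  moreover have "op_bounded (1 + 2 * c\<^sup>2 * h\<^sup>2) D"
  proof (rule op_bounded_if_form_bounded[OF D])
    fix v u :: "complex vec" assume v: "v \<in> carrier_vec m" and u: "u \<in> carrier_vec m"
    have Av: "A *\<^sub>v w \<in> carrier_vec m" if "w \<in> carrier_vec m" for w using A that by simp
    have Lv: "L k *\<^sub>v w \<in> carrier_vec m" if "k \<in> I" "w \<in> carrier_vec m" for k w using L[OF that(1)] that(2) by simp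
    have Cv: "C *\<^sub>v w \<in> carrier_vec m" if "w \<in> carrier_vec m" for w using C that by simp
    define p where "p w = w + complex_of_real h \<cdot>\<^sub>v (A *\<^sub>v w)" for w
    have p: "p w \<in> carrier_vec m" if "w \<in> carrier_vec m" for w using Av[OF that] that by (simp add: p_def)
    \<comment> \<open>\<open>N w\<close> is the sum of \<open>\<parallel>B\<^sub>k w\<parallel>\<^sup>2\<close> over all Kraus operators, with \<open>p w = B\<^sub>0 w\<close>.\<close>
    define N where "N w = (vnorm (p w))\<^sup>2 + h * (\<Sum>k\<in>I. \<gamma> k * (vnorm (L k *\<^sub>v w))\<^sup>2)" for w
    have N: "N w \<le> (1 + c\<^sup>2 * h\<^sup>2) * (vnorm w)\<^sup>2" if w: "w \<in> carrier_vec m" for w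
    proof -
      have "(vnorm (p w))\<^sup>2 = (vnorm w)\<^sup>2 + h * (2 * Re ((A *\<^sub>v w) \<bullet>c w)) + h\<^sup>2 * (vnorm (A *\<^sub>v w))\<^sup>2"
        unfolding vnorm_power2_eq_Re p_def using w Av[OF w] cscalar_prod_commute[OF w Av[OF w]]
        by (simp add: cscalar_prod_add_left[of _ m] cscalar_prod_add_right[of _ m] cscalar_prod_smult_left[of _ m]
            cscalar_prod_smult_right[of _ m] power2_eq_square algebra_simps)
      hence "N w = (vnorm w)\<^sup>2 + h * (2 * Re ((A *\<^sub>v w) \<bullet>c w) + (\<Sum>k\<in>I. \<gamma> k * (vnorm (L k *\<^sub>v w))\<^sup>2))
          + h\<^sup>2 * (vnorm (A *\<^sub>v w))\<^sup>2"
        by (simp add: N_def distrib_left)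
      also have "\<dots> \<le> (vnorm w)\<^sup>2 + 0 + h\<^sup>2 * (c * vnorm w)\<^sup>2"
        using dissipative[OF w] h op_boundedD[OF cA A w]
        by (intro add_mono mult_left_mono power_mono) (auto simp: mult_nonneg_nonpos)
      finally show ?thesis by (simp add: algebra_simps power_mult_distrib)
    qed
    have DS: "(S *\<^sub>v v) \<bullet>c u = (\<Sum>k\<in>I. complex_of_real (\<gamma> k) * ((C *\<^sub>v (L k *\<^sub>v v)) \<bullet>c (L k *\<^sub>v u)))"
    proof -
      have "(S *\<^sub>v v) \<bullet>c u = (\<Sum>k\<in>I. ((complex_of_real (\<gamma> k) \<cdot>\<^sub>m (mat_adjoint (L k) * C * L k)) *\<^sub>v v) \<bullet>c u)"
        unfolding S_def using C L L' v u by (intro cscalar_mat_sum) (auto simp: assoc)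
      also have "\<dots> = (\<Sum>k\<in>I. complex_of_real (\<gamma> k) * ((C *\<^sub>v (L k *\<^sub>v v)) \<bullet>c (L k *\<^sub>v u)))"
      proof (rule sum.cong[OF refl])
        fix k assume k: "k \<in> I"
        have "((mat_adjoint (L k) * C * L k) *\<^sub>v v) \<bullet>c u = (mat_adjoint (L k) *\<^sub>v (C *\<^sub>v (L k *\<^sub>v v))) \<bullet>c u"
          using C L[OF k] L'[OF k] v
          by (simp add: assoc_mult_mat_vec[of _ m m _ m] mult_carrier_mat[of _ m m _ m] mult_mat_vec_carrier[of _ m m])
        also have "\<dots> = (C *\<^sub>v (L k *\<^sub>v v)) \<bullet>c (L k *\<^sub>v u)"
          using C L[OF k] Cv[OF Lv[OF k v]] u by (subst cscalar_prod_mat_adjoint) auto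
        finally show "((complex_of_real (\<gamma> k) \<cdot>\<^sub>m (mat_adjoint (L k) * C * L k)) *\<^sub>v v) \<bullet>c u =
            complex_of_real (\<gamma> k) * ((C *\<^sub>v (L k *\<^sub>v v)) \<bullet>c (L k *\<^sub>v u))"
          using cscalar_smult_mat[OF mult_carrier_mat[OF mult_carrier_mat[OF L'[OF k] C] L[OF k]] v u] by metis
      qed
      finally show ?thesis .
    qed
    have DA: "((mat_adjoint A * C) *\<^sub>v v) \<bullet>c u = (C *\<^sub>v v) \<bullet>c (A *\<^sub>v u)"
    proof -
      have "((mat_adjoint A * C) *\<^sub>v v) \<bullet>c u = (mat_adjoint A *\<^sub>v (C *\<^sub>v v)) \<bullet>c u"
        using assoc_mult_mat_vec[OF A' C v] by simp
      also have "\<dots> = (C *\<^sub>v v) \<bullet>c (A *\<^sub>v u)"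
        using A Cv[OF v] u by (subst cscalar_prod_mat_adjoint) auto
      finally show ?thesis .
    qed
    have CA: "(C * A) *\<^sub>v v = C *\<^sub>v (A *\<^sub>v v)" using assoc_mult_mat_vec[OF C A v] by simp
    have "C *\<^sub>v p v = C *\<^sub>v v + complex_of_real h \<cdot>\<^sub>v (C *\<^sub>v (A *\<^sub>v v))"
      unfolding p_def using C v Av[OF v]
      by (simp add: mult_add_distrib_mat_vec[of _ m m] mult_mat_vec[of _ m m])
    hence Cp: "(C *\<^sub>v p v) \<bullet>c p u = (C *\<^sub>v v) \<bullet>c u + complex_of_real h * ((C *\<^sub>v (A *\<^sub>v v)) \<bullet>c u)
        + complex_of_real h * ((C *\<^sub>v v) \<bullet>c (A *\<^sub>v u)) + (complex_of_real h)\<^sup>2 * ((C *\<^sub>v (A *\<^sub>v v)) \<bullet>c (A *\<^sub>v u))"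
      unfolding p_def using Cv[OF v] Cv[OF Av[OF v]] u Av[OF u]
      by (simp add: cscalar_prod_add_left[of _ m] cscalar_prod_add_right[of _ m] cscalar_prod_smult_left[of _ m]
            cscalar_prod_smult_right[of _ m] power2_eq_square algebra_simps)
    have "(D *\<^sub>v v) \<bullet>c u = (C *\<^sub>v v) \<bullet>c u + complex_of_real h * ((C *\<^sub>v (A *\<^sub>v v)) \<bullet>c u + (C *\<^sub>v v) \<bullet>c (A *\<^sub>v u) + (S *\<^sub>v v) \<bullet>c u)"
      unfolding D_def using C A A' S v u DA CA
      by (simp add: cscalar_add_mat[of _ m m] cscalar_smult_mat[of _ m m] mult_carrier_mat[of _ m m _ m])
    also have "\<dots> = (C *\<^sub>v p v) \<bullet>c p u + complex_of_real h * ((S *\<^sub>v v) \<bullet>c u) - (complex_of_real h)\<^sup>2 * ((C *\<^sub>v (A *\<^sub>v v)) \<bullet>c (A *\<^sub>v u))"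
      unfolding Cp by (simp add: algebra_simps)
    finally have "cmod ((D *\<^sub>v v) \<bullet>c u) \<le> cmod ((C *\<^sub>v p v) \<bullet>c p u) + h * cmod ((S *\<^sub>v v) \<bullet>c u)
        + h\<^sup>2 * cmod ((C *\<^sub>v (A *\<^sub>v v)) \<bullet>c (A *\<^sub>v u))"
      using h by (simp add: norm_mult norm_power order.trans[OF norm_triangle_ineq4] order.trans[OF norm_triangle_ineq])
    have contr: "cmod ((C *\<^sub>v x) \<bullet>c y) \<le> ((vnorm x)\<^sup>2 + (vnorm y)\<^sup>2) / 2"
      if x: "x \<in> carrier_vec m" and y: "y \<in> carrier_vec m" for x y
    proof -
      have "cmod ((C *\<^sub>v x) \<bullet>c y) \<le> vnorm (C *\<^sub>v x) * vnorm y"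
        using C y by (intro cmod_cscalar_prod_le) auto
      also have "\<dots> \<le> 1 * vnorm x * vnorm y"
        by (intro mult_right_mono op_boundedD[OF contraction C x]) simp
      also have "\<dots> \<le> ((vnorm x)\<^sup>2 + (vnorm y)\<^sup>2) / 2"
        using sum_squares_bound[of "vnorm x" "vnorm y"] by simp
      finally show ?thesis .
    qed
    have "cmod ((S *\<^sub>v v) \<bullet>c u) \<le> (\<Sum>k\<in>I. \<gamma> k * (((vnorm (L k *\<^sub>v v))\<^sup>2 + (vnorm (L k *\<^sub>v u))\<^sup>2) / 2))"
      unfolding DS
    proof (rule sum_norm_le)
      fix k assume k: "k \<in> I"
      show "cmod (complex_of_real (\<gamma> k) * ((C *\<^sub>v (L k *\<^sub>v v)) \<bullet>c (L k *\<^sub>v u)))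
        \<le> \<gamma> k * (((vnorm (L k *\<^sub>v v))\<^sup>2 + (vnorm (L k *\<^sub>v u))\<^sup>2) / 2)"
        using mult_left_mono[OF contr[OF Lv[OF k v] Lv[OF k u]] \<gamma>[OF k]] \<gamma>[OF k] by (simp add: norm_mult)
    qed
    also have "\<dots> = ((\<Sum>k\<in>I. \<gamma> k * (vnorm (L k *\<^sub>v v))\<^sup>2) + (\<Sum>k\<in>I. \<gamma> k * (vnorm (L k *\<^sub>v u))\<^sup>2)) / 2"
      by (simp add: sum.distrib sum_divide_distrib[symmetric] distrib_left add_divide_distrib)
    finally have bS: "h * cmod ((S *\<^sub>v v) \<bullet>c u) \<le>
      h * (((\<Sum>k\<in>I. \<gamma> k * (vnorm (L k *\<^sub>v v))\<^sup>2) + (\<Sum>k\<in>I. \<gamma> k * (vnorm (L k *\<^sub>v u))\<^sup>2)) / 2)"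
      using h by (rule mult_left_mono)
    have bA: "h\<^sup>2 * cmod ((C *\<^sub>v (A *\<^sub>v v)) \<bullet>c (A *\<^sub>v u)) \<le> h\<^sup>2 * (((c * vnorm v)\<^sup>2 + (c * vnorm u)\<^sup>2) / 2)"
    proof (rule mult_left_mono)
      have "cmod ((C *\<^sub>v (A *\<^sub>v v)) \<bullet>c (A *\<^sub>v u)) \<le> ((vnorm (A *\<^sub>v v))\<^sup>2 + (vnorm (A *\<^sub>v u))\<^sup>2) / 2"
        by (rule contr[OF Av[OF v] Av[OF u]])
      also have "\<dots> \<le> ((c * vnorm v)\<^sup>2 + (c * vnorm u)\<^sup>2) / 2"
        using op_boundedD[OF cA A v] op_boundedD[OF cA A u]
        by (intro divide_right_mono add_mono power_mono) auto
      finally show "cmod ((C *\<^sub>v (A *\<^sub>v v)) \<bullet>c (A *\<^sub>v u)) \<le> ((c * vnorm v)\<^sup>2 + (c * vnorm u)\<^sup>2) / 2" .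
    qed simp
    have "cmod ((D *\<^sub>v v) \<bullet>c u) \<le> (N v + N u) / 2 + h\<^sup>2 * (((c * vnorm v)\<^sup>2 + (c * vnorm u)\<^sup>2) / 2)"
      using \<open>cmod ((D *\<^sub>v v) \<bullet>c u) \<le> _\<close> contr[OF p[OF v] p[OF u]] bS bA
      by (simp add: N_def field_simps)
    also have "\<dots> \<le> ((1 + c\<^sup>2 * h\<^sup>2) * (vnorm v)\<^sup>2 + (1 + c\<^sup>2 * h\<^sup>2) * (vnorm u)\<^sup>2) / 2 + h\<^sup>2 * (((c * vnorm v)\<^sup>2 + (c * vnorm u)\<^sup>2) / 2)"
      using N[OF v] N[OF u] by simp
    also have "\<dots> = (1 + 2 * c\<^sup>2 * h\<^sup>2) * ((vnorm v)\<^sup>2 + (vnorm u)\<^sup>2) / 2"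
      by (simp add: field_simps power_mult_distrib)
    finally show "cmod ((D *\<^sub>v v) \<bullet>c u) \<le> (1 + 2 * c\<^sup>2 * h\<^sup>2) * ((vnorm v)\<^sup>2 + (vnorm u)\<^sup>2) / 2" .
  qed simp
  ultimately show "cmod (mat_trace (C * (X + complex_of_real h \<cdot>\<^sub>m G X))) \<le> (1 + 2 * (trace_norm A)\<^sup>2 * h\<^sup>2) * trace_norm X"
    using norm_trace_mult_le[OF D _ X] by (simp add: c_def)
qed

end

section \<open>A differential inequality in trace norm\<close>

definition has_mat_derivative ::
  "nat \<Rightarrow> (real \<Rightarrow> complex mat) \<Rightarrow> complex mat \<Rightarrow> real filter \<Rightarrow> bool" where
  "has_mat_derivative n F F' net \<longleftrightarrow>
     (\<forall>i<n. \<forall>j<n. ((\<lambda>s. F s $$ (i, j)) has_vector_derivative F' $$ (i, j)) net)"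

text \<open>
  Differentiability is entrywise, the remainder is measured in trace norm: the entries have a common
  radius \<open>d\<close> because there are finitely many, and the sum of their moduli dominates the trace norm.
\<close>

lemma has_mat_derivative_remainder:
  assumes F: "has_mat_derivative n F F' (at x within S)"
    and c: "\<And>s. s \<in> S \<Longrightarrow> F s \<in> carrier_mat n n" "F' \<in> carrier_mat n n" and x: "x \<in> S" and \<eta>: "0 < \<eta>"
  shows "\<exists>d>0. \<forall>s\<in>S. \<bar>s - x\<bar> < d \<longrightarrow>
    trace_norm (F s - F x - complex_of_real (s - x) \<cdot>\<^sub>m F') \<le> \<eta> * \<bar>s - x\<bar>"
proof -
  define \<eta>' where "\<eta>' = \<eta> / (real n * real n + 1)"
  have \<eta>': "0 < \<eta>'" using \<eta> by (simp add: \<eta>'_def add_nonneg_pos)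
  have "\<forall>i\<in>{..<n}. \<forall>j\<in>{..<n}. eventually (\<lambda>s. cmod (F s $$ (i, j) - F x $$ (i, j) - complex_of_real (s - x) * F' $$ (i, j)) \<le> \<eta>' * \<bar>s - x\<bar>) (at x within S)"
  proof (intro ballI)
    fix i j assume "i \<in> {..<n}" "j \<in> {..<n}"
    hence "((\<lambda>s. F s $$ (i, j)) has_vector_derivative F' $$ (i, j)) (at x within S)"
      using F by (simp add: has_mat_derivative_def)
    hence "((\<lambda>y. (1 / norm (y - x)) *\<^sub>R (F y $$ (i, j) - (F x $$ (i, j) + (y - x) *\<^sub>R F' $$ (i, j)))) \<longlongrightarrow> 0) (at x within S)"
      by (simp add: has_vector_derivative_def has_derivative_within)
    from tendstoD[OF this \<eta>'] show "eventually (\<lambda>s. cmod (F s $$ (i, j) - F x $$ (i, j) - complex_of_real (s - x) * F' $$ (i, j)) \<le> \<eta>' * \<bar>s - x\<bar>) (at x within S)"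
    proof (rule eventually_mono)
      fix s assume a: "dist ((1 / norm (s - x)) *\<^sub>R (F s $$ (i, j) - (F x $$ (i, j) + (s - x) *\<^sub>R F' $$ (i, j)))) 0 < \<eta>'"
      have eq: "F s $$ (i, j) - F x $$ (i, j) - complex_of_real (s - x) * F' $$ (i, j) =
         F s $$ (i, j) - (F x $$ (i, j) + (s - x) *\<^sub>R F' $$ (i, j))"
        by (simp add: scaleR_conv_of_real algebra_simps)
      show "cmod (F s $$ (i, j) - F x $$ (i, j) - complex_of_real (s - x) * F' $$ (i, j)) \<le> \<eta>' * \<bar>s - x\<bar>"
        unfolding eq using a by (cases "s = x") (simp_all add: divide_simps mult.commute)
    qed
  qed
  hence "eventually (\<lambda>s. \<forall>i\<in>{..<n}. \<forall>j\<in>{..<n}. cmod (F s $$ (i, j) - F x $$ (i, j) - complex_of_real (s - x) * F' $$ (i, j)) \<le> \<eta>' * \<bar>s - x\<bar>) (at x within S)"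
    by (simp add: eventually_ball_finite_distrib)
  then obtain d where d: "d > 0" and bd: "\<And>s i j. s \<in> S \<Longrightarrow> s \<noteq> x \<Longrightarrow> dist s x < d \<Longrightarrow> i < n \<Longrightarrow> j < n \<Longrightarrow>
      cmod (F s $$ (i, j) - F x $$ (i, j) - complex_of_real (s - x) * F' $$ (i, j)) \<le> \<eta>' * \<bar>s - x\<bar>"
    unfolding eventually_at by blast
  show ?thesis
  proof (intro exI[of _ d] conjI ballI impI)
    fix s assume s: "s \<in> S" "\<bar>s - x\<bar> < d"
    have "trace_norm (F s - F x - complex_of_real (s - x) \<cdot>\<^sub>m F')
        \<le> (\<Sum>i<n. \<Sum>j<n. cmod ((F s - F x - complex_of_real (s - x) \<cdot>\<^sub>m F') $$ (i, j)))"
      by (intro trace_norm_le_sum_entries minus_carrier_mat smult_carrier_mat c(2))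
    also have "\<dots> \<le> (\<Sum>i<n. \<Sum>j<n. \<eta>' * \<bar>s - x\<bar>)"
    proof (intro sum_mono)
      fix i j assume "i \<in> {..<n}" "j \<in> {..<n}"
      thus "cmod ((F s - F x - complex_of_real (s - x) \<cdot>\<^sub>m F') $$ (i, j)) \<le> \<eta>' * \<bar>s - x\<bar>"
        using bd[OF s(1), of i j] s c(1)[OF s(1)] c(1)[OF x] c(2) by (cases "s = x") (auto simp: dist_real_def)
    qed
    also have "\<dots> = (real n * real n * \<eta>') * \<bar>s - x\<bar>" by simp
    also have "\<dots> \<le> \<eta> * \<bar>s - x\<bar>"
    proof (rule mult_right_mono)
      have "real n * real n * \<eta>' = \<eta> * (real n * real n / (real n * real n + 1))"
        by (simp add: \<eta>'_def)
      also have "\<dots> \<le> \<eta> * 1"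
        using \<eta> by (intro mult_left_mono) (simp_all add: divide_simps add_nonneg_pos)
      finally show "real n * real n * \<eta>' \<le> \<eta>" by simp
    qed simp
    finally show "trace_norm (F s - F x - complex_of_real (s - x) \<cdot>\<^sub>m F') \<le> \<eta> * \<bar>s - x\<bar>" .
  qed (use d in auto)
qed

text \<open>
  A variation-of-constants bound. Across a short interval \<open>[u, v]\<close> of length \<open>h\<close>,
  differentiability at a point \<open>x\<close> in between says that \<open>F v\<close> is \<open>F u + h M (F u) + h R x\<close> up to \<open>o(h)\<close>.
  By the growth hypothesis the first two terms increase the norm only to second order in \<open>h\<close>, so
  that the norm grows by the integral of the bound for \<open>R\<close>, up to \<open>\<epsilon> h\<close>. Such increments add up
  along adjacent intervals, and bisection extends them from short intervals to \<open>[0, \<tau>]\<close>.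
\<close>

lemma trace_norm_comparison:
  fixes M :: "complex mat \<Rightarrow> complex mat" and F R :: "real \<Rightarrow> complex mat"
  assumes \<tau>: "0 \<le> \<tau>" and \<kappa>: "0 \<le> \<kappa>" and a: "0 \<le> a" and b: "0 \<le> b"
    and F: "\<And>s. s \<in> {0..\<tau>} \<Longrightarrow> F s \<in> carrier_mat n n"
    and R: "\<And>s. s \<in> {0..\<tau>} \<Longrightarrow> R s \<in> carrier_mat n n"
    and M: "\<And>X. X \<in> carrier_mat n n \<Longrightarrow> M X \<in> carrier_mat n n"
    and deriv: "\<And>s. s \<in> {0..\<tau>} \<Longrightarrow> has_mat_derivative n F (M (F s) + R s) (at s within {0..\<tau>})"
    and growth: "\<And>X h. X \<in> carrier_mat n n \<Longrightarrow> 0 \<le> h \<Longrightarrow>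
      trace_norm (X + complex_of_real h \<cdot>\<^sub>m M X) \<le> (1 + a * h\<^sup>2) * trace_norm X"
    and lip: "\<And>X Y. X \<in> carrier_mat n n \<Longrightarrow> Y \<in> carrier_mat n n \<Longrightarrow>
      trace_norm (M X - M Y) \<le> b * trace_norm (X - Y)"
    and Rb: "\<And>s. s \<in> {0..\<tau>} \<Longrightarrow> trace_norm (R s) \<le> \<kappa> * s"
  shows "trace_norm (F \<tau>) \<le> trace_norm (F 0) + \<kappa> * \<tau>\<^sup>2 / 2"
proof (rule field_le_epsilon)
  fix e :: real assume e: "0 < e"
  define \<epsilon> where "\<epsilon> = e / (\<tau> + 1)"
  have \<epsilon>: "0 < \<epsilon>" using e \<tau> by (simp add: \<epsilon>_def)
  define P where "P u v \<longleftrightarrow> (0 \<le> u \<and> v \<le> \<tau> \<longrightarrow>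
      trace_norm (F v) \<le> trace_norm (F u) + \<kappa> * (v\<^sup>2 - u\<^sup>2) / 2 + \<epsilon> * (v - u))" for u v
  have "P 0 \<tau>"
    using \<tau>
  proof (rule Bolzano)
    fix u v w assume "P u v" "P v w" "u \<le> v" "v \<le> w"
    thus "P u w" unfolding P_def by (auto simp: field_simps)
  next
    fix x assume "0 \<le> x" "x \<le> \<tau>"
    hence x: "x \<in> {0..\<tau>}" by simp
    define D where "D = M (F x) + R x"
    have D: "D \<in> carrier_mat n n" unfolding D_def using M[OF F[OF x]] R[OF x] by simp
    obtain d0 where d0: "d0 > 0" and rem: "\<And>s. s \<in> {0..\<tau>} \<Longrightarrow> \<bar>s - x\<bar> < d0 \<Longrightarrow>
        trace_norm (F s - F x - complex_of_real (s - x) \<cdot>\<^sub>m D) \<le> \<epsilon> / 2 * \<bar>s - x\<bar>"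
      using has_mat_derivative_remainder[OF deriv[OF x, folded D_def] F D x, of "\<epsilon> / 2"] \<epsilon> by auto
    define q where "q = trace_norm D + \<epsilon> / 2"
    have q: "0 \<le> q" unfolding q_def using trace_norm_nonneg[OF D] \<epsilon> by simp
    define Q where "Q = a * (trace_norm (F x) + q) + b * q + \<kappa> / 2"
    have Q: "0 \<le> Q" unfolding Q_def using a b q \<kappa> trace_norm_nonneg[OF F[OF x]] by simp
    define d where "d = min d0 (min 1 (\<epsilon> / (2 * (Q + 1))))"
    have d: "0 < d" unfolding d_def using d0 \<epsilon> Q by simp
    have "P u v" if uv: "u \<le> x" "x \<le> v" "v - u < d" for u v
      unfolding P_def
    proof
      assume "0 \<le> u \<and> v \<le> \<tau>"
      hence u: "u \<in> {0..\<tau>}" and v: "v \<in> {0..\<tau>}" using uv x by auto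
      define h where "h = v - u"
      have h: "0 \<le> h" "h < d0" "h \<le> 1" "h * Q \<le> \<epsilon> / 2"
      proof -
        show "0 \<le> h" "h < d0" "h \<le> 1" using uv by (auto simp: h_def d_def)
        have "h \<le> \<epsilon> / (2 * (Q + 1))" using uv by (auto simp: h_def d_def)
        hence "h * Q \<le> \<epsilon> / (2 * (Q + 1)) * Q" using Q by (rule mult_right_mono)
        also have "\<dots> \<le> \<epsilon> / 2" using Q \<epsilon> by (simp add: divide_simps)
        finally show "h * Q \<le> \<epsilon> / 2" .
      qed
      define r where "r s = F s - F x - complex_of_real (s - x) \<cdot>\<^sub>m D" for s
      have r: "r s \<in> carrier_mat n n" for s unfolding r_def using D by (simp add: minus_carrier_mat)
      have ru: "trace_norm (r u) \<le> \<epsilon> / 2 * (x - u)" and rv: "trace_norm (r v) \<le> \<epsilon> / 2 * (v - x)"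
        using rem[OF u] rem[OF v] uv h unfolding r_def h_def by auto
      have Fux: "trace_norm (F x - F u) \<le> h * q"
      proof -
        have "F x - F u = complex_of_real (x - u) \<cdot>\<^sub>m D - r u"
          unfolding r_def using F[OF u] F[OF x] D by (intro eq_matI) (auto simp: algebra_simps)
        hence "trace_norm (F x - F u) \<le> trace_norm (complex_of_real (x - u) \<cdot>\<^sub>m D) + trace_norm (r u)"
          using trace_norm_minus[of "complex_of_real (x - u) \<cdot>\<^sub>m D" n "r u"] D r by simp
        also have "\<dots> \<le> (x - u) * trace_norm D + \<epsilon> / 2 * (x - u)"
          using trace_norm_smult_le[OF D, of "complex_of_real (x - u)"] ru uv
          by (intro add_mono) (auto simp del: of_real_diff)
        also have "\<dots> = (x - u) * q" by (simp add: q_def algebra_simps)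
        also have "\<dots> \<le> h * q" using uv q by (intro mult_right_mono) (auto simp: h_def)
        finally show ?thesis .
      qed
      have Fu: "trace_norm (F u) \<le> trace_norm (F x) + h * q"
      proof -
        have "F u = F x - (F x - F u)"
          using F[OF u] F[OF x] by (intro eq_matI) auto
        thus ?thesis
          using trace_norm_minus[OF F[OF x] minus_carrier_mat[OF F[OF u], of "F x"]] Fux by simp
      qed
      have Fv: "F v = (F u + complex_of_real h \<cdot>\<^sub>m M (F u)) + complex_of_real h \<cdot>\<^sub>m R x
          + complex_of_real h \<cdot>\<^sub>m (M (F x) - M (F u)) + (r v - r u)"
        unfolding r_def D_def h_def
        using F[OF u] F[OF v] F[OF x] R[OF x] M[OF F[OF x]] M[OF F[OF u]]
        by (intro eq_matI) (auto simp: algebra_simps)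
      let ?E = "F u + complex_of_real h \<cdot>\<^sub>m M (F u)"
      have Ec: "?E \<in> carrier_mat n n" using F[OF u] M[OF F[OF u]] by simp
      have Rc: "complex_of_real h \<cdot>\<^sub>m R x \<in> carrier_mat n n" using R[OF x] by simp
      have Mc: "M (F x) - M (F u) \<in> carrier_mat n n" by (rule minus_carrier_mat[OF M[OF F[OF u]]])
      have rc: "r v - r u \<in> carrier_mat n n" by (rule minus_carrier_mat[OF r])
      have "trace_norm (F v) \<le> trace_norm ?E + trace_norm (complex_of_real h \<cdot>\<^sub>m R x)
          + trace_norm (complex_of_real h \<cdot>\<^sub>m (M (F x) - M (F u))) + trace_norm (r v - r u)"
        unfolding Fv
        using trace_norm_add[OF Ec Rc] trace_norm_add[OF add_carrier_mat[OF Rc, of ?E] smult_carrier_mat[OF Mc, of "complex_of_real h"]]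
          trace_norm_add[OF add_carrier_mat[OF smult_carrier_mat[OF Mc, of "complex_of_real h"], of "?E + complex_of_real h \<cdot>\<^sub>m R x"] rc]
        by linarith
      also have "\<dots> \<le> (1 + a * h\<^sup>2) * trace_norm (F u) + h * (\<kappa> * x) + h * (b * (h * q)) + \<epsilon> / 2 * h"
      proof (intro add_mono)
        show "trace_norm ?E \<le> (1 + a * h\<^sup>2) * trace_norm (F u)" using growth[OF F[OF u] h(1)] .
        show "trace_norm (complex_of_real h \<cdot>\<^sub>m R x) \<le> h * (\<kappa> * x)"
          using order.trans[OF trace_norm_smult_le[OF R[OF x], of "complex_of_real h"] mult_left_mono[OF Rb[OF x] norm_ge_zero]] h by simp
        have "trace_norm (M (F x) - M (F u)) \<le> b * (h * q)"
          using order.trans[OF lip[OF F[OF x] F[OF u]] mult_left_mono[OF Fux b]] .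
        thus "trace_norm (complex_of_real h \<cdot>\<^sub>m (M (F x) - M (F u))) \<le> h * (b * (h * q))"
          using order.trans[OF trace_norm_smult_le[OF Mc, of "complex_of_real h"] mult_left_mono[OF _ norm_ge_zero]] h by simp
        have "trace_norm (r v - r u) \<le> trace_norm (r v) + trace_norm (r u)" by (rule trace_norm_minus[OF r r])
        also have "\<dots> \<le> \<epsilon> / 2 * (v - x) + \<epsilon> / 2 * (x - u)" using ru rv by (rule add_mono[rotated])
        also have "\<dots> = \<epsilon> / 2 * h" by (simp add: h_def field_simps)
        finally show "trace_norm (r v - r u) \<le> \<epsilon> / 2 * h" .
      qed
      also have "\<dots> \<le> trace_norm (F u) + \<kappa> * (v\<^sup>2 - u\<^sup>2) / 2 + \<epsilon> * h"
      proof -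
        have "h * q \<le> q" using mult_right_mono[OF h(3) q] by simp
        hence "trace_norm (F u) \<le> trace_norm (F x) + q" using Fu by linarith
        hence 1: "a * h\<^sup>2 * trace_norm (F u) \<le> a * h\<^sup>2 * (trace_norm (F x) + q)"
          using a by (intro mult_left_mono) auto
        \<comment> \<open>The right end \<open>v\<close> exceeds the midpoint of \<open>[u, v]\<close> by \<open>h/2\<close>, hence the second-order term.\<close>
        have "h * (\<kappa> * x) \<le> h * (\<kappa> * v)" using h \<kappa> uv by (intro mult_left_mono) auto
        also have "\<dots> = \<kappa> * (v\<^sup>2 - u\<^sup>2) / 2 + \<kappa> / 2 * h\<^sup>2"
          by (simp add: h_def power2_eq_square field_simps)
        finally have 2: "h * (\<kappa> * x) \<le> \<kappa> * (v\<^sup>2 - u\<^sup>2) / 2 + \<kappa> / 2 * h\<^sup>2" .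
        have "a * h\<^sup>2 * (trace_norm (F x) + q) + \<kappa> / 2 * h\<^sup>2 + h * (b * (h * q)) = h * (h * Q)"
          by (simp add: Q_def power2_eq_square algebra_simps)
        also have "\<dots> \<le> h * (\<epsilon> / 2)" using h by (intro mult_left_mono) auto
        finally show ?thesis using 1 2 by (simp add: algebra_simps)
      qed
      finally show "trace_norm (F v) \<le> trace_norm (F u) + \<kappa> * (v\<^sup>2 - u\<^sup>2) / 2 + \<epsilon> * (v - u)"
        by (simp add: h_def)
    qed
    thus "\<exists>d>0. \<forall>u v. u \<le> x \<and> x \<le> v \<and> v - u < d \<longrightarrow> P u v"
      using d by blast
  qed
  hence "trace_norm (F \<tau>) \<le> trace_norm (F 0) + \<kappa> * \<tau>\<^sup>2 / 2 + \<epsilon> * \<tau>"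
    using \<tau> by (simp add: P_def)
  also have "\<epsilon> * \<tau> \<le> e" using e \<tau> by (simp add: \<epsilon>_def divide_simps)
  finally show "trace_norm (F \<tau>) \<le> trace_norm (F 0) + \<kappa> * \<tau>\<^sup>2 / 2 + e" by simp
qed

lemma has_mat_derivative_add:
  assumes "has_mat_derivative n F F' net" "has_mat_derivative n G G' net"
    and "\<And>s. F s \<in> carrier_mat n n" "\<And>s. G s \<in> carrier_mat n n" "F' \<in> carrier_mat n n" "G' \<in> carrier_mat n n"
  shows "has_mat_derivative n (\<lambda>s. F s + G s) (F' + G') net"
  using assms unfolding has_mat_derivative_def
  by (auto intro!: has_vector_derivative_add simp: carrier_matD[OF assms(4)])

lemma has_mat_derivative_mult:
  assumes F: "has_mat_derivative n F F' (at x within S)" and G: "has_mat_derivative n G G' (at x within S)"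
    and c: "\<And>s. F s \<in> carrier_mat n n" "\<And>s. G s \<in> carrier_mat n n" "F' \<in> carrier_mat n n" "G' \<in> carrier_mat n n"
  shows "has_mat_derivative n (\<lambda>s. F s * G s) (F' * G x + F x * G') (at x within S)"
  unfolding has_mat_derivative_def
proof (intro allI impI)
  fix i j assume ij: "i < n" "j < n"
  have "((\<lambda>s. \<Sum>k<n. F s $$ (i, k) * G s $$ (k, j)) has_vector_derivative
      (\<Sum>k<n. F x $$ (i, k) * G' $$ (k, j) + F' $$ (i, k) * G x $$ (k, j))) (at x within S)"
    using F G ij unfolding has_mat_derivative_def
    by (intro has_vector_derivative_sum has_vector_derivative_mult) auto
  moreover have "(\<lambda>s. \<Sum>k<n. F s $$ (i, k) * G s $$ (k, j)) = (\<lambda>s. (F s * G s) $$ (i, j))"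
    using ij carrier_matD[OF c(1)] carrier_matD[OF c(2)] by (simp add: index_mult_mat_sum del: index_mult_mat(1))
  moreover have "(\<Sum>k<n. F x $$ (i, k) * G' $$ (k, j) + F' $$ (i, k) * G x $$ (k, j)) = (F' * G x + F x * G') $$ (i, j)"
    using ij carrier_matD[OF c(1)[of x]] carrier_matD[OF c(2)[of x]] carrier_matD[OF c(3)] carrier_matD[OF c(4)]
    by (simp add: index_mult_mat_sum sum.distrib add.commute del: index_mult_mat(1))
  ultimately show "((\<lambda>s. (F s * G s) $$ (i, j)) has_vector_derivative (F' * G x + F x * G') $$ (i, j)) (at x within S)"
    by simp
qed

lemma has_mat_derivative_const: "has_mat_derivative n (\<lambda>s. C) (0\<^sub>m n n) net"
  by (simp add: has_mat_derivative_def)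

lemma has_mat_derivative_const_mult_left:
  assumes F: "has_mat_derivative n F F' (at x within S)"
    and c: "\<And>s. F s \<in> carrier_mat n n" "F' \<in> carrier_mat n n" "C \<in> carrier_mat n n"
  shows "has_mat_derivative n (\<lambda>s. C * F s) (C * F') (at x within S)"
proof -
  have "0\<^sub>m n n * F x + C * F' = C * F'"
    using c(1)[of x] c(2,3) by simp
  thus ?thesis
    using has_mat_derivative_mult[OF has_mat_derivative_const[of n C] F c(3,1) _ c(2)] by simp
qed

lemma has_mat_derivative_const_mult_right:
  assumes F: "has_mat_derivative n F F' (at x within S)"
    and c: "\<And>s. F s \<in> carrier_mat n n" "F' \<in> carrier_mat n n" "C \<in> carrier_mat n n"
  shows "has_mat_derivative n (\<lambda>s. F s * C) (F' * C) (at x within S)"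
proof -
  have "F' * C + F x * 0\<^sub>m n n = F' * C"
    using c(1)[of x] c(2,3) by simp
  thus ?thesis
    using has_mat_derivative_mult[OF F has_mat_derivative_const[of n C] c(1,3,2)] by simp
qed

lemma has_mat_derivative_scale:
  assumes F: "has_mat_derivative n F F' (at x within S)"
    and c: "\<And>s. F s \<in> carrier_mat n n" "F' \<in> carrier_mat n n"
  shows "has_mat_derivative n (\<lambda>s. complex_of_real s \<cdot>\<^sub>m F s) (F x + complex_of_real x \<cdot>\<^sub>m F') (at x within S)"
  unfolding has_mat_derivative_def
proof (intro allI impI)
  fix i j assume ij: "i < n" "j < n"
  have "((\<lambda>s. complex_of_real s * F s $$ (i, j)) has_vector_derivative
      (complex_of_real x * F' $$ (i, j) + complex_of_real 1 * F x $$ (i, j))) (at x within S)"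
    using F ij unfolding has_mat_derivative_def
    by (intro has_vector_derivative_mult has_vector_derivative_of_real) (auto intro!: derivative_eq_intros)
  thus "((\<lambda>s. (complex_of_real s \<cdot>\<^sub>m F s) $$ (i, j)) has_vector_derivative
      (F x + complex_of_real x \<cdot>\<^sub>m F') $$ (i, j)) (at x within S)"
    using ij carrier_matD[OF c(1)] carrier_matD[OF c(2)] by (simp add: add.commute)
qed

lemma has_mat_derivative_smult:
  assumes F: "has_mat_derivative n F F' (at x within S)"
    and c: "\<And>s. F s \<in> carrier_mat n n" "F' \<in> carrier_mat n n"
  shows "has_mat_derivative n (\<lambda>s. a \<cdot>\<^sub>m F s) (a \<cdot>\<^sub>m F') (at x within S)"
  using F carrier_matD[OF c(1)] carrier_matD[OF c(2)] unfolding has_mat_derivative_def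
  by (auto intro!: has_vector_derivative_mult_right)

lemma has_mat_derivative_mat_sum:
  assumes "\<And>k. k \<in> I \<Longrightarrow> has_mat_derivative n (F k) (F' k) net"
  shows "has_mat_derivative n (\<lambda>s. mat_sum n n I (\<lambda>k. F k s)) (mat_sum n n I F') net"
  using assms unfolding has_mat_derivative_def by (auto intro!: has_vector_derivative_sum)

lemma has_mat_derivative_trace:
  assumes F: "has_mat_derivative n F F' net" and c: "\<And>s. F s \<in> carrier_mat n n" "F' \<in> carrier_mat n n"
  shows "((\<lambda>s. mat_trace (F s)) has_vector_derivative mat_trace F') net"
  using F carrier_matD[OF c(1)] carrier_matD[OF c(2)] unfolding has_mat_derivative_def mat_trace_def
  by (auto intro!: has_vector_derivative_sum)

section \<open>The matrix exponential\<close>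

lemma pow_mat_Suc_left:
  assumes "B \<in> carrier_mat n n"
  shows "B ^\<^sub>m Suc k = B * B ^\<^sub>m k"
proof (induction k)
  case 0
  show ?case using assms by simp
next
  case (Suc k)
  have "B ^\<^sub>m Suc (Suc k) = (B * B ^\<^sub>m k) * B"
    by (subst Suc.IH[symmetric]) simp
  also have "\<dots> = B * B ^\<^sub>m Suc k"
    using assms by (simp add: assoc_mult_mat[of _ n n _ n _ n])
  finally show ?case .
qed

lemma pow_mat_smult:
  fixes B :: "complex mat"
  assumes "B \<in> carrier_mat n n"
  shows "(c \<cdot>\<^sub>m B) ^\<^sub>m k = c ^ k \<cdot>\<^sub>m B ^\<^sub>m k"
proof (induction k)
  case 0
  show ?case using assms by (intro eq_matI) auto
next
  case (Suc k)
  have "(c \<cdot>\<^sub>m B) ^\<^sub>m Suc k = c ^ k \<cdot>\<^sub>m B ^\<^sub>m k * (c \<cdot>\<^sub>m B)"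
    using Suc.IH by simp
  also have "\<dots> = c ^ Suc k \<cdot>\<^sub>m B ^\<^sub>m Suc k"
    using assms by (intro eq_matI)
      (auto simp: index_mult_mat_sum sum_distrib_left mult_ac simp del: index_mult_mat(1))
  finally show ?case .
qed

text \<open>
  This submultiplicative bound dominates the exponential series of a matrix by a scalar one.
\<close>

lemma op_bounded_pow:
  assumes "B \<in> carrier_mat n n" "op_bounded b B" "0 \<le> b"
  shows "op_bounded (b ^ k) (B ^\<^sub>m k)"
proof (induction k)
  case 0
  show ?case using assms(1) by (auto simp: op_bounded_one)
next
  case (Suc k)
  show ?case
    using op_bounded_mult[OF pow_carrier_mat[OF assms(1)] Suc.IH assms(1,2)] assms(3)
    by (simp add: mult.commute)
qed

lemma summable_mat_exp_series:
  fixes B :: "complex mat"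
  assumes B: "B \<in> carrier_mat n n" and ij: "i < n" "j < n"
  shows "summable (\<lambda>k. (B ^\<^sub>m k) $$ (i, j) / fact k * x ^ k)"
proof (rule summable_comparison_test'[where N = 0])
  let ?b = "trace_norm B"
  show "summable (\<lambda>k. inverse (fact k) * (?b * cmod x) ^ k)" by (rule summable_exp)
  fix k :: nat assume "0 \<le> k"
  have "cmod ((B ^\<^sub>m k) $$ (i, j)) \<le> ?b ^ k"
    using op_bounded_pow[OF B op_bounded_trace_norm[OF B] trace_norm_nonneg[OF B]]
    by (rule op_bounded_index_le[OF pow_carrier_mat[OF B] _ ij])
  hence "cmod ((B ^\<^sub>m k) $$ (i, j)) * cmod x ^ k / fact k \<le> ?b ^ k * cmod x ^ k / fact k"
    by (intro divide_right_mono mult_right_mono) auto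
  moreover have "cmod ((B ^\<^sub>m k) $$ (i, j) / fact k * x ^ k) = cmod ((B ^\<^sub>m k) $$ (i, j)) * cmod x ^ k / fact k"
    by (simp add: norm_mult norm_divide norm_power)
  moreover have "inverse (fact k) * (?b * cmod x) ^ k = ?b ^ k * cmod x ^ k / fact k"
    by (simp add: power_mult_distrib divide_inverse mult_ac)
  ultimately show "cmod ((B ^\<^sub>m k) $$ (i, j) / fact k * x ^ k) \<le> inverse (fact k) * (?b * cmod x) ^ k"
    by simp
qed

lemma mat_exp_carrier [simp]: "B \<in> carrier_mat n n \<Longrightarrow> mat_exp B \<in> carrier_mat n n"
  by (auto simp: mat_exp_def)

lemma index_mat_exp_smult:
  fixes B :: "complex mat"
  assumes B: "B \<in> carrier_mat n n" and ij: "i < n" "j < n"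
  shows "mat_exp (x \<cdot>\<^sub>m B) $$ (i, j) = (\<Sum>k. (B ^\<^sub>m k) $$ (i, j) / fact k * x ^ k)"
proof -
  have "((x \<cdot>\<^sub>m B) ^\<^sub>m k) $$ (i, j) / fact k = (B ^\<^sub>m k) $$ (i, j) / fact k * x ^ k" for k
    using carrier_matD[OF pow_carrier_mat[OF B, of k]] ij by (simp add: pow_mat_smult[OF B])
  thus ?thesis using B ij by (simp add: mat_exp_def)
qed

lemma mat_exp_zero:
  assumes B: "B \<in> carrier_mat n n"
  shows "mat_exp (0 \<cdot>\<^sub>m B) = 1\<^sub>m n"
proof (rule eq_matI)
  fix i j assume "i < dim_row (1\<^sub>m n)" "j < dim_col (1\<^sub>m n)"
  hence ij: "i < n" "j < n" by auto
  show "mat_exp (0 \<cdot>\<^sub>m B) $$ (i, j) = 1\<^sub>m n $$ (i, j)"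
    unfolding index_mat_exp_smult[OF B ij] powser_zero using B ij by simp
qed (use B in \<open>auto simp: mat_exp_def\<close>)

lemma mat_exp_deriv_entry:
  fixes B :: "complex mat"
  assumes B: "B \<in> carrier_mat n n" and ij: "i < n" "j < n"
  shows "((\<lambda>s. mat_exp (complex_of_real s \<cdot>\<^sub>m B) $$ (i, j)) has_vector_derivative
    (\<Sum>k. (B ^\<^sub>m Suc k) $$ (i, j) / fact k * complex_of_real s ^ k)) (at s within S)"
proof -
  let ?c = "\<lambda>k. (B ^\<^sub>m k) $$ (i, j) / fact k"
  have "((\<lambda>x. \<Sum>k. ?c k * x ^ k) has_field_derivative (\<Sum>k. diffs ?c k * complex_of_real s ^ k)) (at (complex_of_real s))"
    by (rule termdiffs_strong_converges_everywhere) (rule summable_mat_exp_series[OF B ij])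
  moreover have "diffs ?c k = (B ^\<^sub>m Suc k) $$ (i, j) / fact k" for k
    by (simp add: diffs_def divide_simps del: pow_mat.simps of_nat_Suc)
  ultimately have "((\<lambda>x. \<Sum>k. ?c k * x ^ k) has_field_derivative
     (\<Sum>k. (B ^\<^sub>m Suc k) $$ (i, j) / fact k * complex_of_real s ^ k)) (at (complex_of_real s))"
    by simp
  from has_vector_derivative_real_field[OF this] show ?thesis
    unfolding index_mat_exp_smult[OF B ij] .
qed

text \<open>
  Differentiating the series shifts the power by one. The extra factor \<open>B\<close> can be split off on either
  side; \<open>e\<^sup>s\<^sup>A \<sigma> e\<^sup>s\<^sup>A\<^sup>\<dagger>\<close> requires the left form for its first and the right form for its last factor.
\<close>

lemma has_mat_derivative_mat_exp_left:
  fixes B :: "complex mat"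
  assumes B: "B \<in> carrier_mat n n"
  shows "has_mat_derivative n (\<lambda>s. mat_exp (complex_of_real s \<cdot>\<^sub>m B)) (B * mat_exp (complex_of_real s \<cdot>\<^sub>m B)) (at s within S)"
  unfolding has_mat_derivative_def
proof (intro allI impI)
  fix i j assume ij: "i < n" "j < n"
  have "(\<Sum>k. (B ^\<^sub>m Suc k) $$ (i, j) / fact k * complex_of_real s ^ k)
      = (\<Sum>k. \<Sum>l<n. B $$ (i, l) * ((B ^\<^sub>m k) $$ (l, j) / fact k * complex_of_real s ^ k))"
    using B ij pow_carrier_mat[OF B]
    by (simp add: pow_mat_Suc_left[OF B] index_mult_mat_sum divide_inverse sum_distrib_left mult_ac
        del: pow_mat.simps index_mult_mat(1))
  also have "\<dots> = (\<Sum>l<n. \<Sum>k. B $$ (i, l) * ((B ^\<^sub>m k) $$ (l, j) / fact k * complex_of_real s ^ k))"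
    using ij by (intro suminf_sum summable_mult summable_mat_exp_series[OF B]) auto
  also have "\<dots> = (\<Sum>l<n. B $$ (i, l) * (\<Sum>k. (B ^\<^sub>m k) $$ (l, j) / fact k * complex_of_real s ^ k))"
    using ij by (intro sum.cong refl suminf_mult summable_mat_exp_series[OF B]) auto
  also have "\<dots> = (B * mat_exp (complex_of_real s \<cdot>\<^sub>m B)) $$ (i, j)"
    using B ij carrier_matD[OF mat_exp_carrier[OF smult_carrier_mat[OF B, of "complex_of_real s"]]]
    by (simp add: index_mult_mat_sum index_mat_exp_smult[OF B] del: index_mult_mat(1))
  finally show "((\<lambda>s. mat_exp (complex_of_real s \<cdot>\<^sub>m B) $$ (i, j)) has_vector_derivative
    (B * mat_exp (complex_of_real s \<cdot>\<^sub>m B)) $$ (i, j)) (at s within S)"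
    using mat_exp_deriv_entry[OF B ij, of s S] by (simp only:)
qed

lemma has_mat_derivative_mat_exp_right:
  fixes B :: "complex mat"
  assumes B: "B \<in> carrier_mat n n"
  shows "has_mat_derivative n (\<lambda>s. mat_exp (complex_of_real s \<cdot>\<^sub>m B)) (mat_exp (complex_of_real s \<cdot>\<^sub>m B) * B) (at s within S)"
  unfolding has_mat_derivative_def
proof (intro allI impI)
  fix i j assume ij: "i < n" "j < n"
  have "(\<Sum>k. (B ^\<^sub>m Suc k) $$ (i, j) / fact k * complex_of_real s ^ k)
      = (\<Sum>k. \<Sum>l<n. ((B ^\<^sub>m k) $$ (i, l) / fact k * complex_of_real s ^ k) * B $$ (l, j))"
    using B ij pow_carrier_mat[OF B]
    by (simp add: index_mult_mat_sum divide_inverse sum_distrib_left mult_ac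
        del: index_mult_mat(1))
  also have "\<dots> = (\<Sum>l<n. \<Sum>k. ((B ^\<^sub>m k) $$ (i, l) / fact k * complex_of_real s ^ k) * B $$ (l, j))"
    using ij by (intro suminf_sum summable_mult2 summable_mat_exp_series[OF B]) auto
  also have "\<dots> = (\<Sum>l<n. (\<Sum>k. (B ^\<^sub>m k) $$ (i, l) / fact k * complex_of_real s ^ k) * B $$ (l, j))"
    using ij by (intro sum.cong refl suminf_mult2[symmetric] summable_mat_exp_series[OF B]) auto
  also have "\<dots> = (mat_exp (complex_of_real s \<cdot>\<^sub>m B) * B) $$ (i, j)"
    using B ij carrier_matD[OF mat_exp_carrier[OF smult_carrier_mat[OF B, of "complex_of_real s"]]]
    by (simp add: index_mult_mat_sum index_mat_exp_smult[OF B] del: index_mult_mat(1))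
  finally show "((\<lambda>s. mat_exp (complex_of_real s \<cdot>\<^sub>m B) $$ (i, j)) has_vector_derivative
    (mat_exp (complex_of_real s \<cdot>\<^sub>m B) * B) $$ (i, j)) (at s within S)"
    using mat_exp_deriv_entry[OF B ij, of s S] by (simp only:)
qed

section \<open>The exponential Euler step as a perturbed solution\<close>

lemma real_growth_bound:
  fixes g g' :: "real \<Rightarrow> real"
  assumes \<tau>: "0 \<le> \<tau>" and g: "\<And>s. (g has_field_derivative g' s) (at s)"
    and g': "\<And>s. 0 \<le> s \<Longrightarrow> s \<le> \<tau> \<Longrightarrow> \<bar>g' s\<bar> \<le> \<kappa> * s"
  shows "\<bar>g \<tau> - g 0\<bar> \<le> \<kappa> * \<tau>\<^sup>2 / 2"
proof -
  have 1: "g \<tau> - \<kappa> * \<tau>\<^sup>2 / 2 \<le> g 0 - \<kappa> * 0\<^sup>2 / 2"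
    using \<tau>
  proof (rule DERIV_nonpos_imp_nonincreasing)
    fix s assume "0 \<le> s" "s \<le> \<tau>"
    thus "\<exists>y. ((\<lambda>s. g s - \<kappa> * s\<^sup>2 / 2) has_real_derivative y) (at s) \<and> y \<le> 0"
      using g'[of s] by (intro exI[of _ "g' s - \<kappa> * s"]) (auto intro!: derivative_eq_intros g)
  qed
  have 2: "- g \<tau> - \<kappa> * \<tau>\<^sup>2 / 2 \<le> - g 0 - \<kappa> * 0\<^sup>2 / 2"
    using \<tau>
  proof (rule DERIV_nonpos_imp_nonincreasing)
    fix s assume "0 \<le> s" "s \<le> \<tau>"
    thus "\<exists>y. ((\<lambda>s. - g s - \<kappa> * s\<^sup>2 / 2) has_real_derivative y) (at s) \<and> y \<le> 0"
      using g'[of s] by (intro exI[of _ "- g' s - \<kappa> * s"]) (auto intro!: derivative_eq_intros g)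
  qed
  show ?thesis by (rule abs_leI) (use 1 2 in simp_all)
qed

context dissipative_generator
begin

lemma has_mat_derivative_jump:
  assumes F: "has_mat_derivative m F F' (at x within S)"
    and c: "\<And>s. F s \<in> carrier_mat m m" "F' \<in> carrier_mat m m"
  shows "has_mat_derivative m (\<lambda>s. J (F s)) (J F') (at x within S)"
  unfolding jump_def
proof (rule has_mat_derivative_mat_sum)
  fix k assume k: "k \<in> I"
  have Lk: "L k \<in> carrier_mat m m" "mat_adjoint (L k) \<in> carrier_mat m m" using L[OF k] by auto
  show "has_mat_derivative m (\<lambda>s. complex_of_real (\<gamma> k) \<cdot>\<^sub>m (L k * F s * mat_adjoint (L k)))
      (complex_of_real (\<gamma> k) \<cdot>\<^sub>m (L k * F' * mat_adjoint (L k))) (at x within S)"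
    using Lk c
    by (intro has_mat_derivative_smult has_mat_derivative_const_mult_right has_mat_derivative_const_mult_left F)
       (auto intro!: mult_carrier_mat[of _ m m _ m])
qed

text \<open>
  The comparison principle applies to the generator because its logarithmic norm is nonpositive.
  In particular, the distance of two exact solutions does not increase.
\<close>

lemma trace_norm_flow_le:
  assumes \<tau>: "0 \<le> \<tau>" and \<kappa>: "0 \<le> \<kappa>"
    and F: "\<And>s. s \<in> {0..\<tau>} \<Longrightarrow> F s \<in> carrier_mat m m"
    and R: "\<And>s. s \<in> {0..\<tau>} \<Longrightarrow> R s \<in> carrier_mat m m"
    and deriv: "\<And>s. s \<in> {0..\<tau>} \<Longrightarrow> has_mat_derivative m F (G (F s) + R s) (at s within {0..\<tau>})"
    and Rb: "\<And>s. s \<in> {0..\<tau>} \<Longrightarrow> trace_norm (R s) \<le> \<kappa> * s"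
  shows "trace_norm (F \<tau>) \<le> trace_norm (F 0) + \<kappa> * \<tau>\<^sup>2 / 2"
proof (rule trace_norm_comparison[where M = G and F = F and R = R and a = "2 * (trace_norm A)\<^sup>2" and b = "2 * trace_norm A + jump_bound"])
  show "0 \<le> 2 * trace_norm A + jump_bound" using jump_bound_nonneg trace_norm_nonneg[OF A] by simp
  show "trace_norm (G X - G Y) \<le> (2 * trace_norm A + jump_bound) * trace_norm (X - Y)"
    if "X \<in> carrier_mat m m" "Y \<in> carrier_mat m m" for X Y
    using trace_norm_gen_le[OF minus_carrier_mat[OF that(2), of X]] gen_minus[OF that] by simp
qed (use assms trace_norm_euler_step_le in auto)

lemma dissipative_drift: "dissipative_generator m {} \<gamma> L A"
proof
  fix v :: "complex vec" assume v: "v \<in> carrier_vec m"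
  have "0 \<le> (\<Sum>k\<in>I. \<gamma> k * (vnorm (L k *\<^sub>v v))\<^sup>2)"
    using \<gamma> by (intro sum_nonneg mult_nonneg_nonneg) auto
  thus "2 * Re ((A *\<^sub>v v) \<bullet>c v) + (\<Sum>k\<in>{}. \<gamma> k * (vnorm (L k *\<^sub>v v))\<^sup>2) \<le> 0"
    using dissipative[OF v] by simp
qed (use A in auto)

text \<open>
  The solution of the Lindblad equation without jumps and with initial value \<open>\<sigma>\<close>.
\<close>

definition drift_flow where "drift_flow \<sigma> s = mat_exp (complex_of_real s \<cdot>\<^sub>m A) * \<sigma> * mat_exp (complex_of_real s \<cdot>\<^sub>m mat_adjoint A)"

lemma drift_flow_carrier [simp]: "\<sigma> \<in> carrier_mat m m \<Longrightarrow> drift_flow \<sigma> s \<in> carrier_mat m m"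
  unfolding drift_flow_def using A A' by (intro mult_carrier_mat[of _ m m _ m]) auto

lemma drift_flow_0: "\<sigma> \<in> carrier_mat m m \<Longrightarrow> drift_flow \<sigma> 0 = \<sigma>"
  unfolding drift_flow_def using mat_exp_zero[OF A] mat_exp_zero[OF A'] by simp

lemma has_mat_derivative_drift_flow:
  assumes \<sigma>: "\<sigma> \<in> carrier_mat m m"
  shows "has_mat_derivative m (drift_flow \<sigma>) (A * drift_flow \<sigma> s + drift_flow \<sigma> s * mat_adjoint A) (at s within S)"
proof -
  let ?E = "\<lambda>s. mat_exp (complex_of_real s \<cdot>\<^sub>m A)" and ?E' = "\<lambda>s. mat_exp (complex_of_real s \<cdot>\<^sub>m mat_adjoint A)"
  have E: "?E s \<in> carrier_mat m m" "?E' s \<in> carrier_mat m m" for s using A A' by auto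
  have AE: "A * ?E s \<in> carrier_mat m m" "?E' s * mat_adjoint A \<in> carrier_mat m m"
    by (rule mult_carrier_mat[OF A E(1)], rule mult_carrier_mat[OF E(2) A'])
  have "has_mat_derivative m (\<lambda>s. ?E s * \<sigma>) (A * ?E s * \<sigma>) (at s within S)"
    by (rule has_mat_derivative_const_mult_right[OF has_mat_derivative_mat_exp_left[OF A] E(1) AE(1) \<sigma>])
  from has_mat_derivative_mult[OF this has_mat_derivative_mat_exp_right[OF A'] mult_carrier_mat[OF E(1) \<sigma>] E(2)
      mult_carrier_mat[OF AE(1) \<sigma>] AE(2)]
  have "has_mat_derivative m (drift_flow \<sigma>) (A * ?E s * \<sigma> * ?E' s + ?E s * \<sigma> * (?E' s * mat_adjoint A)) (at s within S)"
    by (simp add: drift_flow_def[abs_def])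
  also have "A * ?E s * \<sigma> * ?E' s = A * drift_flow \<sigma> s"
    unfolding drift_flow_def using A E \<sigma> by (simp add: assoc)
  also have "?E s * \<sigma> * (?E' s * mat_adjoint A) = drift_flow \<sigma> s * mat_adjoint A"
    unfolding drift_flow_def using A' E \<sigma> by (simp add: assoc)
  finally show ?thesis .
qed

text \<open>
  The comparison principle for the drift alone, with residual zero.
\<close>

lemma trace_norm_drift_flow_le:
  assumes \<sigma>: "\<sigma> \<in> carrier_mat m m" and \<tau>: "0 \<le> \<tau>"
  shows "trace_norm (drift_flow \<sigma> \<tau>) \<le> trace_norm \<sigma>"
proof -
  interpret D: dissipative_generator m "{}" \<gamma> L A by (rule dissipative_drift)
  have gen: "gen m {} \<gamma> L A Y = A * Y + Y * mat_adjoint A" if "Y \<in> carrier_mat m m" for Y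
    unfolding gen_def jump_def using that A A' by (intro eq_matI) auto
  have "trace_norm (drift_flow \<sigma> \<tau>) \<le> trace_norm (drift_flow \<sigma> 0) + 0 * \<tau>\<^sup>2 / 2"
  proof (rule D.trace_norm_flow_le[where R = "\<lambda>_. 0\<^sub>m m m"])
    fix s
    have "gen m {} \<gamma> L A (drift_flow \<sigma> s) + 0\<^sub>m m m = A * drift_flow \<sigma> s + drift_flow \<sigma> s * mat_adjoint A"
      using right_add_zero_mat[OF D.gen_carrier[OF drift_flow_carrier[OF \<sigma>, of s]]] gen[OF drift_flow_carrier[OF \<sigma>]] by simp
    thus "has_mat_derivative m (drift_flow \<sigma>) (gen m {} \<gamma> L A (drift_flow \<sigma> s) + 0\<^sub>m m m) (at s within {0..\<tau>})"
      using has_mat_derivative_drift_flow[OF \<sigma>] by simp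
    have "trace_norm (0\<^sub>m m m) \<le> 0"
      using trace_norm_smult_le[of "0\<^sub>m m m" m 0] by simp
    thus "trace_norm (0\<^sub>m m m) \<le> 0 * s" by simp
  qed (use \<tau> \<sigma> in auto)
  thus ?thesis using drift_flow_0[OF \<sigma>] by simp
qed

text \<open>
  One step of the scheme before compression, with the exact exponential. The step length \<open>s\<close> is kept
  variable: as a curve in \<open>s\<close> the numerical solution can be inserted into the Lindblad equation.
\<close>

definition euler_step where "euler_step \<sigma> s = drift_flow \<sigma> s + complex_of_real s \<cdot>\<^sub>m J (drift_flow \<sigma> s)"

lemma euler_step_carrier [simp]: "\<sigma> \<in> carrier_mat m m \<Longrightarrow> euler_step \<sigma> s \<in> carrier_mat m m"
  by (simp add: euler_step_def)

text \<open>
  The defect of the curve \<open>euler_step\<close> in the Lindblad equation. Its factor \<open>s\<close> makes the local error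
  of second order.
\<close>

definition residual where
  "residual \<sigma> s = complex_of_real s \<cdot>\<^sub>m (J (A * drift_flow \<sigma> s + drift_flow \<sigma> s * mat_adjoint A) - G (J (drift_flow \<sigma> s)))"

lemma residual_carrier [simp]: "residual \<sigma> s \<in> carrier_mat m m"
  unfolding residual_def by (intro smult_carrier_mat minus_carrier_mat gen_carrier) simp

lemma has_mat_derivative_euler_step:
  assumes \<sigma>: "\<sigma> \<in> carrier_mat m m"
  shows "has_mat_derivative m (euler_step \<sigma>) (G (euler_step \<sigma> s) + residual \<sigma> s) (at s within S)"
proof -
  let ?X' = "A * drift_flow \<sigma> s + drift_flow \<sigma> s * mat_adjoint A"
  note X = drift_flow_carrier[OF \<sigma>]
  have X': "?X' \<in> carrier_mat m m" by (rule add_carrier_mat[OF mult_carrier_mat[OF X A']])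
  have JX: "has_mat_derivative m (\<lambda>s. J (drift_flow \<sigma> s)) (J ?X') (at s within S)"
    by (rule has_mat_derivative_jump[OF has_mat_derivative_drift_flow[OF \<sigma>] X X'])
  have "has_mat_derivative m (euler_step \<sigma>) (?X' + (J (drift_flow \<sigma> s) + complex_of_real s \<cdot>\<^sub>m J ?X')) (at s within S)"
    unfolding euler_step_def[abs_def]
    by (rule has_mat_derivative_add[OF has_mat_derivative_drift_flow[OF \<sigma>] has_mat_derivative_scale[OF JX] X _ X']) auto
  also have "?X' + (J (drift_flow \<sigma> s) + complex_of_real s \<cdot>\<^sub>m J ?X') = G (euler_step \<sigma> s) + residual \<sigma> s"
  proof -
    have alg: "P + (Q + z \<cdot>\<^sub>m R) = (P + Q + z \<cdot>\<^sub>m W) + z \<cdot>\<^sub>m (R - W)"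
      if "P \<in> carrier_mat m m" "Q \<in> carrier_mat m m" "R \<in> carrier_mat m m" "W \<in> carrier_mat m m" for P Q R W and z :: complex
      using that by (intro eq_matI) (auto simp: algebra_simps)
    have "G (euler_step \<sigma> s) = (?X' + J (drift_flow \<sigma> s)) + complex_of_real s \<cdot>\<^sub>m G (J (drift_flow \<sigma> s))"
      unfolding euler_step_def gen_linear[OF X jump_carrier] by (simp add: gen_def[of _ _ _ _ _ "drift_flow \<sigma> s"])
    thus ?thesis
      unfolding residual_def using alg[OF X' jump_carrier jump_carrier gen_carrier[OF jump_carrier]] by simp
  qed
  finally show ?thesis .
qed

lemma trace_norm_residual_le:
  assumes \<sigma>: "\<sigma> \<in> carrier_mat m m" and s: "0 \<le> s"
  shows "trace_norm (residual \<sigma> s) \<le> (4 * jump_bound * trace_norm A + jump_bound\<^sup>2) * trace_norm \<sigma> * s"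
proof -
  let ?X' = "A * drift_flow \<sigma> s + drift_flow \<sigma> s * mat_adjoint A" and ?c = "trace_norm A" and ?b = "trace_norm \<sigma>"
  have X: "drift_flow \<sigma> s \<in> carrier_mat m m" using \<sigma> by simp
  have X': "?X' \<in> carrier_mat m m" by (rule add_carrier_mat[OF mult_carrier_mat[OF X A']])
  have c: "0 \<le> ?c" by (rule trace_norm_nonneg[OF A])
  have b: "trace_norm (drift_flow \<sigma> s) \<le> ?b" by (rule trace_norm_drift_flow_le[OF \<sigma> s])
  have "trace_norm (J ?X') \<le> jump_bound * (2 * ?c * ?b)"
  proof -
    have "trace_norm (J ?X') \<le> jump_bound * trace_norm ?X'" by (rule trace_norm_jump_le[OF X'])
    also have "trace_norm ?X' \<le> 2 * ?c * trace_norm (drift_flow \<sigma> s)" by (rule trace_norm_commutator_le[OF X])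
    also have "\<dots> \<le> 2 * ?c * ?b" using b c by (intro mult_left_mono) auto
    finally show ?thesis using jump_bound_nonneg by (simp add: mult_left_mono)
  qed
  moreover have "trace_norm (G (J (drift_flow \<sigma> s))) \<le> (2 * ?c + jump_bound) * (jump_bound * ?b)"
  proof -
    have "trace_norm (G (J (drift_flow \<sigma> s))) \<le> (2 * ?c + jump_bound) * trace_norm (J (drift_flow \<sigma> s))" by (rule trace_norm_gen_le[OF jump_carrier])
    also have "trace_norm (J (drift_flow \<sigma> s)) \<le> jump_bound * trace_norm (drift_flow \<sigma> s)" by (rule trace_norm_jump_le[OF X])
    also have "\<dots> \<le> jump_bound * ?b" using b jump_bound_nonneg by (intro mult_left_mono) auto
    finally show ?thesis using jump_bound_nonneg c by (simp add: mult_left_mono)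
  qed
  moreover have "trace_norm (J ?X' - G (J (drift_flow \<sigma> s))) \<le> trace_norm (J ?X') + trace_norm (G (J (drift_flow \<sigma> s)))"
    by (rule trace_norm_minus[OF jump_carrier gen_carrier[OF jump_carrier]])
  ultimately have "trace_norm (J ?X' - G (J (drift_flow \<sigma> s))) \<le> (4 * jump_bound * ?c + jump_bound\<^sup>2) * ?b"
    by (simp add: power2_eq_square algebra_simps)
  hence "s * trace_norm (J ?X' - G (J (drift_flow \<sigma> s))) \<le> s * ((4 * jump_bound * ?c + jump_bound\<^sup>2) * ?b)"
    using s by (rule mult_left_mono)
  moreover have "trace_norm (residual \<sigma> s) \<le> s * trace_norm (J ?X' - G (J (drift_flow \<sigma> s)))"
    unfolding residual_def
    using trace_norm_smult_le[OF minus_carrier_mat[OF gen_carrier[OF jump_carrier]], of "complex_of_real s" "J ?X'"] s by simp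
  ultimately show ?thesis by (simp add: mult_ac)
qed

text \<open>
  The difference of an exact solution and the numerical curve solves the Lindblad equation with
  inhomogeneity \<open>- residual\<close>. Integrating the bound of the residual over \<open>[0, \<tau>]\<close> gives the local
  error, and the error at time zero is propagated with constant one.
\<close>

lemma exact_minus_euler_step_le:
  assumes \<sigma>: "\<sigma> \<in> carrier_mat m m" and \<tau>: "0 \<le> \<tau>"
    and P: "\<And>s. s \<in> {0..\<tau>} \<Longrightarrow> P s \<in> carrier_mat m m"
    and deriv: "\<And>s. s \<in> {0..\<tau>} \<Longrightarrow> has_mat_derivative m P (G (P s)) (at s within {0..\<tau>})"
  shows "trace_norm (P \<tau> - euler_step \<sigma> \<tau>) \<le> trace_norm (P 0 - \<sigma>)
    + (2 * jump_bound * trace_norm A + jump_bound\<^sup>2 / 2) * trace_norm \<sigma> * \<tau>\<^sup>2"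
proof -
  let ?\<kappa> = "(4 * jump_bound * trace_norm A + jump_bound\<^sup>2) * trace_norm \<sigma>"
  have Y: "euler_step \<sigma> s \<in> carrier_mat m m" for s using \<sigma> by simp
  have "trace_norm (P \<tau> - euler_step \<sigma> \<tau>) \<le> trace_norm (P 0 - euler_step \<sigma> 0) + ?\<kappa> * \<tau>\<^sup>2 / 2"
  proof (rule trace_norm_flow_le[where F = "\<lambda>s. P s - euler_step \<sigma> s" and R = "\<lambda>s. (-1) \<cdot>\<^sub>m residual \<sigma> s"])
    show "0 \<le> ?\<kappa>" using jump_bound_nonneg trace_norm_nonneg[OF A] trace_norm_nonneg[OF \<sigma>] by simp
    show "P s - euler_step \<sigma> s \<in> carrier_mat m m" for s by (rule minus_carrier_mat[OF Y])
    fix s assume s: "s \<in> {0..\<tau>}"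
    have eq: "G (P s - euler_step \<sigma> s) + (-1) \<cdot>\<^sub>m residual \<sigma> s = G (P s) - (G (euler_step \<sigma> s) + residual \<sigma> s)"
    proof -
      have "(U - V) + (-1) \<cdot>\<^sub>m W = U - (V + W)"
        if "U \<in> carrier_mat m m" "V \<in> carrier_mat m m" "W \<in> carrier_mat m m" for U V W :: "complex mat"
        using that by (intro eq_matI) auto
      from this[OF gen_carrier[OF P[OF s]] gen_carrier[OF Y] residual_carrier] show ?thesis
        unfolding gen_minus[OF P[OF s] Y] .
    qed
    show "has_mat_derivative m (\<lambda>s. P s - euler_step \<sigma> s) (G (P s - euler_step \<sigma> s) + (-1) \<cdot>\<^sub>m residual \<sigma> s) (at s within {0..\<tau>})"
      unfolding eq
      using deriv[OF s] has_mat_derivative_euler_step[OF \<sigma>, of s "{0..\<tau>}"] carrier_matD[OF Y]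
        carrier_matD[OF residual_carrier[of \<sigma> s]] carrier_matD[OF gen_carrier[OF Y, of s]]
      unfolding has_mat_derivative_def by (auto intro!: has_vector_derivative_diff)
    show "trace_norm ((-1) \<cdot>\<^sub>m residual \<sigma> s) \<le> ?\<kappa> * s"
      using trace_norm_smult_le[OF residual_carrier, of "-1" \<sigma> s] trace_norm_residual_le[OF \<sigma>, of s] s by simp
  qed (use \<tau> in auto)
  moreover have "euler_step \<sigma> 0 = \<sigma>"
    unfolding euler_step_def using drift_flow_0[OF \<sigma>] \<sigma> carrier_matD[OF jump_carrier[of m I \<gamma> L \<sigma>]]
    by (intro eq_matI) auto
  ultimately show ?thesis by (simp add: field_simps)
qed

end

text \<open>
  The balance equation makes the generator annihilate the trace. Evaluated as a quadratic form it
  yields the dissipativity condition with equality.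
\<close>

locale lindblad_generator =
  fixes m :: nat and I :: "nat set" and \<gamma> :: "nat \<Rightarrow> real" and L :: "nat \<Rightarrow> complex mat" and A :: "complex mat"
  assumes A_carrier: "A \<in> carrier_mat m m"
    and L_carrier: "\<And>k. k \<in> I \<Longrightarrow> L k \<in> carrier_mat m m"
    and rates_nonneg: "\<And>k. k \<in> I \<Longrightarrow> 0 \<le> \<gamma> k"
    and balance: "A + mat_adjoint A + mat_sum m m I (\<lambda>k. complex_of_real (\<gamma> k) \<cdot>\<^sub>m (mat_adjoint (L k) * L k)) = 0\<^sub>m m m"
begin

sublocale dissipative_generator
proof
  fix v :: "complex vec" assume v: "v \<in> carrier_vec m"
  let ?B = "mat_sum m m I (\<lambda>k. complex_of_real (\<gamma> k) \<cdot>\<^sub>m (mat_adjoint (L k) * L k))"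
  have A': "mat_adjoint A \<in> carrier_mat m m" using A_carrier by simp
  have Av: "A *\<^sub>v v \<in> carrier_vec m" using A_carrier v by simp
  have "0 = ((A + mat_adjoint A + ?B) *\<^sub>v v) \<bullet>c v"
    unfolding balance using v by (simp add: cscalar_mult_mat_vec[of _ m m])
  also have "\<dots> = (A *\<^sub>v v) \<bullet>c v + (mat_adjoint A *\<^sub>v v) \<bullet>c v + (?B *\<^sub>v v) \<bullet>c v"
    using A_carrier A' v by (simp add: cscalar_add_mat[of _ m m])
  also have "(mat_adjoint A *\<^sub>v v) \<bullet>c v = cnj ((A *\<^sub>v v) \<bullet>c v)"
    using cscalar_prod_mat_adjoint[of v "mat_adjoint A" v] A_carrier v cscalar_prod_commute[OF v Av] by simp
  also have "(?B *\<^sub>v v) \<bullet>c v = (\<Sum>k\<in>I. ((complex_of_real (\<gamma> k) \<cdot>\<^sub>m (mat_adjoint (L k) * L k)) *\<^sub>v v) \<bullet>c v)"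
    using L_carrier v by (intro cscalar_mat_sum smult_carrier_mat mult_carrier_mat[of _ m m _ m] mat_adjoint_carrier) auto
  also have "\<dots> = (\<Sum>k\<in>I. complex_of_real (\<gamma> k * (vnorm (L k *\<^sub>v v))\<^sup>2))"
  proof (rule sum.cong[OF refl])
    fix k assume k: "k \<in> I"
    have Lk: "L k \<in> carrier_mat m m" "mat_adjoint (L k) \<in> carrier_mat m m" using L_carrier[OF k] by auto
    have "((mat_adjoint (L k) * L k) *\<^sub>v v) \<bullet>c v = (mat_adjoint (L k) *\<^sub>v (L k *\<^sub>v v)) \<bullet>c v"
      using assoc_mult_mat_vec[OF Lk(2,1) v] by simp
    also have "\<dots> = (L k *\<^sub>v v) \<bullet>c (L k *\<^sub>v v)"
      using Lk v by (subst cscalar_prod_mat_adjoint) auto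
    finally show "((complex_of_real (\<gamma> k) \<cdot>\<^sub>m (mat_adjoint (L k) * L k)) *\<^sub>v v) \<bullet>c v = complex_of_real (\<gamma> k * (vnorm (L k *\<^sub>v v))\<^sup>2)"
      using cscalar_smult_mat[OF mult_carrier_mat[OF Lk(2,1)] v v] by (simp add: cscalar_prod_self)
  qed
  finally have "0 = Re ((A *\<^sub>v v) \<bullet>c v + cnj ((A *\<^sub>v v) \<bullet>c v) + (\<Sum>k\<in>I. complex_of_real (\<gamma> k * (vnorm (L k *\<^sub>v v))\<^sup>2)))"
    by simp
  thus "2 * Re ((A *\<^sub>v v) \<bullet>c v) + (\<Sum>k\<in>I. \<gamma> k * (vnorm (L k *\<^sub>v v))\<^sup>2) \<le> 0"
    by (simp del: of_real_mult of_real_power)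
qed (use A_carrier L_carrier rates_nonneg in auto)

lemma mat_trace_gen:
  assumes X: "X \<in> carrier_mat m m"
  shows "mat_trace (G X) = 0"
proof -
  let ?B = "mat_sum m m I (\<lambda>k. complex_of_real (\<gamma> k) \<cdot>\<^sub>m (mat_adjoint (L k) * L k))"
  have LL: "complex_of_real (\<gamma> k) \<cdot>\<^sub>m (mat_adjoint (L k) * L k) \<in> carrier_mat m m" if "k \<in> I" for k
    using L_carrier[OF that] by (intro smult_carrier_mat mult_carrier_mat[of _ m m _ m] mat_adjoint_carrier)
  have "mat_trace (J X) = (\<Sum>k\<in>I. mat_trace ((complex_of_real (\<gamma> k) \<cdot>\<^sub>m (mat_adjoint (L k) * L k)) * X))"
  proof -
    have "mat_trace (J X) = (\<Sum>k\<in>I. mat_trace (complex_of_real (\<gamma> k) \<cdot>\<^sub>m (L k * X * mat_adjoint (L k))))"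
      unfolding jump_def using L_carrier X by (intro mat_trace_mat_sum smult_carrier_mat mult_carrier_mat[of _ m m _ m] mat_adjoint_carrier) auto
    also have "\<dots> = (\<Sum>k\<in>I. mat_trace ((complex_of_real (\<gamma> k) \<cdot>\<^sub>m (mat_adjoint (L k) * L k)) * X))"
    proof (rule sum.cong[OF refl])
      fix k assume k: "k \<in> I"
      have Lk: "L k \<in> carrier_mat m m" "mat_adjoint (L k) \<in> carrier_mat m m" using L_carrier[OF k] by auto
      show "mat_trace (complex_of_real (\<gamma> k) \<cdot>\<^sub>m (L k * X * mat_adjoint (L k))) =
          mat_trace ((complex_of_real (\<gamma> k) \<cdot>\<^sub>m (mat_adjoint (L k) * L k)) * X)"
        using mat_trace_commute[OF mult_carrier_mat[OF Lk(1) X] Lk(2)] Lk X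
        by (simp add: assoc mult_smult_assoc_mat[of _ m m _ m] mat_trace_smult[of _ m])
    qed
    finally show ?thesis .
  qed
  also have "\<dots> = mat_trace (?B * X)"
    using LL X by (simp add: mult_mat_sum_left[of _ m m _ _ m] mat_trace_mat_sum mult_carrier_mat[of _ m m _ m])
  finally have J: "mat_trace (J X) = mat_trace (?B * X)" .
  have "mat_trace (G X) = mat_trace (A * X) + mat_trace (mat_adjoint A * X) + mat_trace (?B * X)"
    unfolding gen_def using A A' X J mat_trace_commute[OF X A']
    by (simp add: mat_trace_add[of _ m] mult_carrier_mat[of _ m m _ m])
  also have "\<dots> = mat_trace ((A + mat_adjoint A + ?B) * X)"
    using A A' X by (simp add: mat_trace_add[of _ m] mult_carrier_mat[of _ m m _ m] add_mult_distrib_mat[of _ m m _ _ m])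
  also have "\<dots> = 0" unfolding balance using X by (simp add: mat_trace_def)
  finally show ?thesis .
qed

text \<open>
  The generator preserves the trace. Of the derivative of \<open>euler_step\<close>, only the part
  \<open>s J (A X + X A\<^sup>\<dagger>)\<close> of the residual contributes to the trace. This sharpens the estimate that would
  follow from the local error in trace norm.
\<close>

lemma trace_euler_step_defect:
  assumes \<sigma>: "\<sigma> \<in> carrier_mat m m" and \<tau>: "0 \<le> \<tau>"
  shows "\<bar>Re (mat_trace (euler_step \<sigma> \<tau>)) - Re (mat_trace \<sigma>)\<bar> \<le> jump_bound * trace_norm A * trace_norm \<sigma> * \<tau>\<^sup>2"
proof -
  let ?X' = "\<lambda>s. A * drift_flow \<sigma> s + drift_flow \<sigma> s * mat_adjoint A"
  have Yc: "euler_step \<sigma> s \<in> carrier_mat m m" for s using \<sigma> by simp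
  have X': "?X' s \<in> carrier_mat m m" for s by (rule add_carrier_mat[OF mult_carrier_mat[OF drift_flow_carrier[OF \<sigma>] A']])
  have tr: "mat_trace (G (euler_step \<sigma> s) + residual \<sigma> s) = complex_of_real s * mat_trace (J (?X' s))" for s
    using mat_trace_gen[OF Yc] mat_trace_gen[OF jump_carrier]
    unfolding residual_def
    by (simp add: mat_trace_add[of _ m] mat_trace_smult[of _ m] mat_trace_minus[of _ m] Yc minus_carrier_mat)
  have "\<bar>Re (mat_trace (euler_step \<sigma> \<tau>)) - Re (mat_trace (euler_step \<sigma> 0))\<bar> \<le> (2 * jump_bound * trace_norm A * trace_norm \<sigma>) * \<tau>\<^sup>2 / 2"
  proof (rule real_growth_bound[OF \<tau>, where g' = "\<lambda>s. Re (complex_of_real s * mat_trace (J (?X' s)))"])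
    fix s
    have "((\<lambda>s. mat_trace (euler_step \<sigma> s)) has_vector_derivative complex_of_real s * mat_trace (J (?X' s))) (at s)"
      unfolding tr[symmetric]
      by (rule has_mat_derivative_trace[OF has_mat_derivative_euler_step[OF \<sigma>]]) (use Yc in auto)
    from bounded_linear.has_vector_derivative[OF bounded_linear_Re this]
    show "((\<lambda>s. Re (mat_trace (euler_step \<sigma> s))) has_field_derivative Re (complex_of_real s * mat_trace (J (?X' s)))) (at s)"
      by (simp add: has_real_derivative_iff_has_vector_derivative)
  next
    fix s assume s: "0 \<le> s" "s \<le> \<tau>"
    have "cmod (mat_trace (J (?X' s))) \<le> jump_bound * (2 * trace_norm A * trace_norm \<sigma>)"
    proof -
      have "cmod (mat_trace (J (?X' s))) \<le> trace_norm (J (?X' s))" by (rule norm_trace_le[OF jump_carrier])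
      also have "\<dots> \<le> jump_bound * trace_norm (?X' s)" by (rule trace_norm_jump_le[OF X'])
      also have "trace_norm (?X' s) \<le> 2 * trace_norm A * trace_norm (drift_flow \<sigma> s)"
        using \<sigma> by (intro trace_norm_commutator_le) simp
      also have "\<dots> \<le> 2 * trace_norm A * trace_norm \<sigma>"
        using trace_norm_drift_flow_le[OF \<sigma> s(1)] trace_norm_nonneg[OF A] by (intro mult_left_mono) auto
      finally show ?thesis using jump_bound_nonneg by (simp add: mult_left_mono)
    qed
    hence "s * cmod (mat_trace (J (?X' s))) \<le> s * (jump_bound * (2 * trace_norm A * trace_norm \<sigma>))"
      using s(1) by (rule mult_left_mono)
    moreover have "\<bar>Re (complex_of_real s * mat_trace (J (?X' s)))\<bar> \<le> s * cmod (mat_trace (J (?X' s)))"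
      using s abs_Re_le_cmod[of "complex_of_real s * mat_trace (J (?X' s))"] by (simp add: norm_mult)
    ultimately show "\<bar>Re (complex_of_real s * mat_trace (J (?X' s)))\<bar> \<le> 2 * jump_bound * trace_norm A * trace_norm \<sigma> * s"
      by (simp add: mult_ac)
  qed
  moreover have "euler_step \<sigma> 0 = \<sigma>"
    unfolding euler_step_def using drift_flow_0[OF \<sigma>] \<sigma> carrier_matD[OF jump_carrier[of m I \<gamma> L \<sigma>]]
    by (intro eq_matI) auto
  ultimately show ?thesis by simp
qed

end

section \<open>Expansion, compression and normalization of low-rank factors\<close>

lemma mat_of_cols_gram_index:
  fixes cs :: "complex vec list"
  assumes "i < n" "j < n"
  shows "(mat_of_cols n cs * mat_adjoint (mat_of_cols n cs)) $$ (i, j) = (\<Sum>c\<leftarrow>cs. c $ i * cnj (c $ j))"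
  using assms
  by (simp add: index_mult_mat_sum mat_of_cols_index sum_list_sum_nth lessThan_atLeast0 del: index_mult_mat(1))

lemma hcat_gram_index:
  assumes "\<And>B. B \<in> set Bs \<Longrightarrow> dim_row B = n" and ij: "i < n" "j < n"
  shows "(hcat n Bs * mat_adjoint (hcat n Bs)) $$ (i, j) = (\<Sum>B\<leftarrow>Bs. (B * mat_adjoint B) $$ (i, j))"
proof -
  have eq: "(\<Sum>c\<leftarrow>cols B. c $ i * cnj (c $ j)) = (B * mat_adjoint B) $$ (i, j)" if "dim_row B = n" for B :: "complex mat"
    using that ij by (simp add: sum_list_sum_nth lessThan_atLeast0 index_mult_mat_sum del: index_mult_mat(1))
  have "(\<Sum>c\<leftarrow>concat (map cols Bs). c $ i * cnj (c $ j)) = (\<Sum>B\<leftarrow>Bs. (B * mat_adjoint B) $$ (i, j))"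
    using assms(1) by (induction Bs) (simp_all add: eq del: index_mult_mat(1))
  thus ?thesis
    unfolding hcat_def mat_of_cols_gram_index[OF ij] .
qed

text \<open>
  For blocks placed side by side, the products with the adjoints add up, so that the expanded factor
  represents one explicit Euler step of the jump part.
\<close>

lemma lree_expand_gram:
  assumes E: "E \<in> carrier_mat m m" and Z: "Z \<in> carrier_mat m q" and \<tau>: "0 \<le> \<tau>"
    and L: "\<And>k. k \<in> {1..K} \<Longrightarrow> L k \<in> carrier_mat m m" and \<gamma>: "\<And>k. k \<in> {1..K} \<Longrightarrow> 0 \<le> \<gamma> k"
  defines "W \<equiv> lree_expand m K \<gamma> L \<tau> E Z"
  defines "X \<equiv> E * (Z * mat_adjoint Z) * mat_adjoint E"
  shows "W * mat_adjoint W = X + complex_of_real \<tau> \<cdot>\<^sub>m jump m {1..K} \<gamma> L X"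
proof -
  define V where "V = E * Z"
  have V: "V \<in> carrier_mat m q" using E Z by (simp add: V_def)
  have Z': "mat_adjoint Z \<in> carrier_mat q m" and E': "mat_adjoint E \<in> carrier_mat m m" and V': "mat_adjoint V \<in> carrier_mat q m"
    using Z E V by auto
  have X: "X = V * mat_adjoint V"
    unfolding X_def V_def using E Z Z' E'
    by (simp add: mat_adjoint_mult assoc_mult_mat[of _ m m _ q _ m] assoc_mult_mat[of _ m m _ m _ m]
        assoc_mult_mat[of _ m q _ m _ m] mult_carrier_mat[of _ m q _ m] mult_carrier_mat[of _ q m _ m])
  define B where "B k = complex_of_real (sqrt (\<gamma> k * \<tau>)) \<cdot>\<^sub>m (L k * V)" for k
  define Bs where "Bs = V # map B [1..<Suc K]"
  have W: "W = hcat m Bs" by (simp add: W_def lree_expand_def Let_def Bs_def B_def[abs_def] V_def)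
  have Bc: "B k \<in> carrier_mat m q" if "k \<in> {1..K}" for k using L[OF that] V by (simp add: B_def)
  have rows: "dim_row C = m" if "C \<in> set Bs" for C
  proof -
    from that have "C = V \<or> (\<exists>k\<in>{1..K}. C = B k)"
      by (auto simp: Bs_def less_Suc_eq_le simp del: upt_Suc)
    thus ?thesis using V Bc by fastforce
  qed
  show ?thesis
  proof (rule eq_matI)
    fix i j assume "i < dim_row (X + complex_of_real \<tau> \<cdot>\<^sub>m jump m {1..K} \<gamma> L X)" "j < dim_col (X + complex_of_real \<tau> \<cdot>\<^sub>m jump m {1..K} \<gamma> L X)"
    hence ij: "i < m" "j < m" by (auto simp: jump_def)
    have BB: "(B k * mat_adjoint (B k)) $$ (i, j) = complex_of_real \<tau> * (complex_of_real (\<gamma> k) \<cdot>\<^sub>m (L k * X * mat_adjoint (L k))) $$ (i, j)"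
      if k: "k \<in> {1..K}" for k
    proof -
      have Lk: "L k \<in> carrier_mat m m" "mat_adjoint (L k) \<in> carrier_mat m m" using L[OF k] by auto
      have LV: "L k * V \<in> carrier_mat m q" "mat_adjoint (L k * V) \<in> carrier_mat q m" using Lk V by auto
      have "B k * mat_adjoint (B k) = complex_of_real (sqrt (\<gamma> k * \<tau>)) * cnj (complex_of_real (sqrt (\<gamma> k * \<tau>))) \<cdot>\<^sub>m ((L k * V) * mat_adjoint (L k * V))"
        unfolding B_def mat_adjoint_smult
        using LV by (intro eq_matI) (auto simp: mult_smult_distrib[of _ m q _ m] mult_smult_assoc_mat[of _ m q _ m] simp del: index_mult_mat(1))
      also have "complex_of_real (sqrt (\<gamma> k * \<tau>)) * cnj (complex_of_real (sqrt (\<gamma> k * \<tau>))) = complex_of_real \<tau> * complex_of_real (\<gamma> k)"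
        using \<gamma>[OF k] \<tau> by (simp flip: of_real_mult add: mult.commute)
      also have "(L k * V) * mat_adjoint (L k * V) = L k * X * mat_adjoint (L k)"
        unfolding X using Lk V V'
        by (simp add: mat_adjoint_mult assoc_mult_mat[of _ m m _ q _ m] assoc_mult_mat[of _ m m _ m _ m]
          assoc_mult_mat[of _ m q _ m _ m] mult_carrier_mat[of _ m q _ m] mult_carrier_mat[of _ q m _ m])
      finally show ?thesis
        using ij Lk by (simp del: index_mult_mat(1))
    qed
    have "(W * mat_adjoint W) $$ (i, j) = (\<Sum>C\<leftarrow>Bs. (C * mat_adjoint C) $$ (i, j))"
      unfolding W by (rule hcat_gram_index[OF rows ij])
    also have "\<dots> = X $$ (i, j) + (\<Sum>k\<leftarrow>[1..<Suc K]. (B k * mat_adjoint (B k)) $$ (i, j))"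
      by (simp add: Bs_def X o_def del: upt_Suc index_mult_mat(1))
    also have "(\<Sum>k\<leftarrow>[1..<Suc K]. (B k * mat_adjoint (B k)) $$ (i, j)) = (\<Sum>k\<in>{1..K}. (B k * mat_adjoint (B k)) $$ (i, j))"
      by (simp add: interv_sum_list_conv_sum_set_nat atLeastLessThanSuc_atLeastAtMost del: upt_Suc index_mult_mat(1))
    also have "\<dots> = (\<Sum>k\<in>{1..K}. complex_of_real \<tau> * (complex_of_real (\<gamma> k) \<cdot>\<^sub>m (L k * X * mat_adjoint (L k))) $$ (i, j))"
      by (rule sum.cong) (simp_all only: BB)
    also have "X $$ (i, j) + \<dots> = (X + complex_of_real \<tau> \<cdot>\<^sub>m jump m {1..K} \<gamma> L X) $$ (i, j)"
      using ij by (simp add: jump_def sum_distrib_left del: index_mult_mat(1))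
    finally show "(W * mat_adjoint W) $$ (i, j) = (X + complex_of_real \<tau> \<cdot>\<^sub>m jump m {1..K} \<gamma> L X) $$ (i, j)" .
  qed (auto simp: W jump_def hcat_def)
qed

text \<open>
  The rank \<open>min (dim_row Z) (dim_col Z)\<close> always meets the tolerance, since all later singular values
  are zero by convention; hence the least such rank exists and does not exceed it.
\<close>

lemma trunc_rank_props:
  assumes tol: "0 \<le> tol"
  shows "trunc_rank tol Z \<le> min (dim_row Z) (dim_col Z)"
    and "(\<Sum>j\<in>{trunc_rank tol Z..<min (dim_row Z) (dim_col Z)}. (sing_val Z j)\<^sup>2) \<le> tol"
proof -
  let ?P = "\<lambda>r. (\<Sum>j\<in>{r..<dim_col Z}. (sing_val Z j)\<^sup>2) \<le> tol"
  have P: "?P (min (dim_row Z) (dim_col Z))"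
    using tol by (subst sum.neutral) (auto simp: sing_val_def)
  show "trunc_rank tol Z \<le> min (dim_row Z) (dim_col Z)"
    unfolding trunc_rank_def by (rule Least_le[of ?P, OF P])
  have "?P (trunc_rank tol Z)"
    unfolding trunc_rank_def by (rule LeastI[of ?P, OF P])
  moreover have "(\<Sum>j\<in>{trunc_rank tol Z..<min (dim_row Z) (dim_col Z)}. (sing_val Z j)\<^sup>2)
      \<le> (\<Sum>j\<in>{trunc_rank tol Z..<dim_col Z}. (sing_val Z j)\<^sup>2)"
    by (rule sum_mono2) auto
  ultimately show "(\<Sum>j\<in>{trunc_rank tol Z..<min (dim_row Z) (dim_col Z)}. (sing_val Z j)\<^sup>2) \<le> tol"
    by linarith
qed

text \<open>
  Multiplication with the adjoint of an isometry leaves \<open>M M\<^sup>\<dagger>\<close> unchanged. This covers the right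
  singular vectors in a singular value decomposition and in the second form of a compression.
\<close>

lemma index_isometry_gram:
  fixes M :: "complex mat"
  assumes M: "M \<in> carrier_mat n k" and V: "V \<in> carrier_mat q k" "mat_adjoint V * V = 1\<^sub>m k" and ij: "i < n" "j < n"
  shows "((M * mat_adjoint V) * mat_adjoint (M * mat_adjoint V)) $$ (i, j) = (\<Sum>l<k. M $$ (i, l) * cnj (M $$ (j, l)))"
proof -
  have V': "mat_adjoint V \<in> carrier_mat k q" and M': "mat_adjoint M \<in> carrier_mat k n" using V M by auto
  have "(M * mat_adjoint V) * mat_adjoint (M * mat_adjoint V) = (M * mat_adjoint V) * (V * mat_adjoint M)"
    using M V by (simp add: mat_adjoint_mult)
  also have "\<dots> = M * (mat_adjoint V * (V * mat_adjoint M))"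
    by (rule assoc_mult_mat[OF M V' mult_carrier_mat[OF V(1) M']])
  also have "mat_adjoint V * (V * mat_adjoint M) = (mat_adjoint V * V) * mat_adjoint M"
    by (rule assoc_mult_mat[OF V' V(1) M', symmetric])
  also have "\<dots> = mat_adjoint M" unfolding V(2) using M' by (rule left_mult_one_mat)
  finally have "(M * mat_adjoint V) * mat_adjoint (M * mat_adjoint V) = M * mat_adjoint M" .
  thus ?thesis using M ij by (simp add: index_mult_mat_sum del: index_mult_mat(1))
qed

text \<open>
  Both ways of storing the compression represent \<open>\<Sum>\<^sub>j\<^sub><\<^sub>r \<sigma>\<^sub>j\<^sup>2 u\<^sub>j u\<^sub>j\<^sup>\<dagger>\<close>. The discarded part is \<open>B B\<^sup>\<dagger>\<close>, where \<open>B\<close>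
  has the columns \<open>\<sigma>\<^sub>j u\<^sub>j\<close> with \<open>j \<ge> r\<close>; its trace norm is the discarded sum of squared singular values.
\<close>

lemma column_compression_error:
  assumes Z: "Z \<in> carrier_mat n q" and tol: "0 \<le> tol" and comp: "column_compression tol Z Zc"
  shows "dim_row Zc = n" and "trace_norm (Z * mat_adjoint Z - Zc * mat_adjoint Zc) \<le> tol"
proof -
  define p where "p = min n q"
  define r where "r = trunc_rank tol Z"
  define s where "s = sing_val Z"
  obtain U V where svd: "is_svd Z U V"
    and Zc: "Zc = first_cols r U * mat_diag r (\<lambda>j. complex_of_real (s j)) \<or>
      Zc = first_cols r U * mat_diag r (\<lambda>j. complex_of_real (s j)) * mat_adjoint (first_cols r V)"
    using comp by (auto simp: column_compression_def Let_def r_def s_def)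
  have U: "U \<in> carrier_mat n p" "mat_adjoint U * U = 1\<^sub>m p"
    and V: "V \<in> carrier_mat q p" "mat_adjoint V * V = 1\<^sub>m p"
    and ZUV: "Z = U * mat_diag p (\<lambda>j. complex_of_real (s j)) * mat_adjoint V"
    using svd Z by (simp_all add: is_svd_def Let_def p_def s_def)
  have rp: "r \<le> p" and tail: "(\<Sum>j\<in>{r..<p}. (s j)\<^sup>2) \<le> tol"
    using trunc_rank_props[OF tol, of Z] Z by (simp_all add: r_def p_def s_def)
  define W where "W = first_cols r U * mat_diag r (\<lambda>j. complex_of_real (s j))"
  have fU: "first_cols r U \<in> carrier_mat n r" using U by (simp add: first_cols_def)
  have W: "W \<in> carrier_mat n r" unfolding W_def using fU by simp
  have W_index: "W $$ (i, l) = complex_of_real (s l) * U $$ (i, l)" if "i < n" "l < r" for i l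
    unfolding W_def mat_diag_mult_right[OF fU] using that U by (simp add: first_cols_def mult.commute)
  define M where "M = U * mat_diag p (\<lambda>j. complex_of_real (s j))"
  have M: "M \<in> carrier_mat n p" unfolding M_def using U by simp
  have M_index: "M $$ (i, l) = complex_of_real (s l) * U $$ (i, l)" if "i < n" "l < p" for i l
    unfolding M_def mat_diag_mult_right[OF U(1)] using that by (simp add: mult.commute)
  have fV: "first_cols r V \<in> carrier_mat q r" using V by (simp add: first_cols_def)
  have fVV: "mat_adjoint (first_cols r V) * first_cols r V = 1\<^sub>m r"
  proof (rule eq_matI)
    fix i j assume "i < dim_row (1\<^sub>m r)" "j < dim_col (1\<^sub>m r)"
    hence ij: "i < r" "j < r" by auto
    have "(mat_adjoint (first_cols r V) * first_cols r V) $$ (i, j) = (mat_adjoint V * V) $$ (i, j)"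
      using ij V(1) rp by (simp add: first_cols_def index_mult_mat_sum del: index_mult_mat(1))
    also have "\<dots> = 1\<^sub>m r $$ (i, j)" unfolding V(2) using ij rp by simp
    finally show "(mat_adjoint (first_cols r V) * first_cols r V) $$ (i, j) = 1\<^sub>m r $$ (i, j)" .
  qed (use fV in auto)
  show dim: "dim_row Zc = n" using Zc W fV by (auto simp: W_def[symmetric])
  have ZcZc: "(Zc * mat_adjoint Zc) $$ (i, j) = (\<Sum>l<r. W $$ (i, l) * cnj (W $$ (j, l)))" if ij: "i < n" "j < n" for i j
    using Zc
  proof
    assume "Zc = first_cols r U * mat_diag r (\<lambda>j. complex_of_real (s j))"
    thus ?thesis using W ij by (simp add: W_def[symmetric] index_mult_mat_sum del: index_mult_mat(1))
  next
    assume "Zc = first_cols r U * mat_diag r (\<lambda>j. complex_of_real (s j)) * mat_adjoint (first_cols r V)"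
    thus ?thesis using index_isometry_gram[OF W fV fVV ij] by (simp add: W_def)
  qed
  have ZZ: "(Z * mat_adjoint Z) $$ (i, j) = (\<Sum>l<p. M $$ (i, l) * cnj (M $$ (j, l)))" if ij: "i < n" "j < n" for i j
    unfolding ZUV M_def[symmetric] by (rule index_isometry_gram[OF M V ij])
  define B where "B = mat n p (\<lambda>(i, l). if l < r then 0 else complex_of_real (s l) * U $$ (i, l))"
  have B: "B \<in> carrier_mat n p" by (simp add: B_def)
  have split: "{..<p} = {..<r} \<union> {r..<p}" using rp by auto
  have "Z * mat_adjoint Z - Zc * mat_adjoint Zc = B * mat_adjoint B"
  proof (rule eq_matI)
    fix i j assume "i < dim_row (B * mat_adjoint B)" "j < dim_col (B * mat_adjoint B)"
    hence ij: "i < n" "j < n" using B by auto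
    let ?t = "\<lambda>l. (complex_of_real (s l) * U $$ (i, l)) * cnj (complex_of_real (s l) * U $$ (j, l))"
    have "(B * mat_adjoint B) $$ (i, j) = (\<Sum>l<p. if l < r then 0 else ?t l)"
      using B ij by (auto simp: index_mult_mat_sum B_def simp del: index_mult_mat(1) intro!: sum.cong)
    also have "\<dots> = (\<Sum>l\<in>{r..<p}. ?t l)"
      unfolding split by (subst sum.union_disjoint) auto
    also have "\<dots> = (\<Sum>l<p. ?t l) - (\<Sum>l<r. ?t l)"
      unfolding split by (subst sum.union_disjoint) auto
    also have "(\<Sum>l<p. ?t l) = (Z * mat_adjoint Z) $$ (i, j)"
      unfolding ZZ[OF ij] using ij by (intro sum.cong) (auto simp: M_index)
    also have "(\<Sum>l<r. ?t l) = (Zc * mat_adjoint Zc) $$ (i, j)"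
      unfolding ZcZc[OF ij] using ij by (intro sum.cong) (auto simp: W_index)
    finally show "(Z * mat_adjoint Z - Zc * mat_adjoint Zc) $$ (i, j) = (B * mat_adjoint B) $$ (i, j)"
      using ij Z dim by (simp del: index_mult_mat(1))
  qed (use Z dim B in auto)
  hence "trace_norm (Z * mat_adjoint Z - Zc * mat_adjoint Zc) \<le> (frob_norm B)\<^sup>2"
    using trace_norm_gram_le[OF B] by simp
  also have "\<dots> = (\<Sum>l<p. if l < r then 0 else (s l)\<^sup>2)"
  proof -
    have "(vnorm (col B l))\<^sup>2 = (if l < r then 0 else (s l)\<^sup>2)" if l: "l < p" for l
    proof -
      have "col B l = (if l < r then 0 else complex_of_real (s l)) \<cdot>\<^sub>v col U l"
        using l U by (intro eq_vecI) (auto simp: B_def)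
      hence "vnorm (col B l) = (if l < r then 0 else \<bar>s l\<bar>) * vnorm (col U l)"
        by (simp add: vnorm_smult)
      moreover have "(vnorm (col U l))\<^sup>2 = 1"
      proof -
        have "col U l \<bullet>c col U l = (mat_adjoint U * U) $$ (l, l)"
          using U(1) l by (subst index_mat_adjoint_mult) auto
        thus ?thesis using U(2) l by (simp add: vnorm_power2_eq_Re)
      qed
      ultimately show ?thesis by (simp add: power_mult_distrib)
    qed
    thus ?thesis using B by (simp add: frob_norm_sum_vnorm_col)
  qed
  also have "\<dots> = (\<Sum>l\<in>{r..<p}. (s l)\<^sup>2)"
    unfolding split by (subst sum.union_disjoint) auto
  finally show "trace_norm (Z * mat_adjoint Z - Zc * mat_adjoint Zc) \<le> tol" using tail by linarith
qed

text \<open>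
  Normalization multiplies \<open>Z Z\<^sup>\<dagger>\<close>, whose trace norm is \<open>f\<^sup>2\<close>, by \<open>1 / f\<^sup>2\<close>. The error is therefore the
  deviation of the trace \<open>f\<^sup>2\<close> from one.
\<close>

lemma normalization_error:
  assumes Z: "Z \<in> carrier_mat n q" "Z \<noteq> 0\<^sub>m n q"
  defines "f \<equiv> frob_norm Z"
  defines "Z' \<equiv> complex_of_real (1 / f) \<cdot>\<^sub>m Z"
  shows "(frob_norm Z')\<^sup>2 = 1"
    and "trace_norm (Z * mat_adjoint Z - Z' * mat_adjoint Z') \<le> \<bar>f\<^sup>2 - 1\<bar>"
proof -
  have f0: "0 < f"
  proof -
    have "\<exists>i<n. \<exists>j<q. Z $$ (i, j) \<noteq> 0"
    proof (rule ccontr)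
      assume "\<not> ?thesis"
      hence "Z = 0\<^sub>m n q" using Z(1) by (intro eq_matI) auto
      with Z(2) show False ..
    qed
    then obtain i j where ij: "i < n" "j < q" "Z $$ (i, j) \<noteq> 0" by blast
    have "0 < (cmod (Z $$ (i, j)))\<^sup>2" using ij by simp
    also have "\<dots> \<le> (\<Sum>j<q. (cmod (Z $$ (i, j)))\<^sup>2)"
      using ij by (intro member_le_sum) auto
    also have "\<dots> \<le> (\<Sum>i<n. \<Sum>j<q. (cmod (Z $$ (i, j)))\<^sup>2)"
      using ij by (intro member_le_sum[of i _ "\<lambda>i. \<Sum>j<q. (cmod (Z $$ (i, j)))\<^sup>2"]) (auto intro: sum_nonneg)
    finally have "0 < (\<Sum>i<n. \<Sum>j<q. (cmod (Z $$ (i, j)))\<^sup>2)" .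
    thus ?thesis using Z(1) by (simp add: f_def frob_norm_def)
  qed
  have ZZ: "Z * mat_adjoint Z \<in> carrier_mat n n" using Z by auto
  have "Z' * mat_adjoint Z' = complex_of_real (1 / f\<^sup>2) \<cdot>\<^sub>m (Z * mat_adjoint Z)"
    unfolding Z'_def mat_adjoint_smult using Z
    by (intro eq_matI) (auto simp: index_mult_mat_sum sum_distrib_left power2_eq_square mult_ac simp del: index_mult_mat(1))
  note ZZ' = this
  have "complex_of_real ((frob_norm Z')\<^sup>2) = mat_trace (Z' * mat_adjoint Z')"
    by (rule mat_trace_self_adjoint_product[symmetric])
  also have "\<dots> = complex_of_real (1 / f\<^sup>2) * complex_of_real (f\<^sup>2)"
    unfolding ZZ' mat_trace_smult[OF ZZ] mat_trace_self_adjoint_product f_def ..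
  also have "\<dots> = complex_of_real 1" using f0 by simp
  finally show "(frob_norm Z')\<^sup>2 = 1" by (simp only: of_real_eq_iff)
  have "Z * mat_adjoint Z - Z' * mat_adjoint Z' = complex_of_real (1 - 1 / f\<^sup>2) \<cdot>\<^sub>m (Z * mat_adjoint Z)"
    unfolding ZZ' using ZZ by (intro eq_matI) (auto simp: algebra_simps simp del: index_mult_mat(1))
  hence "trace_norm (Z * mat_adjoint Z - Z' * mat_adjoint Z') \<le> \<bar>1 - 1 / f\<^sup>2\<bar> * trace_norm (Z * mat_adjoint Z)"
    using trace_norm_smult_le[OF ZZ, of "complex_of_real (1 - 1 / f\<^sup>2)"] by (simp only: norm_of_real)
  also have "\<dots> \<le> \<bar>1 - 1 / f\<^sup>2\<bar> * f\<^sup>2"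
    unfolding f_def by (rule mult_left_mono[OF trace_norm_gram_le[OF Z(1)]]) simp
  also have "\<dots> = \<bar>(1 - 1 / f\<^sup>2) * f\<^sup>2\<bar>" by (simp add: abs_mult)
  also have "(1 - 1 / f\<^sup>2) * f\<^sup>2 = f\<^sup>2 - 1" using f0 by (simp add: field_simps)
  finally show "trace_norm (Z * mat_adjoint Z - Z' * mat_adjoint Z') \<le> \<bar>f\<^sup>2 - 1\<bar>" .
qed

section \<open>The drift matrix of the Lindblad equation\<close>

lemma drift_mat_carrier: "H \<in> carrier_mat m m \<Longrightarrow> drift_mat m K H \<gamma> L \<in> carrier_mat m m"
  unfolding drift_mat_def by (intro minus_carrier_mat smult_carrier_mat) simp

lemma
  fixes \<gamma> :: "nat \<Rightarrow> real"
  assumes H: "H \<in> carrier_mat m m" "hermitian_mat H"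
    and L: "\<And>k. k \<in> {1..K} \<Longrightarrow> L k \<in> carrier_mat m m"
  shows mat_adjoint_drift_mat: "mat_adjoint (drift_mat m K H \<gamma> L) = \<i> \<cdot>\<^sub>m H -
      (1/2) \<cdot>\<^sub>m mat_sum m m {1..K} (\<lambda>k. complex_of_real (\<gamma> k) \<cdot>\<^sub>m (mat_adjoint (L k) * L k))"
    and drift_mat_balance: "drift_mat m K H \<gamma> L + mat_adjoint (drift_mat m K H \<gamma> L) +
      mat_sum m m {1..K} (\<lambda>k. complex_of_real (\<gamma> k) \<cdot>\<^sub>m (mat_adjoint (L k) * L k)) = 0\<^sub>m m m"
proof -
  let ?B = "mat_sum m m {1..K} (\<lambda>k. complex_of_real (\<gamma> k) \<cdot>\<^sub>m (mat_adjoint (L k) * L k))"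
  have hB: "mat_adjoint ?B = ?B"
  proof (rule eq_matI)
    fix i j assume "i < dim_row ?B" "j < dim_col ?B"
    hence ij: "i < m" "j < m" by auto
    have "cnj ((complex_of_real (\<gamma> k) \<cdot>\<^sub>m (mat_adjoint (L k) * L k)) $$ (j, i)) =
        (complex_of_real (\<gamma> k) \<cdot>\<^sub>m (mat_adjoint (L k) * L k)) $$ (i, j)" if "k \<in> {1..K}" for k
      using L[OF that] ij by (simp add: index_mult_mat_sum mult.commute del: index_mult_mat(1))
    thus "mat_adjoint ?B $$ (i, j) = ?B $$ (i, j)" using ij by (simp del: index_smult_mat)
  qed auto
  have hH: "cnj (H $$ (j, i)) = H $$ (i, j)" if "i < m" "j < m" for i j
  proof -
    have "mat_adjoint H = H" using H(2) by (simp add: hermitian_mat_def)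
    moreover have "mat_adjoint H $$ (i, j) = cnj (H $$ (j, i))" using H(1) that by (intro index_mat_adjoint) auto
    ultimately show ?thesis by metis
  qed
  have hB': "cnj (?B $$ (j, i)) = ?B $$ (i, j)" if "i < m" "j < m" for i j
    using index_mat_adjoint[of i ?B j] that unfolding hB by simp
  show adj: "mat_adjoint (drift_mat m K H \<gamma> L) = \<i> \<cdot>\<^sub>m H - (1/2) \<cdot>\<^sub>m ?B"
    unfolding drift_mat_def using H by (intro eq_matI) (auto simp: hH hB' simp del: index_mat_sum One_nat_def)
  show "drift_mat m K H \<gamma> L + mat_adjoint (drift_mat m K H \<gamma> L) + ?B = 0\<^sub>m m m"
    unfolding adj unfolding drift_mat_def using H by (intro eq_matI) (auto simp del: index_mat_sum)
qed

text \<open>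
  The anticommutator is absorbed into the non-Hermitian drift matrix \<open>- i H - 1/2 \<Sum>\<^sub>k \<gamma>\<^sub>k L\<^sub>k\<^sup>\<dagger> L\<^sub>k\<close>.
\<close>

lemma lindblad_rhs_eq_gen:
  assumes H: "H \<in> carrier_mat m m" "hermitian_mat H"
    and L: "\<And>k. k \<in> {1..K} \<Longrightarrow> L k \<in> carrier_mat m m" and X: "X \<in> carrier_mat m m"
  shows "lindblad_rhs m K H \<gamma> L X = gen m {1..K} \<gamma> L (drift_mat m K H \<gamma> L) X"
proof -
  let ?F = "\<lambda>k. complex_of_real (\<gamma> k) \<cdot>\<^sub>m (mat_adjoint (L k) * L k)"
  let ?B = "mat_sum m m {1..K} ?F"
  have F: "?F k \<in> carrier_mat m m" if "k \<in> {1..K}" for k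
    using L[OF that] by (auto intro!: mult_carrier_mat[of _ m m _ m])
  have B: "?B \<in> carrier_mat m m" by simp
  have BX: "?B * X = mat_sum m m {1..K} (\<lambda>k. ?F k * X)" by (rule mult_mat_sum_left[OF X F])
  have XB: "X * ?B = mat_sum m m {1..K} (\<lambda>k. X * ?F k)" by (rule mult_mat_sum_right[OF X F])
  have AX: "drift_mat m K H \<gamma> L * X = (- \<i>) \<cdot>\<^sub>m (H * X) - (1/2) \<cdot>\<^sub>m (?B * X)"
    unfolding drift_mat_def using H(1) X B
    by (simp add: minus_mult_distrib_mat[of _ m m _ _ m] mult_smult_assoc_mat[of _ m m _ m])
  have adj: "mat_adjoint (drift_mat m K H \<gamma> L) = \<i> \<cdot>\<^sub>m H - (1/2) \<cdot>\<^sub>m ?B"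
    using H L by (rule mat_adjoint_drift_mat)
  have XA: "X * mat_adjoint (drift_mat m K H \<gamma> L) = \<i> \<cdot>\<^sub>m (X * H) - (1/2) \<cdot>\<^sub>m (X * ?B)"
    using H(1) X B
    unfolding adj
    by (simp add: mult_minus_distrib_mat[of _ m m _ m] mult_smult_distrib[of _ m m _ m])
  show ?thesis
  proof (rule eq_matI)
    fix i j assume "i < dim_row (gen m {1..K} \<gamma> L (drift_mat m K H \<gamma> L) X)" "j < dim_col (gen m {1..K} \<gamma> L (drift_mat m K H \<gamma> L) X)"
    hence ij: "i < m" "j < m" by (auto simp: gen_def jump_def)
    have summand: "(complex_of_real (\<gamma> k) \<cdot>\<^sub>m (L k * X * mat_adjoint (L k) -
        (1/2) \<cdot>\<^sub>m (mat_adjoint (L k) * L k * X + X * (mat_adjoint (L k) * L k)))) $$ (i, j) =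
      (complex_of_real (\<gamma> k) \<cdot>\<^sub>m (L k * X * mat_adjoint (L k))) $$ (i, j)
        - (1/2) * (?F k * X) $$ (i, j) - (1/2) * (X * ?F k) $$ (i, j)" if k: "k \<in> {1..K}" for k
    proof -
      have Lk: "L k \<in> carrier_mat m m" "mat_adjoint (L k) \<in> carrier_mat m m" using L[OF k] by auto
      have LL: "mat_adjoint (L k) * L k \<in> carrier_mat m m" by (rule mult_carrier_mat[OF Lk(2,1)])
      show ?thesis
        using ij Lk X LL carrier_matD[OF Lk(1)] carrier_matD[OF X] unfolding mult_smult_assoc_mat[OF LL X] mult_smult_distrib[OF X LL]
        by (simp add: algebra_simps del: index_mult_mat(1))
    qed
    have "lindblad_rhs m K H \<gamma> L X $$ (i, j) = (- \<i>) * ((H * X) $$ (i, j) - (X * H) $$ (i, j)) +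
       (\<Sum>k\<in>{1..K}. (complex_of_real (\<gamma> k) \<cdot>\<^sub>m (L k * X * mat_adjoint (L k))) $$ (i, j)
        - (1/2) * (?F k * X) $$ (i, j) - (1/2) * (X * ?F k) $$ (i, j))"
      unfolding lindblad_rhs_def using ij H(1) X summand by (simp del: index_mult_mat(1) index_smult_mat(1) add: index_smult_mat(1)[of _ "H * X - X * H"])
    also have "\<dots> = (- \<i>) * ((H * X) $$ (i, j) - (X * H) $$ (i, j)) + jump m {1..K} \<gamma> L X $$ (i, j)
        - (1/2) * (?B * X) $$ (i, j) - (1/2) * (X * ?B) $$ (i, j)"
      unfolding BX XB jump_def using ij by (simp add: sum_subtractf sum_divide_distrib algebra_simps del: index_mult_mat(1) index_smult_mat(1))
    also have "\<dots> = gen m {1..K} \<gamma> L (drift_mat m K H \<gamma> L) X $$ (i, j)"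
      unfolding gen_def AX XA using ij H(1) X by (simp add: jump_def algebra_simps del: index_mult_mat(1) index_mat_sum)
    finally show "lindblad_rhs m K H \<gamma> L X $$ (i, j) = gen m {1..K} \<gamma> L (drift_mat m K H \<gamma> L) X $$ (i, j)" .
  qed (auto simp: gen_def jump_def lindblad_rhs_def)
qed

section \<open>Accumulation of the errors\<close>

lemma has_vector_derivative_shift_within:
  fixes f :: "real \<Rightarrow> complex"
  assumes f: "(f has_vector_derivative f') (at (c + x) within S)" and sub: "\<And>s. s \<in> U \<Longrightarrow> c + s \<in> S"
  shows "((\<lambda>s. f (c + s)) has_vector_derivative f') (at x within U)"
proof -
  have "((\<lambda>s. c + s) has_derivative (\<lambda>h. h)) (at x within U)"
    by (auto intro!: derivative_eq_intros)
  moreover have "(f has_derivative (\<lambda>h. h *\<^sub>R f')) (at (c + x) within (\<lambda>s. c + s) ` U)"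
    by (rule has_derivative_subset[OF f[unfolded has_vector_derivative_def]]) (use sub in auto)
  ultimately show ?thesis
    unfolding has_vector_derivative_def by (rule has_derivative_in_compose)
qed

context lindblad_generator
begin

text \<open>
  The jump term is linear, so an error in the drift flow is amplified by \<open>1 + \<tau> C\<^sub>1\<close> at most.
\<close>

lemma perturbed_step_le:
  assumes \<sigma>: "\<sigma> \<in> carrier_mat m m" and B: "B \<in> carrier_mat m m" and \<tau>: "0 \<le> \<tau>"
    and e: "trace_norm (drift_flow \<sigma> \<tau> - B) \<le> e"
  shows "trace_norm (euler_step \<sigma> \<tau> - (B + complex_of_real \<tau> \<cdot>\<^sub>m J B)) \<le> (1 + \<tau> * jump_bound) * e"
proof -
  let ?X = "drift_flow \<sigma> \<tau>"
  have X: "?X \<in> carrier_mat m m" using \<sigma> by simp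
  have D: "?X - B \<in> carrier_mat m m" using B by (rule minus_carrier_mat)
  have "?X = B + 1 \<cdot>\<^sub>m (?X - B)" using X B by (intro eq_matI) auto
  hence "J ?X = J B + 1 \<cdot>\<^sub>m J (?X - B)" using jump_linear[OF B D, of 1] by simp
  moreover have "P + z \<cdot>\<^sub>m (Q + 1 \<cdot>\<^sub>m R) - (P' + z \<cdot>\<^sub>m Q) = (P - P') + z \<cdot>\<^sub>m R"
    if "P \<in> carrier_mat m m" "P' \<in> carrier_mat m m" "Q \<in> carrier_mat m m" "R \<in> carrier_mat m m" for P P' Q R and z :: complex
    using that by (intro eq_matI) (auto simp: algebra_simps)
  ultimately have "euler_step \<sigma> \<tau> - (B + complex_of_real \<tau> \<cdot>\<^sub>m J B) = (?X - B) + complex_of_real \<tau> \<cdot>\<^sub>m J (?X - B)"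
    unfolding euler_step_def using X B by simp
  hence "trace_norm (euler_step \<sigma> \<tau> - (B + complex_of_real \<tau> \<cdot>\<^sub>m J B))
      \<le> trace_norm (?X - B) + trace_norm (complex_of_real \<tau> \<cdot>\<^sub>m J (?X - B))"
    using trace_norm_add[OF D, of "complex_of_real \<tau> \<cdot>\<^sub>m J (?X - B)"] by simp
  also have "trace_norm (complex_of_real \<tau> \<cdot>\<^sub>m J (?X - B)) \<le> \<tau> * trace_norm (J (?X - B))"
    using trace_norm_smult_le[OF jump_carrier, of "complex_of_real \<tau>"] \<tau> by simp
  also have "\<dots> \<le> \<tau> * (jump_bound * trace_norm (?X - B))"
    using trace_norm_jump_le[OF D] \<tau> by (rule mult_left_mono)
  also have "trace_norm (?X - B) + \<dots> = (1 + \<tau> * jump_bound) * trace_norm (?X - B)"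
    by (simp add: algebra_simps)
  also have "\<dots> \<le> (1 + \<tau> * jump_bound) * e"
    using e jump_bound_nonneg \<tau> by (intro mult_left_mono) auto
  finally show ?thesis by simp
qed

end

text \<open>
  The triangle inequality through the exact Euler step \<open>Y\<close>, the Euler step with perturbed exponential,
  and the compressed matrix. The normalization error is the deviation of the trace from one, to
  which perturbed exponential and compression contribute once more; hence the factors two.
\<close>

lemma scheme_step_error:
  fixes L :: "nat \<Rightarrow> complex mat" and \<gamma> :: "nat \<Rightarrow> real"
  assumes gen: "lindblad_generator m {1..K} \<gamma> L A"
    and \<tau>: "0 \<le> \<tau>" and tol2: "0 \<le> tol2"
    and E: "E \<in> carrier_mat m m" and Z: "Z \<in> carrier_mat m q" "(frob_norm Z)\<^sup>2 = 1"
    and Eerr: "trace_norm (mat_exp (complex_of_real \<tau> \<cdot>\<^sub>m A) * (Z * mat_adjoint Z) * mat_exp (complex_of_real \<tau> \<cdot>\<^sub>m mat_adjoint A)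
                  - E * (Z * mat_adjoint Z) * mat_adjoint E) \<le> e"
    and comp: "column_compression tol2 (lree_expand m K \<gamma> L \<tau> E Z) Zh" and nz: "Zh \<noteq> 0\<^sub>m (dim_row Zh) (dim_col Zh)"
    and P: "\<And>s. s \<in> {0..\<tau>} \<Longrightarrow> P s \<in> carrier_mat m m"
    and deriv: "\<And>s. s \<in> {0..\<tau>} \<Longrightarrow> has_mat_derivative m P (gen m {1..K} \<gamma> L A (P s)) (at s within {0..\<tau>})"
  defines "Z' \<equiv> complex_of_real (1 / frob_norm Zh) \<cdot>\<^sub>m Zh"
    and "C1 \<equiv> (\<Sum>k=1..K. \<gamma> k * (trace_norm (L k))\<^sup>2)"
  shows "Z' \<in> carrier_mat m (dim_col Zh)" "(frob_norm Z')\<^sup>2 = 1"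
    "trace_norm (P \<tau> - Z' * mat_adjoint Z') \<le> trace_norm (P 0 - Z * mat_adjoint Z)
      + (C1\<^sup>2 / 2 + 3 * C1 * trace_norm A) * \<tau>\<^sup>2 + 2 * (1 + \<tau> * C1) * e + 2 * tol2"
proof -
  interpret G: lindblad_generator m "{1..K}" \<gamma> L A by (rule gen)
  have C1: "G.jump_bound = C1" unfolding G.jump_bound_def C1_def ..
  define \<sigma> where "\<sigma> = Z * mat_adjoint Z"
  have \<sigma>: "\<sigma> \<in> carrier_mat m m" unfolding \<sigma>_def using Z by auto
  have n\<sigma>: "trace_norm \<sigma> \<le> 1" unfolding \<sigma>_def using trace_norm_gram_le[OF Z(1)] Z(2) by simp
  have t\<sigma>: "mat_trace \<sigma> = 1" unfolding \<sigma>_def mat_trace_self_adjoint_product Z(2) by simp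
  define B where "B = E * \<sigma> * mat_adjoint E"
  have B: "B \<in> carrier_mat m m" unfolding B_def using E \<sigma> by (intro mult_carrier_mat[of _ m m _ m]) auto
  define W where "W = lree_expand m K \<gamma> L \<tau> E Z"
  have W: "W \<in> carrier_mat m (dim_col W)"
    unfolding W_def lree_expand_def Let_def hcat_def by (intro carrier_matI) auto
  define Y where "Y = G.euler_step \<sigma> \<tau>"
  have Y: "Y \<in> carrier_mat m m" unfolding Y_def by (rule G.euler_step_carrier[OF \<sigma>])
  have WW: "W * mat_adjoint W = B + complex_of_real \<tau> \<cdot>\<^sub>m jump m {1..K} \<gamma> L B"
    unfolding W_def B_def \<sigma>_def by (rule lree_expand_gram[OF E Z(1) \<tau> G.L_carrier G.rates_nonneg])
  have WWc: "W * mat_adjoint W \<in> carrier_mat m m" unfolding WW using B by simp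
  have rows: "dim_row Zh = m" and c: "trace_norm (W * mat_adjoint W - Zh * mat_adjoint Zh) \<le> tol2"
    using column_compression_error[OF W tol2 comp[folded W_def]] by auto
  have Zh: "Zh \<in> carrier_mat m (dim_col Zh)" using rows by (intro carrier_matI) simp_all
  have ZZc: "Zh * mat_adjoint Zh \<in> carrier_mat m m" by (rule mult_carrier_mat[OF Zh mat_adjoint_carrier[OF Zh]])
  have nz': "Zh \<noteq> 0\<^sub>m m (dim_col Zh)" using nz rows by simp
  show Z'c: "Z' \<in> carrier_mat m (dim_col Zh)" unfolding Z'_def by (rule smult_carrier_mat[OF Zh])
  note norm = normalization_error[OF Zh nz', folded Z'_def]
  show "(frob_norm Z')\<^sup>2 = 1" by (rule norm(1))
  have Z'Z': "Z' * mat_adjoint Z' \<in> carrier_mat m m" by (rule mult_carrier_mat[OF Z'c mat_adjoint_carrier[OF Z'c]])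
  let ?a = "(1 + \<tau> * C1) * e" and ?c = "trace_norm A"
  have nonneg: "0 \<le> C1" "0 \<le> ?c" using G.jump_bound_nonneg trace_norm_nonneg[OF G.A_carrier] unfolding C1 by auto
  have a: "trace_norm (Y - W * mat_adjoint W) \<le> ?a"
    using G.perturbed_step_le[OF \<sigma> B \<tau>, of e] Eerr
    unfolding WW Y_def C1 B_def \<sigma>_def G.drift_flow_def by simp
  have exact: "trace_norm (P \<tau> - Y) \<le> trace_norm (P 0 - \<sigma>) + (2 * C1 * ?c + C1\<^sup>2 / 2) * \<tau>\<^sup>2"
  proof -
    have "trace_norm (P \<tau> - Y) \<le> trace_norm (P 0 - \<sigma>) + (2 * C1 * ?c + C1\<^sup>2 / 2) * trace_norm \<sigma> * \<tau>\<^sup>2"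
      using G.exact_minus_euler_step_le[OF \<sigma> \<tau> P deriv] unfolding Y_def C1 .
    also have "(2 * C1 * ?c + C1\<^sup>2 / 2) * trace_norm \<sigma> * \<tau>\<^sup>2 \<le> (2 * C1 * ?c + C1\<^sup>2 / 2) * 1 * \<tau>\<^sup>2"
      using n\<sigma> nonneg by (intro mult_right_mono mult_left_mono) auto
    finally show ?thesis by simp
  qed
  \<comment> \<open>\<open>W\<close> and \<open>Zh\<close> are compared with \<open>Y\<close> in trace norm, which controls the trace; the trace of \<open>Y\<close>
    is one up to second order.\<close>
  have "\<bar>(frob_norm Zh)\<^sup>2 - 1\<bar> \<le> C1 * ?c * \<tau>\<^sup>2 + ?a + tol2"
  proof -
    have 1: "\<bar>Re (mat_trace Y) - 1\<bar> \<le> C1 * ?c * \<tau>\<^sup>2"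
    proof -
      have "\<bar>Re (mat_trace Y) - 1\<bar> \<le> C1 * ?c * trace_norm \<sigma> * \<tau>\<^sup>2"
        using G.trace_euler_step_defect[OF \<sigma> \<tau>] unfolding Y_def C1 t\<sigma> by simp
      also have "\<dots> \<le> C1 * ?c * 1 * \<tau>\<^sup>2"
        using n\<sigma> nonneg by (intro mult_right_mono mult_left_mono) auto
      finally show ?thesis by simp
    qed
    have 2: "\<bar>Re (mat_trace Y) - Re (mat_trace (W * mat_adjoint W))\<bar> \<le> ?a"
      using order.trans[OF order.trans[OF abs_Re_le_cmod norm_trace_le[OF minus_carrier_mat[OF WWc]]] a]
      by (simp add: mat_trace_minus[OF Y WWc])
    have 3: "\<bar>Re (mat_trace (W * mat_adjoint W)) - Re (mat_trace (Zh * mat_adjoint Zh))\<bar> \<le> tol2"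
      using order.trans[OF order.trans[OF abs_Re_le_cmod norm_trace_le[OF minus_carrier_mat[OF ZZc]]] c]
      by (simp add: mat_trace_minus[OF WWc ZZc])
    have "Re (mat_trace (Zh * mat_adjoint Zh)) = (frob_norm Zh)\<^sup>2"
      unfolding mat_trace_self_adjoint_product by (simp del: of_real_power)
    thus ?thesis using 1 2 3 by linarith
  qed
  hence n: "trace_norm (Zh * mat_adjoint Zh - Z' * mat_adjoint Z') \<le> C1 * ?c * \<tau>\<^sup>2 + ?a + tol2"
    using norm(2) by linarith
  have P\<tau>: "P \<tau> \<in> carrier_mat m m" using P \<tau> by simp
  have "trace_norm (P \<tau> - Z' * mat_adjoint Z') \<le> trace_norm (P \<tau> - Y) + trace_norm (Y - W * mat_adjoint W)
      + trace_norm (W * mat_adjoint W - Zh * mat_adjoint Zh) + trace_norm (Zh * mat_adjoint Zh - Z' * mat_adjoint Z')"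
    using trace_norm_triangle[OF P\<tau> Y Z'Z'] trace_norm_triangle[OF Y WWc Z'Z'] trace_norm_triangle[OF WWc ZZc Z'Z']
    by linarith
  also have "\<dots> \<le> (trace_norm (P 0 - \<sigma>) + (2 * C1 * ?c + C1\<^sup>2 / 2) * \<tau>\<^sup>2) + ?a + tol2 + (C1 * ?c * \<tau>\<^sup>2 + ?a + tol2)"
    using exact a c n by (intro add_mono)
  also have "\<dots> = trace_norm (P 0 - \<sigma>) + (C1\<^sup>2 / 2 + 3 * C1 * ?c) * \<tau>\<^sup>2 + 2 * (1 + \<tau> * C1) * e + 2 * tol2"
    by (simp add: algebra_simps)
  finally show "trace_norm (P \<tau> - Z' * mat_adjoint Z') \<le> trace_norm (P 0 - Z * mat_adjoint Z)
      + (C1\<^sup>2 / 2 + 3 * C1 * trace_norm A) * \<tau>\<^sup>2 + 2 * (1 + \<tau> * C1) * e + 2 * tol2"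
    by (simp only: \<sigma>_def)
qed

theorem theorem5p3:
  fixes m K N r0 :: nat
    and T \<tau> \<delta> \<epsilon>1 \<epsilon>2 tol1 tol2 C1 C2 C3 c1 c1' c2 :: real
    and H A E \<rho>0 Z0 :: "complex mat"
    and L Z Zh :: "nat \<Rightarrow> complex mat"
    and \<gamma> :: "nat \<Rightarrow> real"
    and \<rho> :: "real \<Rightarrow> complex mat"
  assumes "m > 0" and "K > 0" and "N > 0" and "r0 > 0" and "T > 0"
    and "\<tau> = T / real N"
    and "H \<in> carrier_mat m m" and "hermitian_mat H"
    and "\<And>k. k \<in> {1..K} \<Longrightarrow> L k \<in> carrier_mat m m"
    and "\<And>k. k \<in> {1..K} \<Longrightarrow> \<gamma> k \<ge> 0"
    and "A = drift_mat m K H \<gamma> L"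
    and "C1 = (\<Sum>k=1..K. \<gamma> k * (trace_norm (L k))\<^sup>2)"
    and "C2 = trace_norm A"
    and "C3 > 0"
    and "\<rho>0 \<in> carrier_mat m m" and "psd_mat \<rho>0" and "mat_trace \<rho>0 = 1"
    and "lindblad_solution m K H \<gamma> L T \<rho>0 \<rho>"
    and "Z0 \<in> carrier_mat m r0"
    and "mat_trace (Z0 * mat_adjoint Z0) = 1"
    and "\<delta> > 0"
    and "trace_norm (\<rho>0 - Z0 * mat_adjoint Z0) \<le> \<delta>"
    and "\<epsilon>1 > 0" and "\<epsilon>2 > 0"
    and "tol1 = \<tau> * \<epsilon>1" and "tol2 = \<tau> * \<epsilon>2"
    and "E \<in> carrier_mat m m"
    and "\<And>\<sigma>. \<sigma> \<in> carrier_mat m m \<Longrightarrow>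
      trace_norm (mat_exp (complex_of_real \<tau> \<cdot>\<^sub>m A) * \<sigma> * mat_exp (complex_of_real \<tau> \<cdot>\<^sub>m mat_adjoint A)
                  - E * \<sigma> * mat_adjoint E)
        \<le> C3 * tol1 * trace_norm \<sigma>"
    and "lree_scheme m K N \<gamma> L \<tau> E tol2 Z0 Z Zh"
    and "c1 = 1/2 * C1\<^sup>2 + C1 * C2 + 1/3 * C1 * C2\<^sup>2 * T"
    and "c2 = (1 + T * C1) * C3"
    and "c1' = c1 + 2 * C1 * C2"
  shows "\<forall>n\<le>N. trace_norm (\<rho> (real n * \<tau>) - Z n * mat_adjoint (Z n))
           \<le> c1' * (real n * \<tau>) * \<tau> + \<delta> + 2 * c2 * (real n * \<tau>) * \<epsilon>1 + 2 * (real n * \<tau>) * \<epsilon>2"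
proof -
  note N = \<open>N > 0\<close> and T = \<open>T > 0\<close> and \<tau>_eq = \<open>\<tau> = T / real N\<close>
  note H = \<open>H \<in> carrier_mat m m\<close> \<open>hermitian_mat H\<close> and L = assms(9) and \<gamma> = assms(10)
  note A_eq = \<open>A = drift_mat m K H \<gamma> L\<close> and scheme = \<open>lree_scheme m K N \<gamma> L \<tau> E tol2 Z0 Z Zh\<close>
  note solution = \<open>lindblad_solution m K H \<gamma> L T \<rho>0 \<rho>\<close> and E_err = assms(28)
  have \<tau>: "0 < \<tau>" "real N * \<tau> = T" using N T by (auto simp: \<tau>_eq)
  have \<tau>T: "\<tau> \<le> T" using N T by (simp add: \<tau>_eq divide_simps)
  have A: "A \<in> carrier_mat m m" unfolding A_eq by (rule drift_mat_carrier[OF H(1)])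
  have gen: "lindblad_generator m {1..K} \<gamma> L A"
  proof
    show "A + mat_adjoint A + mat_sum m m {1..K} (\<lambda>k. complex_of_real (\<gamma> k) \<cdot>\<^sub>m (mat_adjoint (L k) * L k)) = 0\<^sub>m m m"
      unfolding A_eq by (rule drift_mat_balance[OF H L])
  qed (use A L \<gamma> in auto)
  have C1: "0 \<le> C1" unfolding \<open>C1 = _\<close> using \<gamma> by (intro sum_nonneg mult_nonneg_nonneg) auto
  have C2: "0 \<le> C2" unfolding \<open>C2 = _\<close> by (rule trace_norm_nonneg[OF A])
  have \<rho>: "\<rho> t \<in> carrier_mat m m" if "t \<in> {0..T}" for t
    using solution that by (simp add: lindblad_solution_def)
  have deriv: "((\<lambda>s. \<rho> s $$ (i, j)) has_vector_derivative gen m {1..K} \<gamma> L A (\<rho> t) $$ (i, j)) (at t within {0..T})"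
    if "t \<in> {0..T}" "i < m" "j < m" for t i j
  proof -
    have "lindblad_rhs m K H \<gamma> L (\<rho> t) = gen m {1..K} \<gamma> L A (\<rho> t)"
      unfolding A_eq by (rule lindblad_rhs_eq_gen[OF H L \<rho>[OF that(1)]])
    thus ?thesis using solution that unfolding lindblad_solution_def by metis
  qed
  define d where "d = (C1\<^sup>2 / 2 + 3 * C1 * C2) * \<tau>\<^sup>2 + 2 * (1 + \<tau> * C1) * (C3 * tol1) + 2 * tol2"
  have main: "(\<exists>q. Z n \<in> carrier_mat m q) \<and> (frob_norm (Z n))\<^sup>2 = 1 \<and>
      trace_norm (\<rho> (real n * \<tau>) - Z n * mat_adjoint (Z n)) \<le> \<delta> + real n * d" if "n \<le> N" for n
    using that
  proof (induction n)
    case 0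
    have "complex_of_real ((frob_norm Z0)\<^sup>2) = complex_of_real 1"
      using assms(20) unfolding mat_trace_self_adjoint_product by simp
    hence "(frob_norm Z0)\<^sup>2 = 1" by (simp only: of_real_eq_iff)
    thus ?case
      using assms(19,22) scheme solution by (auto simp: lree_scheme_def lindblad_solution_def)
  next
    case (Suc n)
    then obtain q where Z: "Z n \<in> carrier_mat m q" "(frob_norm (Z n))\<^sup>2 = 1"
      and IH: "trace_norm (\<rho> (real n * \<tau>) - Z n * mat_adjoint (Z n)) \<le> \<delta> + real n * d" by auto
    have comp: "column_compression tol2 (lree_expand m K \<gamma> L \<tau> E (Z n)) (Zh (Suc n))"
      and nz: "Zh (Suc n) \<noteq> 0\<^sub>m (dim_row (Zh (Suc n))) (dim_col (Zh (Suc n)))"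
      and ZS: "Z (Suc n) = complex_of_real (1 / frob_norm (Zh (Suc n))) \<cdot>\<^sub>m Zh (Suc n)"
      using scheme Suc.prems by (auto simp: lree_scheme_def)
    have ZZ: "Z n * mat_adjoint (Z n) \<in> carrier_mat m m" using Z by auto
    have "trace_norm (Z n * mat_adjoint (Z n)) \<le> 1" using trace_norm_gram_le[OF Z(1)] Z(2) by simp
    hence "C3 * tol1 * trace_norm (Z n * mat_adjoint (Z n)) \<le> C3 * tol1 * 1"
      using \<open>C3 > 0\<close> \<open>tol1 = _\<close> \<open>\<epsilon>1 > 0\<close> \<tau> by (intro mult_left_mono) auto
    with E_err[OF ZZ] have err: "trace_norm (mat_exp (complex_of_real \<tau> \<cdot>\<^sub>m A) * (Z n * mat_adjoint (Z n)) * mat_exp (complex_of_real \<tau> \<cdot>\<^sub>m mat_adjoint A)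
                  - E * (Z n * mat_adjoint (Z n)) * mat_adjoint E) \<le> C3 * tol1" by simp
    have "real (Suc n) * \<tau> \<le> real N * \<tau>" using Suc.prems \<tau>(1) by (intro mult_right_mono) auto
    hence range: "real n * \<tau> + s \<in> {0..T}" if "s \<in> {0..\<tau>}" for s
      using that \<tau> by (auto simp: distrib_right)
    have tol2: "0 \<le> tol2" using \<open>tol2 = _\<close> \<open>\<epsilon>2 > 0\<close> \<tau> by simp
    note step = scheme_step_error[OF gen less_imp_le[OF \<tau>(1)] tol2 \<open>E \<in> carrier_mat m m\<close> Z err comp nz,
        where P = "\<lambda>s. \<rho> (real n * \<tau> + s)", folded ZS \<open>C1 = _\<close> \<open>C2 = _\<close>]
    have P: "\<rho> (real n * \<tau> + s) \<in> carrier_mat m m" if "s \<in> {0..\<tau>}" for s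
      using \<rho>[OF range[OF that]] .
    have PD: "has_mat_derivative m (\<lambda>s. \<rho> (real n * \<tau> + s)) (gen m {1..K} \<gamma> L A (\<rho> (real n * \<tau> + s))) (at s within {0..\<tau>})"
      if s: "s \<in> {0..\<tau>}" for s
      unfolding has_mat_derivative_def
      by (intro allI impI has_vector_derivative_shift_within[OF deriv[OF range[OF s]]] range)
    have "trace_norm (\<rho> (real n * \<tau> + \<tau>) - Z (Suc n) * mat_adjoint (Z (Suc n)))
        \<le> trace_norm (\<rho> (real n * \<tau>) - Z n * mat_adjoint (Z n)) + d"
      using step(3)[OF P PD] by (simp add: d_def)
    moreover have "real n * \<tau> + \<tau> = real (Suc n) * \<tau>" by (simp add: algebra_simps)
    ultimately have "trace_norm (\<rho> (real (Suc n) * \<tau>) - Z (Suc n) * mat_adjoint (Z (Suc n))) \<le> \<delta> + real (Suc n) * d"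
      using IH by (simp add: algebra_simps)
    thus ?case using step(1,2)[OF P PD] by blast
  qed
  have d: "d \<le> (c1' * \<tau> + 2 * c2 * \<epsilon>1 + 2 * \<epsilon>2) * \<tau>"
  proof -
    have "C1\<^sup>2 / 2 + 3 * C1 * C2 \<le> c1'"
      using C1 C2 T by (simp add: \<open>c1' = _\<close> \<open>c1 = _\<close>)
    hence 1: "(C1\<^sup>2 / 2 + 3 * C1 * C2) * \<tau>\<^sup>2 \<le> c1' * \<tau>\<^sup>2" by (rule mult_right_mono) simp
    have "(1 + \<tau> * C1) * C3 \<le> c2"
      unfolding \<open>c2 = _\<close> using \<tau>T C1 \<open>C3 > 0\<close> by (intro mult_right_mono add_left_mono) auto
    hence 2: "(1 + \<tau> * C1) * C3 * (\<tau> * \<epsilon>1) \<le> c2 * (\<tau> * \<epsilon>1)"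
      using \<tau> \<open>\<epsilon>1 > 0\<close> by (intro mult_right_mono) auto
    show ?thesis
      using 1 2 by (simp add: d_def \<open>tol1 = _\<close> \<open>tol2 = _\<close> power2_eq_square algebra_simps)
  qed
  show ?thesis
  proof (intro allI impI)
    fix n assume n: "n \<le> N"
    have "trace_norm (\<rho> (real n * \<tau>) - Z n * mat_adjoint (Z n)) \<le> \<delta> + real n * d"
      using main[OF n] by simp
    also have "\<dots> \<le> \<delta> + real n * ((c1' * \<tau> + 2 * c2 * \<epsilon>1 + 2 * \<epsilon>2) * \<tau>)"
      using d by (intro add_left_mono mult_left_mono) auto
    also have "\<dots> = c1' * (real n * \<tau>) * \<tau> + \<delta> + 2 * c2 * (real n * \<tau>) * \<epsilon>1 + 2 * (real n * \<tau>) * \<epsilon>2"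
      by (simp add: algebra_simps)
    finally show "trace_norm (\<rho> (real n * \<tau>) - Z n * mat_adjoint (Z n))
           \<le> c1' * (real n * \<tau>) * \<tau> + \<delta> + 2 * c2 * (real n * \<tau>) * \<epsilon>1 + 2 * (real n * \<tau>) * \<epsilon>2" .
  qed
qed

end
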